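(* Given a connected undirected graph $G$ with $n$ vertices and $m$ edges, in $O(m+n)$ time and using $O(m+n)$ bits of working space one can determine whether $G$ is $2$-vertex connected and/or $2$-edge connected. If not, in the same amount of time and space, one can compute all the bridges and cut vertices of $G$.
   Context: A cut vertex is a vertex whose removal (with its incident edges) increases the number of connected components; a bridge is an edge whose removal increases the number of components. A connected graph with at least three vertices is $2$-vertex connected (biconnected) iff it has no cut vertex; a connected graph with at least two vertices is $2$-edge connected iff it has no bridge. Model: the input graph is in read-only memory as an adjacency list with cross pointers (given a vertex $u$ and the position in its list of a neighbour $v$, there is a pointer to the position of $u$ in the list of $v$); only additional workspace is counted, in bits, on a word RAM with words of $\Omega(\lg n)$ bits. *)

theory Defs
  imports Complex_Main
begin

section \<open>Connectivity of undirected graphs\<close>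

text \<open>An edge is a two-element set of vertices: graphs have no loops and no parallel edges.\<close>

definition simple_graph :: "'a set \<Rightarrow> 'a set set \<Rightarrow> bool" where
  "simple_graph V E \<longleftrightarrow> finite V \<and> (\<forall>e\<in>E. e \<subseteq> V \<and> card e = 2)"

definition linked_by_path :: "'a set \<Rightarrow> 'a set set \<Rightarrow> ('a \<times> 'a) set" where
  "linked_by_path V E = {(x, y). {x, y} \<in> E}\<^sup>* \<inter> V \<times> V"

definition components :: "'a set \<Rightarrow> 'a set set \<Rightarrow> 'a set set" where
  "components V E = V // linked_by_path V E"

definition connected_graph :: "'a set \<Rightarrow> 'a set set \<Rightarrow> bool" where
  "connected_graph V E \<longleftrightarrow> card (components V E) = 1"

definition cut_vertices :: "'a set \<Rightarrow> 'a set set \<Rightarrow> 'a set" where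
  "cut_vertices V E =
     {v \<in> V. card (components (V - {v}) {e \<in> E. v \<notin> e}) > card (components V E)}"

definition bridges :: "'a set \<Rightarrow> 'a set set \<Rightarrow> 'a set set" where
  "bridges V E = {e \<in> E. card (components V (E - {e})) > card (components V E)}"

definition two_vertex_connected :: "'a set \<Rightarrow> 'a set set \<Rightarrow> bool" where
  "two_vertex_connected V E \<longleftrightarrow>
     connected_graph V E \<and> card V \<ge> 3 \<and> cut_vertices V E = {}"

definition two_edge_connected :: "'a set \<Rightarrow> 'a set set \<Rightarrow> bool" where
  "two_edge_connected V E \<longleftrightarrow>
     connected_graph V E \<and> card V \<ge> 2 \<and> bridges V E = {}"


section \<open>Adjacency lists with cross pointers\<close>

text \<open>
  The graph on the vertices \<open>0, \<dots>, n - 1\<close> with \<open>m\<close> edges is stored in a block of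
  \<open>2 + n + 6 * m\<close> words:
  \<^item> word \<open>0\<close> is \<open>n\<close> and word \<open>1\<close> is \<open>m\<close>;
  \<^item> word \<open>2 + v\<close> is the address of the first cell of the list of \<open>v\<close>;
  \<^item> the rest is divided into \<open>2 * m\<close> cells of three words: the neighbour, the address of
    the next cell of the same list, and the cross pointer.

  Address \<open>0\<close> is the null pointer. Nothing is assumed about the order of the neighbours
  in a list or about where in the block the cells of a list lie.
\<close>

definition cell_addrs :: "nat \<Rightarrow> nat \<Rightarrow> nat set" where
  "cell_addrs n m = {2 + n + 3 * k | k. k < 2 * m}"

definition neighbour :: "nat list \<Rightarrow> nat \<Rightarrow> nat" where
  "neighbour inp c = inp ! c"

definition next_cell :: "nat list \<Rightarrow> nat \<Rightarrow> nat" where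
  "next_cell inp c = inp ! (c + 1)"

definition cross :: "nat list \<Rightarrow> nat \<Rightarrow> nat" where
  "cross inp c = inp ! (c + 2)"

text \<open>The cells met when following the next-pointers from address \<open>a\<close> are exactly \<open>cs\<close>.\<close>

fun cell_chain :: "nat list \<Rightarrow> nat \<Rightarrow> nat list \<Rightarrow> bool" where
  "cell_chain inp a [] \<longleftrightarrow> a = 0"
| "cell_chain inp a (c # cs) \<longleftrightarrow> a = c \<and> cell_chain inp (next_cell inp c) cs"

definition adjacency_list :: "nat \<Rightarrow> nat set set \<Rightarrow> nat list \<Rightarrow> bool" where
  "adjacency_list n E inp \<longleftrightarrow>
     length inp = 2 + n + 6 * card E \<and> inp ! 0 = n \<and> inp ! 1 = card E \<and>
     (\<exists>L :: nat \<Rightarrow> nat list.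
        (\<forall>v<n. cell_chain inp (inp ! (2 + v)) (L v) \<and>
               distinct (L v) \<and> set (L v) \<subseteq> cell_addrs n (card E) \<and>
               bij_betw (neighbour inp) (set (L v)) {u. {v, u} \<in> E}) \<and>
        (\<forall>u<n. \<forall>c\<in>set (L u).
               cross inp c \<in> set (L (neighbour inp c)) \<and>
               neighbour inp (cross inp c) = u))"


section \<open>A word RAM\<close>

text \<open>
  Words have \<open>w\<close> bits and are represented by the naturals below \<open>2 ^ w\<close>. A program has
  finitely many registers, a read-only input, a random access working memory and a
  write-only output. It is fixed independently of \<open>w\<close>, which it can refer to by
  \<open>WordSize\<close>.
\<close>

datatype binop =
  Add | Sub | Mul | Div | Mod | BitAnd | BitOr | BitXor | ShiftL | ShiftR | Less | Equal

datatype exp = Reg nat | Const nat | WordSize | Bin binop exp exp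

datatype com =
    Skip
  | Assign nat exp
  | ReadInput nat exp    \<comment> \<open>target register, address\<close>
  | Load nat exp         \<comment> \<open>target register, address\<close>
  | Store exp exp        \<comment> \<open>address, value\<close>
  | Output exp
  | Seq com com
  | If exp com com
  | While exp com

fun binop_val :: "nat \<Rightarrow> binop \<Rightarrow> nat \<Rightarrow> nat \<Rightarrow> nat" where
  "binop_val w Add a b = (a + b) mod 2 ^ w"
| "binop_val w Sub a b = (a + (2 ^ w - b)) mod 2 ^ w"
| "binop_val w Mul a b = (a * b) mod 2 ^ w"
| "binop_val w Div a b = a div b"
| "binop_val w Mod a b = a mod b"
| "binop_val w BitAnd a b = Bit_Operations.and a b"
| "binop_val w BitOr a b = Bit_Operations.or a b"
| "binop_val w BitXor a b = Bit_Operations.xor a b"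
| "binop_val w ShiftL a b = push_bit b a mod 2 ^ w"
| "binop_val w ShiftR a b = drop_bit b a"
| "binop_val w Less a b = of_bool (a < b) mod 2 ^ w"
| "binop_val w Equal a b = of_bool (a = b) mod 2 ^ w"

fun exp_val :: "nat \<Rightarrow> (nat \<Rightarrow> nat) \<Rightarrow> exp \<Rightarrow> nat" where
  "exp_val w r (Reg i) = r i"
| "exp_val w r (Const k) = k mod 2 ^ w"
| "exp_val w r WordSize = w"
| "exp_val w r (Bin f e1 e2) = binop_val w f (exp_val w r e1) (exp_val w r e2)"

fun exp_cost :: "exp \<Rightarrow> nat" where
  "exp_cost (Bin f e1 e2) = 1 + exp_cost e1 + exp_cost e2"
| "exp_cost _ = 1"

fun exp_regs :: "exp \<Rightarrow> nat set" where
  "exp_regs (Reg i) = {i}"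
| "exp_regs (Bin f e1 e2) = exp_regs e1 \<union> exp_regs e2"
| "exp_regs _ = {}"

fun com_regs :: "com \<Rightarrow> nat set" where
  "com_regs Skip = {}"
| "com_regs (Assign i e) = insert i (exp_regs e)"
| "com_regs (ReadInput i e) = insert i (exp_regs e)"
| "com_regs (Load i e) = insert i (exp_regs e)"
| "com_regs (Store e1 e2) = exp_regs e1 \<union> exp_regs e2"
| "com_regs (Output e) = exp_regs e"
| "com_regs (Seq c1 c2) = com_regs c1 \<union> com_regs c2"
| "com_regs (If e c1 c2) = exp_regs e \<union> com_regs c1 \<union> com_regs c2"
| "com_regs (While e c) = exp_regs e \<union> com_regs c"

record state =
  regs :: "nat \<Rightarrow> nat"
  mem :: "nat list"
  outp :: "nat list"

definition initial_state :: "nat \<Rightarrow> state" where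
  "initial_state s = \<lparr>regs = (\<lambda>_. 0), mem = replicate s 0, outp = []\<rparr>"

text \<open>
  \<open>runs w inp c \<sigma> t \<sigma>'\<close>: started in \<open>\<sigma>\<close> on the read-only input \<open>inp\<close>, program \<open>c\<close>
  halts in \<open>\<sigma>'\<close> after \<open>t\<close> steps. The working memory keeps the length it has in \<open>\<sigma>\<close>, and a
  program that accesses the input or the working memory out of bounds has no run. Hence
  a run from \<open>initial_state s\<close> certifies that \<open>s\<close> words of working memory suffice.
\<close>

inductive runs :: "nat \<Rightarrow> nat list \<Rightarrow> com \<Rightarrow> state \<Rightarrow> nat \<Rightarrow> state \<Rightarrow> bool"
  for w :: nat and inp :: "nat list" where
  Skip: "runs w inp Skip \<sigma> 1 \<sigma>"
| Assign: "runs w inp (Assign i e) \<sigma> (1 + exp_cost e)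
     (\<sigma>\<lparr>regs := (regs \<sigma>)(i := exp_val w (regs \<sigma>) e)\<rparr>)"
| ReadInput: "a = exp_val w (regs \<sigma>) e \<Longrightarrow> a < length inp \<Longrightarrow>
     runs w inp (ReadInput i e) \<sigma> (1 + exp_cost e)
       (\<sigma>\<lparr>regs := (regs \<sigma>)(i := inp ! a mod 2 ^ w)\<rparr>)"
| Load: "a = exp_val w (regs \<sigma>) e \<Longrightarrow> a < length (mem \<sigma>) \<Longrightarrow>
     runs w inp (Load i e) \<sigma> (1 + exp_cost e)
       (\<sigma>\<lparr>regs := (regs \<sigma>)(i := mem \<sigma> ! a)\<rparr>)"
| Store: "a = exp_val w (regs \<sigma>) e1 \<Longrightarrow> a < length (mem \<sigma>) \<Longrightarrow>
     runs w inp (Store e1 e2) \<sigma> (1 + exp_cost e1 + exp_cost e2)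
       (\<sigma>\<lparr>mem := (mem \<sigma>)[a := exp_val w (regs \<sigma>) e2]\<rparr>)"
| Output: "runs w inp (Output e) \<sigma> (1 + exp_cost e)
     (\<sigma>\<lparr>outp := outp \<sigma> @ [exp_val w (regs \<sigma>) e]\<rparr>)"
| Seq: "runs w inp c1 \<sigma> t1 \<sigma>1 \<Longrightarrow> runs w inp c2 \<sigma>1 t2 \<sigma>2 \<Longrightarrow>
     runs w inp (Seq c1 c2) \<sigma> (t1 + t2) \<sigma>2"
| IfTrue: "exp_val w (regs \<sigma>) e \<noteq> 0 \<Longrightarrow> runs w inp c1 \<sigma> t \<sigma>1 \<Longrightarrow>
     runs w inp (If e c1 c2) \<sigma> (1 + exp_cost e + t) \<sigma>1"
| IfFalse: "exp_val w (regs \<sigma>) e = 0 \<Longrightarrow> runs w inp c2 \<sigma> t \<sigma>1 \<Longrightarrow>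
     runs w inp (If e c1 c2) \<sigma> (1 + exp_cost e + t) \<sigma>1"
| WhileFalse: "exp_val w (regs \<sigma>) e = 0 \<Longrightarrow>
     runs w inp (While e c) \<sigma> (1 + exp_cost e) \<sigma>"
| WhileTrue: "exp_val w (regs \<sigma>) e \<noteq> 0 \<Longrightarrow> runs w inp c \<sigma> t1 \<sigma>1 \<Longrightarrow>
     runs w inp (While e c) \<sigma>1 t2 \<sigma>2 \<Longrightarrow>
     runs w inp (While e c) \<sigma> (1 + exp_cost e + t1 + t2) \<sigma>2"

text \<open>
  The working space in bits, counting the registers as well as the working memory, in
  whole words. Since one register already takes \<open>w\<close> bits, and \<open>w\<close> is not bounded above,
  a bound of \<open>O(f)\<close> bits reads \<open>O(f + w)\<close>; the two agree whenever \<open>w\<close> is \<open>O(f)\<close>.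
\<close>

definition space_bits :: "nat \<Rightarrow> com \<Rightarrow> nat \<Rightarrow> nat" where
  "space_bits w c s = w * (card (com_regs c) + s)"


section \<open>The required output\<close>

text \<open>
  Two answer bits, then the number of bridges, then the end points of every bridge, then
  the cut vertices. Every bridge and every cut vertex is listed exactly once.
\<close>

definition connectivity_report :: "nat set \<Rightarrow> nat set set \<Rightarrow> nat list \<Rightarrow> bool" where
  "connectivity_report V E out \<longleftrightarrow>
     (\<exists>(bs :: (nat \<times> nat) list) (cs :: nat list).
        out = [of_bool (two_vertex_connected V E), of_bool (two_edge_connected V E), length bs]
              @ concat (map (\<lambda>(u, v). [u, v]) bs) @ cs \<and>
        distinct (map (\<lambda>(u, v). {u, v}) bs) \<and>
        set (map (\<lambda>(u, v). {u, v}) bs) = bridges V E \<and>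
        distinct cs \<and> set cs = cut_vertices V E)"

end

theory Submission
  imports Defs
begin

text \<open>
  A depth-first search with one bit per cell needs no stack: the bits mark the cell of every
  vertex that points to its parent. To backtrack from a vertex, scan its list for the
  marked cell and resume after the cross pointer of that cell in the list of the
  parent; every list is scanned only once for this purpose.

  All edges outside the search tree join a vertex to an ancestor. The tree edge above
  \<open>x\<close> is a bridge iff no such edge \<open>{t, u}\<close> spans it, that is, joins the subtree of \<open>x\<close> to a
  proper ancestor \<open>t\<close> of \<open>x\<close>; and \<open>v\<close>, not the root, is a cut vertex iff it has a child that is
  spanned by no edge with \<open>t \<noteq> v\<close>. The root is a cut vertex iff it has two children.

  To find the spanned vertices, repeat the search, which is deterministic and hence
  builds the same tree. On entering \<open>t\<close>, walk up the tree from every \<open>u\<close> joined to \<open>t\<close> from below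
  outside the tree, marking the vertices met, until the walk is about to reach \<open>t\<close> or meets
  a marked vertex. Since ancestors are entered first, everything between that vertex and \<open>t\<close> is
  then marked already, so each vertex is marked once and the walks take linear time.
\<close>

section \<open>Depth-first search trees and connectivity\<close>

text \<open>The textbook algorithm stores depth-first numbers and lowpoints, hence on the order of n
  log n bits; with O(1) bits per cell no vertex can carry a number. Two uses of numbers have to be
  replaced. A lowpoint is only ever compared with the depths of \<open>x\<close> and of its parent,
  so the two sets \<open>covered\<close> and \<open>high\<close> hold all that is needed of it. And
  which end of an edge is the ancestor is read off the visited bits: on entering \<open>t\<close>,
  its neighbours visited before are ancestors, the others descendants. This is why the search runs
  twice: edges are treated at their upper end, at a time when the parent cells of all descendants
  must already be known. A walk is not bounded by the degree of \<open>t\<close>, so running times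
  are amortised: potentials are part of the loop invariants, with generous numerals that absorb the
  constants of the cost model.\<close>

lemma linked_by_path_equiv: "equiv V (linked_by_path V E)"
proof (rule equivI)
  show "linked_by_path V E \<subseteq> V \<times> V" by (auto simp: linked_by_path_def)
  show "refl_on V (linked_by_path V E)"
    by (auto simp: refl_on_def linked_by_path_def)
  have "sym ({(x, y). {x, y} \<in> E}\<^sup>*)"
    by (rule sym_rtrancl) (auto simp: sym_def insert_commute)
  then show "sym (linked_by_path V E)"
    by (auto simp: linked_by_path_def sym_def)
  show "trans (linked_by_path V E)"
    by (auto simp: linked_by_path_def trans_def)
qed

lemma finite_components: "finite V \<Longrightarrow> finite (components V E)"
  unfolding components_def by (rule finite_quotient) (auto simp: linked_by_path_def)

text \<open>In a connected graph a deletion increases the number of components iff the result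
  exceeds 1, so both criteria become statements about all pairs of vertices. The bound is
  \<open>\<le> 1\<close> because deleting the only vertex leaves no component at all.\<close>

lemma card_components_le_1_iff:
  assumes "finite V"
  shows "card (components V E) \<le> 1 \<longleftrightarrow> V \<times> V \<subseteq> linked_by_path V E"
proof
  assume *: "card (components V E) \<le> 1"
  show "V \<times> V \<subseteq> linked_by_path V E"
  proof clarify
    fix x y assume xy: "x \<in> V" "y \<in> V"
    then have "linked_by_path V E `` {x} \<in> components V E" "linked_by_path V E `` {y} \<in> components V E"
      by (auto simp: components_def quotientI)
    then have "linked_by_path V E `` {x} = linked_by_path V E `` {y}"
      using * card_le_Suc0_iff_eq[OF finite_components[OF assms]] by auto
    then show "(x, y) \<in> linked_by_path V E"
      using eq_equiv_class_iff[OF linked_by_path_equiv xy] by blast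
  qed
next
  assume *: "V \<times> V \<subseteq> linked_by_path V E"
  then have "X = Y" if XY: "X \<in> components V E" "Y \<in> components V E" for X Y
  proof -
    obtain x y where "x \<in> V" "X = linked_by_path V E `` {x}" "y \<in> V" "Y = linked_by_path V E `` {y}"
      using XY unfolding components_def quotient_def by blast
    then show ?thesis using * eq_equiv_class_iff[OF linked_by_path_equiv, of x V y E] by blast
  qed
  then show "card (components V E) \<le> 1"
    using card_le_Suc0_iff_eq[OF finite_components[OF assms]] by auto
qed

lemma components_pos: "finite V \<Longrightarrow> x \<in> V \<Longrightarrow> 0 < card (components V E)"
  by (metis card_gt_0_iff components_def empty_iff finite_components quotientI)

text \<open>Mostly used to refute connectivity: a set closed under edges that contains
  \<open>x\<close> but not \<open>y\<close> separates them.\<close>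

lemma linked_by_path_closed:
  assumes "(x, y) \<in> linked_by_path V E" and "x \<in> A"
    and "\<And>a b. {a, b} \<in> E \<Longrightarrow> a \<in> A \<Longrightarrow> b \<in> A"
  shows "y \<in> A"
proof -
  have "(x, y) \<in> {(x, y). {x, y} \<in> E}\<^sup>*" using assms(1) by (simp add: linked_by_path_def)
  then show ?thesis by (induction rule: rtrancl_induct) (use assms in auto)
qed

lemma all_linked:
  assumes "\<And>y. y \<in> V' \<Longrightarrow> (y, r) \<in> linked_by_path V' E'"
  shows "V' \<times> V' \<subseteq> linked_by_path V' E'"
  using assms linked_by_path_equiv[of V' E'] by (blast elim: equivE dest: symD transD)

lemma linked_trans: "(a, b) \<in> linked_by_path V' E' \<Longrightarrow> (b, c) \<in> linked_by_path V' E' \<Longrightarrow> (a, c) \<in> linked_by_path V' E'"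
  using linked_by_path_equiv[of V' E'] by (auto elim!: equivE dest: transD)

lemma linked_edge: "{a, b} \<in> E' \<Longrightarrow> a \<in> V' \<Longrightarrow> b \<in> V' \<Longrightarrow> (a, b) \<in> linked_by_path V' E'"
  by (auto simp: linked_by_path_def)

section \<open>Rooted trees and back edges\<close>

definition tree_up :: "'a set \<Rightarrow> 'a \<Rightarrow> ('a \<Rightarrow> 'a) \<Rightarrow> ('a \<times> 'a) set" where
  "tree_up V r par = {(x, par x) | x. x \<in> V \<and> x \<noteq> r}"

text \<open>The property that singles out depth-first search trees among spanning trees is
  \<open>edge_comparable\<close>; how the tree was found does not enter. \<open>dep\<close> forbids
  cycles in \<open>par\<close> and lives in the proof only: the program stores no depths.\<close>

locale dfs_tree =
  fixes V :: "'a set" and E :: "'a set set" and root :: 'a and par :: "'a \<Rightarrow> 'a"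
    and dep :: "'a \<Rightarrow> nat"
  assumes finite_V: "finite V"
    and edge_in: "{a, b} \<in> E \<Longrightarrow> a \<in> V \<and> b \<in> V \<and> a \<noteq> b"
    and edge_pair: "e \<in> E \<Longrightarrow> \<exists>a b. e = {a, b}"
    and root_in: "root \<in> V"
    and tree_edge: "x \<in> V \<Longrightarrow> x \<noteq> root \<Longrightarrow> {x, par x} \<in> E"
    and dep_Suc: "x \<in> V \<Longrightarrow> x \<noteq> root \<Longrightarrow> dep x = Suc (dep (par x))"
    and edge_comparable: "{a, b} \<in> E \<Longrightarrow> (a, b) \<in> (tree_up V root par)\<^sup>* \<or> (b, a) \<in> (tree_up V root par)\<^sup>*"
begin

definition anc :: "'a \<Rightarrow> 'a \<Rightarrow> bool" where
  "anc a x \<longleftrightarrow> (x, a) \<in> (tree_up V root par)\<^sup>*"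

lemma par_in: "x \<in> V \<Longrightarrow> x \<noteq> root \<Longrightarrow> par x \<in> V"
  using tree_edge edge_in by blast

lemma anc_refl [simp]: "anc x x" by (simp add: anc_def)

lemma anc_trans: "anc a b \<Longrightarrow> anc b c \<Longrightarrow> anc a c"
  by (auto simp: anc_def)

lemma anc_par: "x \<in> V \<Longrightarrow> x \<noteq> root \<Longrightarrow> anc (par x) x"
  by (auto simp: anc_def tree_up_def)

lemma anc_cases: "anc a x \<Longrightarrow> a = x \<or> (x \<in> V \<and> x \<noteq> root \<and> anc a (par x))"
  unfolding anc_def by (erule converse_rtranclE) (auto simp: tree_up_def)

lemma anc_child: "anc a x \<Longrightarrow> a \<noteq> x \<Longrightarrow> \<exists>c. anc c x \<and> c \<in> V \<and> c \<noteq> root \<and> par c = a"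
  unfolding anc_def by (erule rtranclE) (auto simp: tree_up_def)

lemma anc_dep: "anc a x \<Longrightarrow> a = x \<or> dep a < dep x"
  unfolding anc_def
  by (induction rule: converse_rtrancl_induct) (auto simp: tree_up_def dep_Suc)

lemma anc_antisym: "anc a x \<Longrightarrow> anc x a \<Longrightarrow> a = x"
  using anc_dep[of a x] anc_dep[of x a] by auto

text \<open>Every vertex has at most one upward edge, so of two upward paths from \<open>x\<close>
  one extends the other.\<close>

lemma anc_linear: "anc a x \<Longrightarrow> anc b x \<Longrightarrow> anc a b \<or> anc b a"
  using single_valued_confluent[of "tree_up V root par" x a b]
  by (auto simp: anc_def single_valued_def tree_up_def)

lemma root_anc: "x \<in> V \<Longrightarrow> anc root x"
proof (induction "dep x" arbitrary: x rule: less_induct)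
  case less
  then show ?case
    by (cases "x = root") (auto simp: dep_Suc par_in intro: anc_trans[OF _ anc_par])
qed

lemma anc_in: "anc a x \<Longrightarrow> x \<in> V \<Longrightarrow> a \<in> V"
  unfolding anc_def
  by (induction rule: rtrancl_induct) (auto simp: tree_up_def par_in)

lemma par_neq: "x \<in> V \<Longrightarrow> x \<noteq> root \<Longrightarrow> par x \<noteq> x"
  using dep_Suc by fastforce

text \<open>Since \<open>t\<close> is a proper ancestor of \<open>w\<close>, the single inequation
  \<open>par w \<noteq> t\<close> already says that the edge is not a tree edge.\<close>

definition spans :: "'a \<Rightarrow> 'a \<Rightarrow> 'a \<Rightarrow> bool" where
  "spans t w x \<longleftrightarrow> {t, w} \<in> E \<and> par w \<noteq> t \<and> anc x w \<and> anc t x \<and> t \<noteq> x"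

text \<open>In terms of lowpoints: the lowpoint of \<open>x\<close> lies strictly above
  \<open>x\<close>.\<close>

definition covered :: "'a set" where
  "covered = {x. \<exists>t w. spans t w x}"

text \<open>In terms of lowpoints: the lowpoint of \<open>x\<close> lies strictly above the parent
  of \<open>x\<close>.\<close>

definition high :: "'a set" where
  "high = {x. \<exists>t w. spans t w x \<and> par x \<noteq> t}"

lemma spansD:
  assumes "spans t w x"
  shows "x \<in> V" "x \<noteq> root" "t \<in> V" "w \<in> V" "w \<noteq> root" "anc t w" "\<not> anc x t" "anc t (par x)"
proof -
  show w: "t \<in> V" "w \<in> V" using assms edge_in by (auto simp: spans_def)
  show x: "x \<in> V" using assms w anc_in by (auto simp: spans_def)
  show nx: "\<not> anc x t" using assms anc_antisym by (auto simp: spans_def)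
  then show xr: "x \<noteq> root" using root_anc w by auto
  then show "w \<noteq> root" using assms by (metis anc_antisym root_anc spans_def x)
  show "anc t w" using assms anc_trans by (auto simp: spans_def)
  show "anc t (par x)" using assms anc_cases unfolding spans_def by blast
qed

text \<open>The core of both criteria. A vertex \<open>b\<close> outside the subtree of
  \<open>x\<close> cannot lie below \<open>a\<close>, so by comparability it lies above
  \<open>a\<close>. As \<open>x\<close> lies above \<open>a\<close> too, \<open>b\<close> and
  \<open>x\<close> are comparable, and \<open>b\<close> must be above \<open>x\<close>.\<close>

lemma edge_leaving_subtree:
  assumes "{a, b} \<in> E" "anc x a" "\<not> anc x b"
  shows "a = x \<and> b = par x \<or> spans b a x"
proof -
  have ba: "anc b a" using edge_comparable[OF assms(1)] assms anc_trans
    unfolding anc_def by blast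
  then have bx: "anc b x" using anc_linear assms by blast
  have ne: "b \<noteq> x" using assms by auto
  show ?thesis
  proof (cases "par a = b")
    case True
    then show ?thesis using anc_cases[OF assms(2)] assms(3) by auto
  next
    case False
    then show ?thesis using assms bx ne by (auto simp: spans_def insert_commute)
  qed
qed

text \<open>\<open>V'\<close> and \<open>E'\<close> stand for the graph after deleting a vertex or
  an edge. Only tree edges with both ends in the subtree of \<open>x\<close> are required, so the
  edge above \<open>x\<close> may be gone.\<close>

lemma subtree_linked:
  assumes "anc x y" "x \<in> V'" "y \<in> V'" 
    and tree: "\<And>z. z \<in> V \<Longrightarrow> z \<noteq> root \<Longrightarrow> anc x (par z) \<Longrightarrow> {z, par z} \<in> E'"
  shows "(y, x) \<in> linked_by_path V' E'"
proof -
  have "(y, x) \<in> {(x, y). {x, y} \<in> E'}\<^sup>*"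
    using assms(1) unfolding anc_def
  proof (induction rule: converse_rtrancl_induct)
    case (step y z)
    then show ?case using tree by (auto simp: tree_up_def anc_def intro: converse_rtrancl_into_rtrancl)
  qed simp
  then show ?thesis using assms by (simp add: linked_by_path_def)
qed

text \<open>The upward path of a vertex outside the subtree of \<open>x\<close> never enters that
  subtree, so it uses only tree edges whose lower end is outside.\<close>

lemma outside_subtree_linked:
  assumes "y \<in> V'" "root \<in> V'" "y \<in> V" "\<not> anc x y" 
    and tree: "\<And>z. z \<in> V \<Longrightarrow> z \<noteq> root \<Longrightarrow> \<not> anc x z \<Longrightarrow> {z, par z} \<in> E'"
  shows "(y, root) \<in> linked_by_path V' E'"
proof -
  have "(y, root) \<in> {(x, y). {x, y} \<in> E'}\<^sup>*"
    using root_anc[OF assms(3)] assms(4) unfolding anc_def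
  proof (induction rule: converse_rtrancl_induct)
    case (step y z)
    then have z: "z = par y" "y \<in> V" "y \<noteq> root" by (auto simp: tree_up_def)
    with step have "\<not> anc x z" using anc_par anc_trans by (auto simp: anc_def)
    then show ?case using tree[of y] step z by (auto simp: anc_def intro: converse_rtrancl_into_rtrancl)
  qed simp
  then show ?thesis using assms by (simp add: linked_by_path_def)
qed

lemma connected: "card (components V E) = 1"
proof -
  have "V \<times> V \<subseteq> linked_by_path V E"
    by (rule all_linked[of _ root], rule subtree_linked) (auto simp: root_anc root_in tree_edge)
  then show ?thesis
    using card_components_le_1_iff[OF finite_V, of E] components_pos[OF finite_V root_in, of E] by simp
qed

section \<open>Bridges and cut vertices read off the tree\<close>

lemma tree_edge_eq_iff:
  assumes "x \<in> V" "x \<noteq> root" "y \<in> V" "y \<noteq> root"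
  shows "{x, par x} = {y, par y} \<longleftrightarrow> x = y"
  using assms dep_Suc[of x] dep_Suc[of y] by (auto simp: doubleton_eq_iff)

text \<open>Without the edge above \<open>x\<close>, the subtree of \<open>x\<close> and the rest of
  the tree are still connected in themselves. They are joined to each other exactly by the edges
  that span \<open>x\<close>.\<close>

lemma bridges_eq: "bridges V E = (\<lambda>x. {x, par x}) ` (V - {root} - covered)"
proof -
  have *: "e \<in> bridges V E \<longleftrightarrow> e \<in> E \<and> \<not> V \<times> V \<subseteq> linked_by_path V (E - {e})" for e
    unfolding bridges_def connected using card_components_le_1_iff[OF finite_V, of "E - {e}"] by auto
  show ?thesis
  proof (intro equalityI subsetI)
    fix e assume e: "e \<in> bridges V E"
    show "e \<in> (\<lambda>x. {x, par x}) ` (V - {root} - covered)"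
    proof (rule ccontr)
      assume n: "\<not> ?thesis"
      have "V \<times> V \<subseteq> linked_by_path V (E - {e})"
      \<comment> \<open>If \<open>e\<close> is not a tree edge, the whole tree survives its
        deletion.\<close>
      proof (cases "\<exists>x. x \<in> V \<and> x \<noteq> root \<and> e = {x, par x}")
        case False
        then show ?thesis
          by (intro all_linked[of _ root] subtree_linked) (auto simp: root_anc root_in tree_edge)
      next
        case True
        then obtain x where x: "x \<in> V" "x \<noteq> root" "e = {x, par x}" by auto
        with n have "x \<in> covered" by auto
        then obtain t w where sp: "spans t w x" by (auto simp: covered_def)
        note D = spansD[OF sp]
        have out: "(y, root) \<in> linked_by_path V (E - {e})" if "y \<in> V" "\<not> anc x y" for y
          using that x tree_edge_eq_iff by (intro outside_subtree_linked[where x = x]) (auto simp: root_in tree_edge)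
        have ins: "(y, x) \<in> linked_by_path V (E - {e})" if "y \<in> V" "anc x y" for y
          using that x tree_edge_eq_iff
          by (intro subtree_linked) (auto simp: tree_edge, metis anc_antisym anc_par par_neq)
        \<comment> \<open>If the spanning edge were the deleted one, then \<open>w = x\<close> and
          \<open>t = par x\<close>, contrary to \<open>par w \<noteq> t\<close>; the other matching
          would give \<open>t = x\<close>.\<close>
        have "{w, t} \<noteq> e"
        proof
          assume "{w, t} = e"
          then have "w = x \<and> t = par x \<or> w = par x \<and> t = x" unfolding x doubleton_eq_iff .
          then show False using sp by (auto simp: spans_def)
        qed
        then have "(w, t) \<in> linked_by_path V (E - {e})"
          using D sp by (intro linked_edge) (auto simp: spans_def insert_commute)
        moreover have "(x, w) \<in> linked_by_path V (E - {e})"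
          using ins[of w] D sp linked_by_path_equiv[of V "E - {e}"] by (auto simp: spans_def elim!: equivE dest: symD)
        ultimately have "(x, root) \<in> linked_by_path V (E - {e})"
          using out[of t] D by (blast intro: linked_trans)
        then have "(y, root) \<in> linked_by_path V (E - {e})" if "y \<in> V" for y
          using out[of y] ins[of y] linked_trans that by (cases "anc x y") auto
        then show ?thesis by (rule all_linked)
      qed
      then show False using e * by auto
    qed
  next
    fix e assume "e \<in> (\<lambda>x. {x, par x}) ` (V - {root} - covered)"
    then obtain x where x: "x \<in> V" "x \<noteq> root" "e = {x, par x}" "x \<notin> covered" by auto
    have "(x, root) \<notin> linked_by_path V (E - {e})"
    proof
      assume l: "(x, root) \<in> linked_by_path V (E - {e})"
      have "root \<in> {y. anc x y}"
        using l
      proof (rule linked_by_path_closed)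
        fix a b assume "{a, b} \<in> E - {e}" "a \<in> {y. anc x y}"
        then show "b \<in> {y. anc x y}"
          using edge_leaving_subtree[of a b x] x by (auto simp: covered_def)
      qed simp
      then show False using x root_anc anc_antisym by auto
    qed
    then show "e \<in> bridges V E" using x * tree_edge root_in by auto
  qed
qed

text \<open>No edge joins the subtrees of two children of \<open>v\<close>, since their vertices are
  incomparable. After deleting \<open>v\<close>, the subtree of a child can therefore only be
  rejoined by an edge leading strictly above \<open>v\<close>. Above the root there is nothing, so
  there the number of children decides.\<close>

lemma cut_vertices_eq: "cut_vertices V E =
  {par x | x. x \<in> V \<and> x \<noteq> root \<and> x \<notin> high \<and> par x \<noteq> root} \<union>
  {root | x y. x \<in> V \<and> x \<noteq> root \<and> y \<in> V \<and> y \<noteq> root \<and> x \<noteq> y \<and> par x = root \<and> par y = root}"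
  (is "_ = ?A \<union> ?B")
proof -
  let ?V = "\<lambda>v. V - {v}" and ?E = "\<lambda>v. {e \<in> E. v \<notin> e}"
  have *: "v \<in> cut_vertices V E \<longleftrightarrow> v \<in> V \<and> \<not> ?V v \<times> ?V v \<subseteq> linked_by_path (?V v) (?E v)" for v
    unfolding cut_vertices_def connected using card_components_le_1_iff[of "?V v" "?E v"] finite_V by auto
  \<comment> \<open>For a child \<open>x\<close> of \<open>v\<close>, an edge that avoids
    \<open>v\<close> and leaves the subtree of \<open>x\<close> would span \<open>x\<close> and end
    above \<open>v\<close>: excluded by \<open>x \<notin> high\<close>, or by \<open>v\<close> being
    the root.\<close>
  have closed: "anc x b" if x: "x \<in> V" "x \<noteq> root" "par x = v" and nh: "v = root \<or> x \<notin> high"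
    and ab: "{a, b} \<in> ?E v" "anc x a" for x v a b
  proof (rule ccontr)
    assume b: "\<not> anc x b"
    have bv: "b \<noteq> v" and abE: "{a, b} \<in> E" using ab by auto
    from edge_leaving_subtree[OF abE ab(2) b] bv x have sp: "spans b a x" by auto
    with bv x have "x \<in> high" by (auto simp: high_def)
    with nh have "anc b root" using spansD[OF sp] x by auto
    then show False using spansD[OF sp] bv anc_antisym root_anc \<open>x \<in> high\<close> nh by metis
  qed
  have unlinked: "(x, y) \<notin> linked_by_path (?V v) (?E v)" 
    if x: "x \<in> V" "x \<noteq> root" "par x = v" and nh: "v = root \<or> x \<notin> high" and y: "\<not> anc x y" for x v y
    using linked_by_path_closed[of x y "?V v" "?E v" "{y. anc x y}"] closed[OF x nh] y by auto
  have ins: "(y, x) \<in> linked_by_path (?V v) (?E v)" 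
    if x: "x \<in> V" "x \<noteq> root" "par x = v" and "y \<in> V" "anc x y" for x y v
  proof (rule subtree_linked)
    have nv: "\<not> anc x v" using x anc_antisym anc_par par_neq by metis
    then show "x \<in> ?V v" "y \<in> ?V v" using that by auto
    fix z assume z: "z \<in> V" "z \<noteq> root" "anc x (par z)"
    then have "anc x z" using anc_trans anc_par by blast
    then show "{z, par z} \<in> ?E v" using z nv tree_edge by auto
  qed fact
  show ?thesis
  proof (intro equalityI subsetI)
    fix v assume v: "v \<in> cut_vertices V E"
    then have vV: "v \<in> V" using * by auto
    show "v \<in> ?A \<union> ?B"
    proof (rule ccontr)
      assume n: "v \<notin> ?A \<union> ?B"
      have "\<exists>r. \<forall>y\<in>?V v. (y, r) \<in> linked_by_path (?V v) (?E v)"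
      proof (cases "v = root")
        case True
        \<comment> \<open>The facts about \<open>x\<close> stand under the quantifier over
          \<open>y\<close>, so that the claim is vacuous for the graph with one vertex, where the
          root has no child.\<close>
        have "\<exists>x. \<forall>y\<in>?V v. x \<in> V \<and> x \<noteq> root \<and> par x = root \<and> anc x y"
        proof (cases "\<exists>x. x \<in> V \<and> x \<noteq> root \<and> par x = root")
          case True
          then obtain x where x: "x \<in> V" "x \<noteq> root" "par x = root" by auto
          have "anc x y" if y: "y \<in> ?V v" for y
          proof -
            obtain c where "anc c y" "c \<in> V" "c \<noteq> root" "par c = root"
              using anc_child[of root y] root_anc[of y] y \<open>v = root\<close> by auto
            then show ?thesis using n \<open>v = root\<close> x by auto
          qed
          with x show ?thesis by auto
        next
          case False
          then have "?V v = {}" using anc_child[of root] root_anc \<open>v = root\<close> by fastforce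
          then show ?thesis by auto
        qed
        then show ?thesis using ins True by blast
      next
        case False
        have out: "(y, root) \<in> linked_by_path (?V v) (?E v)" if "y \<in> V" "\<not> anc v y" for y
        proof (rule outside_subtree_linked[where x = v])
          fix z assume z: "z \<in> V" "z \<noteq> root" "\<not> anc v z"
          then have "par z \<noteq> v" using anc_par by blast
          then show "{z, par z} \<in> ?E v" using z tree_edge by auto
        qed (use that False root_in in auto)
        have "(y, root) \<in> linked_by_path (?V v) (?E v)" if y: "y \<in> ?V v" for y
        proof (cases "anc v y")
          case True
          then obtain x where x: "anc x y" "x \<in> V" "x \<noteq> root" "par x = v"
            using anc_child[of v y] y by auto
          with n False have "x \<in> high" by auto
          then obtain t w where sp: "spans t w x" and t: "t \<noteq> v" using x by (auto simp: high_def)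
          note D = spansD[OF sp]
          have "anc t v" using D x by auto
          then have nt: "\<not> anc v t" using t anc_antisym by auto
          have "anc x w" using sp by (simp add: spans_def)
          then have wv: "w \<noteq> v" using x anc_antisym anc_par par_neq by metis
          have "(y, x) \<in> linked_by_path (?V v) (?E v)" using ins x y by auto
          moreover have "(x, w) \<in> linked_by_path (?V v) (?E v)"
            using ins[of x v w] x \<open>anc x w\<close> D linked_by_path_equiv[of "?V v" "?E v"]
            by (auto elim!: equivE dest: symD)
          moreover have "(w, t) \<in> linked_by_path (?V v) (?E v)"
            using sp t wv D by (intro linked_edge) (auto simp: spans_def insert_commute)
          moreover have "(t, root) \<in> linked_by_path (?V v) (?E v)" using out nt D by blast
          ultimately show ?thesis by (blast intro: linked_trans)
        qed (use y out in auto)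
        then show ?thesis by auto
      qed
      then obtain r where "\<And>y. y \<in> ?V v \<Longrightarrow> (y, r) \<in> linked_by_path (?V v) (?E v)" by blast
      from all_linked[OF this] show False using v *[of v] by blast
    qed
  next
    fix v assume "v \<in> ?A \<union> ?B"
    then consider x where "x \<in> V" "x \<noteq> root" "x \<notin> high" "par x = v" "v \<noteq> root"
      | x y where "x \<in> V" "x \<noteq> root" "y \<in> V" "y \<noteq> root" "x \<noteq> y" "par x = v" "par y = v" "v = root"
      by auto
    then show "v \<in> cut_vertices V E"
    proof cases
      case 1
      then have "\<not> anc x root" using anc_antisym root_anc by blast
      then have "(x, root) \<notin> linked_by_path (?V v) (?E v)" using 1 unlinked by auto
      moreover have "x \<noteq> v" using 1 par_neq[of x] by auto
      ultimately show ?thesis using 1 * par_in root_in by auto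
    next
      case 2
      then have "\<not> anc x y" using anc_cases[of x y] anc_antisym root_anc by metis
      then have "(x, y) \<notin> linked_by_path (?V v) (?E v)" using 2 unlinked by auto
      then show ?thesis using 2 * root_in by auto
    qed
  qed
qed

end

section \<open>Depth-first search on adjacency lists\<close>

lemma cell_chain_drop: "cell_chain inp a (xs @ ys) \<Longrightarrow> \<exists>b. cell_chain inp b ys"
  by (induction xs arbitrary: a) auto

locale adjacency =
  fixes n :: nat and E :: "nat set set" and inp :: "nat list" and L :: "nat \<Rightarrow> nat list"
  assumes graph: "simple_graph {..<n} E"
    and connected: "connected_graph {..<n} E"
    and length_inp: "length inp = 2 + n + 6 * card E"
    and inp_0: "inp ! 0 = n" and inp_1: "inp ! 1 = card E"
    and chain: "v < n \<Longrightarrow> cell_chain inp (inp ! (2 + v)) (L v)"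
    and distinct_L: "v < n \<Longrightarrow> distinct (L v)"
    and L_addrs: "v < n \<Longrightarrow> set (L v) \<subseteq> cell_addrs n (card E)"
    and L_bij: "v < n \<Longrightarrow> bij_betw (neighbour inp) (set (L v)) {u. {v, u} \<in> E}"
    and cross_in: "v < n \<Longrightarrow> c \<in> set (L v) \<Longrightarrow> cross inp c \<in> set (L (neighbour inp c))"
    and nb_cross: "v < n \<Longrightarrow> c \<in> set (L v) \<Longrightarrow> neighbour inp (cross inp c) = v"
begin

section \<open>Consequences of the cross pointers\<close>

abbreviation "nb \<equiv> neighbour inp"
abbreviation "cr \<equiv> cross inp"
abbreviation "nx \<equiv> next_cell inp"

lemma edge_lt: "{a, b} \<in> E \<Longrightarrow> a < n \<and> b < n \<and> a \<noteq> b"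
  using graph unfolding simple_graph_def by (fastforce simp: card_2_iff doubleton_eq_iff)

lemma edge_pair: "e \<in> E \<Longrightarrow> \<exists>a b. e = {a, b}"
  using graph unfolding simple_graph_def by (fastforce simp: card_2_iff)

lemma n_pos: "0 < n"
proof (rule ccontr)
  assume "\<not> 0 < n"
  then have "components {..<n} E = {}" by (simp add: components_def quotient_def)
  then show False using connected by (simp add: connected_graph_def)
qed

lemma nb_edge: "v < n \<Longrightarrow> c \<in> set (L v) \<Longrightarrow> {v, nb c} \<in> E"
  using bij_betwE[OF L_bij] by blast

lemma nb_lt: "v < n \<Longrightarrow> c \<in> set (L v) \<Longrightarrow> nb c < n"
  using nb_edge edge_lt by blast

lemma nb_neq: "v < n \<Longrightarrow> c \<in> set (L v) \<Longrightarrow> nb c \<noteq> v"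
  using nb_edge edge_lt by blast

lemma edge_cell: "{v, u} \<in> E \<Longrightarrow> \<exists>c\<in>set (L v). nb c = u"
proof -
  assume *: "{v, u} \<in> E"
  then have "u \<in> nb ` set (L v)" using bij_betw_imp_surj_on[OF L_bij[of v]] edge_lt by auto
  then show ?thesis by auto
qed

lemma nb_inj: "v < n \<Longrightarrow> c \<in> set (L v) \<Longrightarrow> d \<in> set (L v) \<Longrightarrow> nb c = nb d \<Longrightarrow> c = d"
  using L_bij[of v] by (auto simp: bij_betw_def dest: inj_onD)

text \<open>A cell knows its owner: it is the neighbour recorded in the cell under its cross
  pointer.\<close>

lemma L_disjoint: "u < n \<Longrightarrow> v < n \<Longrightarrow> c \<in> set (L u) \<Longrightarrow> c \<in> set (L v) \<Longrightarrow> u = v"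
  using nb_cross by metis

text \<open>Both cells lie in the list of \<open>v\<close> and name the same neighbour; a list names
  each neighbour once.\<close>

lemma cross_cross: "v < n \<Longrightarrow> c \<in> set (L v) \<Longrightarrow> cr (cr c) = c"
proof -
  assume vc: "v < n" "c \<in> set (L v)"
  then have *: "cr c \<in> set (L (nb c))" "nb (cr c) = v" "nb c < n" 
    using cross_in nb_cross nb_lt by auto
  then have "cr (cr c) \<in> set (L v)" "nb (cr (cr c)) = nb c"
    using cross_in[OF *(3,1)] nb_cross[OF *(3,1)] by auto
  then show ?thesis using nb_inj vc by blast
qed

lemma card_E_le: "card E \<le> n * n"
proof -
  have "E \<subseteq> (\<lambda>(a, b). {a, b}) ` ({..<n} \<times> {..<n})"
    using edge_pair edge_lt by fastforce
  then have "card E \<le> card ({..<n} \<times> {..<n})" by (rule surj_card_le[rotated]) simp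
  then show ?thesis by simp
qed

lemma sum_degrees: "(\<Sum>v<n. length (L v)) \<le> 2 * card E"
proof -
  have "(\<Sum>v<n. length (L v)) = (\<Sum>v<n. card (set (L v)))"
    by (intro sum.cong) (auto simp: distinct_card distinct_L)
  also have "\<dots> = card (\<Union>v<n. set (L v))"
    by (rule card_UN_disjoint[symmetric]) (use L_disjoint in auto)
  also have "\<dots> \<le> card ((\<lambda>k. 2 + n + 3 * k) ` {..<2 * card E})"
    by (rule card_mono) (use L_addrs in \<open>auto simp: cell_addrs_def\<close>)
  also have "\<dots> \<le> 2 * card E" using card_image_le[of "{..<2 * card E}"] by auto
  finally show ?thesis .
qed

lemma cell_bounds: "v < n \<Longrightarrow> c \<in> set (L v) \<Longrightarrow> 2 + n \<le> c \<and> c + 2 < length inp"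
  using L_addrs[of v] length_inp by (auto simp: cell_addrs_def)

text \<open>The root has no parent cell. \<open>pc 0\<close> keeps its initial value
  \<open>0\<close>, and \<open>nb 0\<close> would read the header word \<open>n\<close>, which is no
  vertex.\<close>

definition parent :: "(nat \<Rightarrow> nat) \<Rightarrow> nat \<Rightarrow> nat" where
  "parent pc x = (if x = 0 then 0 else nb (pc x))"

text \<open>
  A configuration of the depth-first search consists of the visited vertices, the parent
  cells (the cell of \<open>x\<close> that points to the parent of \<open>x\<close>) and the stack of active vertices,
  each with the part of its list that remains to be scanned. The program stores only
  the top of the stack.
\<close>

inductive dfs_step :: "nat set \<times> (nat \<Rightarrow> nat) \<times> (nat \<times> nat list) list \<Rightarrow>
    nat set \<times> (nat \<Rightarrow> nat) \<times> (nat \<times> nat list) list \<Rightarrow> bool" where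
  skip: "nb c \<in> S \<Longrightarrow> dfs_step (S, pc, (v, c # r) # st) (S, pc, (v, r) # st)"
| down: "nb c \<notin> S \<Longrightarrow> dfs_step (S, pc, (v, c # r) # st)
     (insert (nb c) S, pc(nb c := cr c), (nb c, L (nb c)) # (v, r) # st)"
| up: "dfs_step (S, pc, (v, []) # y # st) (S, pc, y # st)"

inductive_simps dfs_step_simps:
  "dfs_step (S, pc, (v, c # r) # st) h"
  "dfs_step (S, pc, (v, []) # st) h"

definition dfs_start :: "nat set \<times> (nat \<Rightarrow> nat) \<times> (nat \<times> nat list) list" where
  "dfs_start = ({0}, \<lambda>_. 0, [(0, L 0)])"

text \<open>The decisive condition is \<open>L y = pre @ cr (pc x) # r'\<close>: what the parent
  \<open>y\<close> has left to scan begins right after the cross pointer of the parent cell of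
  \<open>x\<close>. Hence every entry below the top can be recovered from the parent marks and need
  not be stored.\<close>

fun stack_ok :: "(nat \<Rightarrow> nat) \<Rightarrow> (nat \<times> nat list) list \<Rightarrow> bool" where
  "stack_ok pc [] \<longleftrightarrow> False"
| "stack_ok pc [(x, r)] \<longleftrightarrow> x = 0 \<and> (\<exists>pre. L x = pre @ r)"
| "stack_ok pc ((x, r) # (y, r') # st) \<longleftrightarrow> x \<noteq> 0 \<and> (\<exists>pre. L x = pre @ r) \<and> nb (pc x) = y \<and>
     (\<exists>pre. L y = pre @ cr (pc x) # r') \<and> stack_ok pc ((y, r') # st)"

lemma stack_ok_Cons: "stack_ok pc ((x, r) # st) \<longleftrightarrow> (\<exists>pre. L x = pre @ r) \<and>
   (case st of [] \<Rightarrow> x = 0 | (y, r') # st' \<Rightarrow> x \<noteq> 0 \<and> nb (pc x) = y \<and> 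
     (\<exists>pre. L y = pre @ cr (pc x) # r') \<and> stack_ok pc st)"
  by (cases st) auto

lemma stack_ok_pc_cong: "(\<And>x. x \<in> fst ` set st \<Longrightarrow> pc x = pc' x) \<Longrightarrow> stack_ok pc st \<longleftrightarrow> stack_ok pc' st"
  by (induction pc st rule: stack_ok.induct) auto

section \<open>Invariant of the search\<close>

abbreviation up_rel :: "nat set \<Rightarrow> (nat \<Rightarrow> nat) \<Rightarrow> (nat \<times> nat) set" where
  "up_rel S pc \<equiv> tree_up S 0 (parent pc)"

definition comparable :: "nat set \<Rightarrow> (nat \<Rightarrow> nat) \<Rightarrow> nat \<Rightarrow> nat \<Rightarrow> bool" where
  "comparable S pc x y \<longleftrightarrow> (x, y) \<in> (up_rel S pc)\<^sup>* \<or> (y, x) \<in> (up_rel S pc)\<^sup>*"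

definition scanned :: "(nat \<times> nat list) list \<Rightarrow> nat \<Rightarrow> nat \<Rightarrow> bool" where
  "scanned st x c \<longleftrightarrow> c \<in> set (L x) \<and> (\<forall>r. (x, r) \<in> set st \<longrightarrow> c \<notin> set r)"

text \<open>The last conjunct becomes \<open>edge_comparable\<close> once all lists are exhausted;
  it takes the place of discovery and finishing times.\<close>

fun dfs_inv :: "nat set \<times> (nat \<Rightarrow> nat) \<times> (nat \<times> nat list) list \<Rightarrow> bool" where
  "dfs_inv (S, pc, st) \<longleftrightarrow> S \<subseteq> {..<n} \<and> 0 \<in> S \<and>
     (\<forall>x\<in>S - {0}. pc x \<in> set (L x) \<and> nb (pc x) \<in> S) \<and>
     (\<exists>dep :: nat \<Rightarrow> nat. \<forall>x\<in>S - {0}. dep x = Suc (dep (nb (pc x)))) \<and>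
     stack_ok pc st \<and> fst ` set st \<subseteq> S \<and> distinct (map fst st) \<and>
     (\<forall>x\<in>S. \<forall>c. scanned st x c \<longrightarrow> nb c \<in> S \<and> comparable S pc x (nb c))"

lemma stack_anc:
  assumes "stack_ok pc ((x, r) # st)" "fst ` set ((x, r) # st) \<subseteq> S" "y \<in> fst ` set ((x, r) # st)"
  shows "(x, y) \<in> (up_rel S pc)\<^sup>*"
  using assms
proof (induction st arbitrary: x r)
  case (Cons z st)
  obtain z1 z2 where z: "z = (z1, z2)" by (cases z)
  have "(x, z1) \<in> up_rel S pc" using Cons.prems z by (auto simp: tree_up_def parent_def)
  moreover have "y = x \<or> (z1, y) \<in> (up_rel S pc)\<^sup>*"
    using Cons.IH[of z1 z2] Cons.prems z by auto
  ultimately show ?case by (auto intro: converse_rtrancl_into_rtrancl)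
qed auto

lemma dfs_inv_start: "dfs_inv dfs_start"
  using n_pos by (auto simp: dfs_start_def scanned_def)

lemma comparable_mono:
  assumes "comparable S pc x y" "S \<subseteq> S'" "\<And>x. x \<in> S \<Longrightarrow> pc' x = pc x"
  shows "comparable S' pc' x y"
proof -
  have "up_rel S pc \<subseteq> up_rel S' pc'" using assms by (auto simp: tree_up_def parent_def)
  then show ?thesis using assms(1) rtrancl_mono unfolding comparable_def by blast
qed

text \<open>The visited neighbour is either on the stack, hence an ancestor of \<open>v\<close>, or
  finished. In the second case its whole list is scanned, including the cross pointer of
  \<open>c\<close>, and the invariant for that cell already gives comparability with
  \<open>v\<close>.\<close>

lemma dfs_inv_skip:
  assumes inv: "dfs_inv (S, pc, (v, c # r) # st)" and c: "nb c \<in> S"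
  shows "dfs_inv (S, pc, (v, r) # st)"
proof -
  have so: "stack_ok pc ((v, c # r) # st)" using inv by simp
  have st: "stack_ok pc ((v, r) # st)"
    using so by (auto simp: stack_ok_Cons split: list.splits)
  have v: "v \<in> S" "v < n" "v \<notin> fst ` set st" using inv by auto
  have cv: "c \<in> set (L v)" using so by (auto simp: stack_ok_Cons)
  have fs: "fst ` set ((v, c # r) # st) \<subseteq> S" using inv by auto
  have sc: "nb d \<in> S \<and> comparable S pc x (nb d)" if "x \<in> S" "scanned ((v, c # r) # st) x d" for x d
    using inv that by simp
  have comp: "comparable S pc v (nb c)"
  proof (cases "nb c \<in> fst ` set ((v, c # r) # st)")
    case True
    then show ?thesis using stack_anc[OF so fs] by (auto simp: comparable_def)
  next
    case False
    have "scanned ((v, c # r) # st) (nb c) (cr c)"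
      using False cross_in[OF v(2) cv] by (force simp: scanned_def)
    from sc[OF c this] show ?thesis using nb_cross[OF v(2) cv] by (auto simp: comparable_def)
  qed
  have "nb d \<in> S \<and> comparable S pc x (nb d)" if "x \<in> S" "scanned ((v, r) # st) x d" for x d
  proof (cases "x = v \<and> d = c")
    case True
    then show ?thesis using c comp by auto
  next
    case False
    then have "scanned ((v, c # r) # st) x d" using that by (auto simp: scanned_def)
    then show ?thesis using sc that by blast
  qed
  then show ?thesis using inv st by simp
qed

lemma dfs_inv_down:
  assumes inv: "dfs_inv (S, pc, (v, c # r) # st)" and c: "nb c \<notin> S"
  shows "dfs_inv (insert (nb c) S, pc(nb c := cr c), (nb c, L (nb c)) # (v, r) # st)"
proof -
  let ?u = "nb c" let ?S = "insert ?u S" let ?pc = "pc(?u := cr c)"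
  have so: "stack_ok pc ((v, c # r) # st)" using inv by simp
  have v: "v \<in> S" "v < n" "v \<notin> fst ` set st" and S0: "0 \<in> S" using inv by auto
  have cv: "c \<in> set (L v)" using so by (auto simp: stack_ok_Cons)
  have fs: "fst ` set ((v, c # r) # st) \<subseteq> S" using inv by auto
  note u = nb_lt[OF v(2) cv] cross_in[OF v(2) cv] nb_cross[OF v(2) cv] cross_cross[OF v(2) cv]
  have u0: "?u \<noteq> 0" using c S0 by metis
  have "stack_ok pc ((v, r) # st)"
    using so by (auto simp: stack_ok_Cons split: list.splits)
  then have "stack_ok ?pc ((v, r) # st)"
    using fs c by (subst stack_ok_pc_cong[of _ _ pc]) auto
  then have st: "stack_ok ?pc ((?u, L ?u) # (v, r) # st)"
    using u u0 so by (auto simp: stack_ok_Cons[of _ v])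
  obtain dep :: "nat \<Rightarrow> nat" where dep: "\<forall>x\<in>S - {0}. dep x = Suc (dep (nb (pc x)))" 
    and pS: "\<forall>x\<in>S - {0}. nb (pc x) \<in> S" using inv by auto
  \<comment> \<open>Older depths are unaffected, since the parents of the vertices in
    \<open>S\<close> lie in \<open>S\<close> and so differ from the new vertex.\<close>
  have "\<forall>x\<in>?S - {0}. (dep(?u := Suc (dep v))) x = Suc ((dep(?u := Suc (dep v))) (nb (?pc x)))"
    using dep pS u c v by (auto dest: bspec)
  then have depex: "\<exists>dep :: nat \<Rightarrow> nat. \<forall>x\<in>?S - {0}. dep x = Suc (dep (nb (?pc x)))" by blast
  have sc: "nb d \<in> ?S \<and> comparable ?S ?pc x (nb d)" if x: "x \<in> ?S" "scanned ((?u, L ?u) # (v, r) # st) x d" for x d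
  proof -
    have "x \<noteq> ?u" using x by (auto simp: scanned_def)
    then have xS: "x \<in> S" using x by auto
    show ?thesis
    proof (cases "x = v \<and> d = c")
      case True
      then show ?thesis using u u0 v by (auto simp: comparable_def tree_up_def parent_def intro!: r_into_rtrancl)
    next
      case False
      then have "scanned ((v, c # r) # st) x d" using x by (auto simp: scanned_def)
      then have "nb d \<in> S \<and> comparable S pc x (nb d)" using inv xS by simp
      moreover have "?pc y = pc y" if "y \<in> S" for y using c that by auto
      ultimately show ?thesis using comparable_mono[OF _ subset_insertI] by blast
    qed
  qed
  have "\<forall>x\<in>?S - {0}. ?pc x \<in> set (L x) \<and> nb (?pc x) \<in> ?S" 
    using inv u v c by auto
  moreover have "distinct (map fst ((?u, L ?u) # (v, r) # st))" using inv c by auto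
  moreover have "fst ` set ((?u, L ?u) # (v, r) # st) \<subseteq> ?S" using fs by auto
  moreover have "?S \<subseteq> {..<n}" "0 \<in> ?S" using inv u by auto
  ultimately show ?thesis unfolding dfs_inv.simps using st depex sc by blast
qed

lemma dfs_inv_up:
  assumes inv: "dfs_inv (S, pc, (v, []) # y # st)"
  shows "dfs_inv (S, pc, y # st)"
proof -
  have "stack_ok pc (y # st)" using inv by (cases y) auto
  moreover have "scanned ((v, []) # y # st) x c" if "scanned (y # st) x c" for x c
    using that by (auto simp: scanned_def)
  ultimately show ?thesis using inv by simp
qed

lemma dfs_inv_step: "dfs_step g h \<Longrightarrow> dfs_inv g \<Longrightarrow> dfs_inv h"
  by (induction rule: dfs_step.induct) (erule (1) dfs_inv_skip dfs_inv_down dfs_inv_up | erule dfs_inv_up)+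

section \<open>Determinism and the final configuration\<close>

definition reached where "reached g \<longleftrightarrow> dfs_step\<^sup>*\<^sup>* dfs_start g"

lemma reached_start: "reached dfs_start" by (simp add: reached_def)

lemma reached_step: "reached g \<Longrightarrow> dfs_step g h \<Longrightarrow> reached h" by (auto simp: reached_def)

lemma reached_inv: "reached g \<Longrightarrow> dfs_inv g"
  unfolding reached_def by (induction rule: rtranclp_induct) (auto intro: dfs_inv_start dfs_inv_step)

lemma dfs_step_det: "dfs_step g h \<Longrightarrow> dfs_step g h' \<Longrightarrow> h = h'"
  by (induction rule: dfs_step.induct) (auto simp: dfs_step_simps)

text \<open>The rule \<open>up\<close> demands an entry below the top, so the search ends with the
  exhausted root still on the stack.\<close>

lemma dfs_step_final: "\<not> dfs_step (S, pc, [(v, [])]) h"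
  by (simp add: dfs_step_simps)

text \<open>As steps are deterministic, the reachable configurations form a chain.\<close>

lemma reached_linear:
  assumes "reached g" "reached h"
  shows "dfs_step\<^sup>*\<^sup>* g h \<or> dfs_step\<^sup>*\<^sup>* h g"
  using assms(2,1) unfolding reached_def
proof (induction rule: rtranclp_induct)
  case (step y z)
  from step.IH[OF step.prems] show ?case
  proof
    assume "dfs_step\<^sup>*\<^sup>* g y"
    then show ?thesis using step(2) by (auto intro: rtranclp.rtrancl_into_rtrancl)
  next
    assume "dfs_step\<^sup>*\<^sup>* y g"
    then show ?thesis
    proof (cases rule: converse_rtranclpE)
      case base
      then show ?thesis using step(2) by auto
    next
      case (step z')
      then show ?thesis using dfs_step_det \<open>dfs_step y z\<close> by metis
    qed
  qed
qed simp

lemma dfs_steps_mono: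
  "dfs_step\<^sup>*\<^sup>* g h \<Longrightarrow> fst g \<subseteq> fst h \<and> (\<forall>x\<in>fst g. fst (snd h) x = fst (snd g) x)"
proof (induction rule: rtranclp_induct)
  case (step y z)
  from step(2) have "fst y \<subseteq> fst z \<and> (\<forall>x\<in>fst y. fst (snd z) x = fst (snd y) x)" 
    by (induction rule: dfs_step.induct) auto
  with step show ?case by auto
qed simp

text \<open>This is the sense in which a second search builds the same tree: the parent cell of a
  visited vertex never changes, so at any moment it is the one found at the end of the first
  search.\<close>

lemma final_reached:
  assumes "reached (S, pc, [(0, [])])" "reached (S', pc', st)"
  shows "\<forall>x\<in>S'. pc x = pc' x"
proof -
  have "dfs_step\<^sup>*\<^sup>* (S', pc', st) (S, pc, [(0, [])])"
    using reached_linear[OF assms]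
  proof
    assume "dfs_step\<^sup>*\<^sup>* (S, pc, [(0, [])]) (S', pc', st)"
    then show ?thesis by (cases rule: converse_rtranclpE) (auto simp: dfs_step_final)
  qed
  then show ?thesis using dfs_steps_mono by fastforce
qed

text \<open>At the end the lists of all visited vertices are exhausted, so the visited set is closed
  under edges; it contains \<open>0\<close>, and the graph is connected.\<close>

lemma final_all:
  assumes "reached (S, pc, [(0, [])])"
  shows "S = {..<n}"
proof -
  have inv: "dfs_inv (S, pc, [(0, [])])" using reached_inv assms by blast
  have nbS: "b \<in> S" if "{a, b} \<in> E" "a \<in> S" for a b
    using edge_cell[OF that(1)] inv that by (auto simp: scanned_def)
  have *: "{..<n} \<times> {..<n} \<subseteq> linked_by_path {..<n} E"
    using card_components_le_1_iff[of "{..<n}" E] connected by (simp add: connected_graph_def)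
  have "x \<in> S" if "x < n" for x
  proof -
    have "(0, x) \<in> linked_by_path {..<n} E" using * n_pos that by blast
    then show ?thesis by (rule linked_by_path_closed) (use nbS inv in auto)
  qed
  then show ?thesis using inv by auto
qed

lemma final_tree:
  assumes "reached (S, pc, [(0, [])])"
  shows "\<exists>dep. dfs_tree {..<n} E 0 (parent pc) dep"
proof -
  have inv: "dfs_inv ({..<n}, pc, [(0, [])])" using reached_inv assms final_all[OF assms] by blast
  then obtain dep :: "nat \<Rightarrow> nat" where dep: "\<forall>x\<in>{..<n} - {0}. dep x = Suc (dep (nb (pc x)))" by auto
  have "dfs_tree {..<n} E 0 (parent pc) dep"
  proof
    fix x assume x: "x \<in> {..<n}" "x \<noteq> 0"
    then have "pc x \<in> set (L x)" using inv by simp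
    then show "{x, parent pc x} \<in> E" using x nb_edge by (simp add: parent_def)
    show "dep x = Suc (dep (parent pc x))" using dep x by (simp add: parent_def)
  next
    fix a b assume ab: "{a, b} \<in> E"
    then obtain c where "c \<in> set (L a)" "nb c = b" using edge_cell by blast
    then have "comparable {..<n} pc a b" using inv edge_lt[OF ab] by (auto simp: scanned_def)
    then show "(a, b) \<in> (up_rel {..<n} pc)\<^sup>* \<or> (b, a) \<in> (up_rel {..<n} pc)\<^sup>*"
      by (simp add: comparable_def)
  qed (use edge_lt edge_pair n_pos in auto)
  then show ?thesis by blast
qed

end

section \<open>Program logic and bit arrays\<close>

text \<open>\<open>Q\<close> receives the absolute time \<open>t + t'\<close>, so that loop
  invariants can bound elapsed time and potentials together.\<close>

definition wp :: "nat \<Rightarrow> nat list \<Rightarrow> com \<Rightarrow> (state \<Rightarrow> nat \<Rightarrow> bool) \<Rightarrow> state \<Rightarrow> nat \<Rightarrow> bool" where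
  "wp w inp c Q \<sigma> t \<longleftrightarrow> (\<exists>t' \<sigma>'. runs w inp c \<sigma> t' \<sigma>' \<and> Q \<sigma>' (t + t'))"

inductive_simps runs_simps:
  "runs w inp Skip \<sigma> t \<sigma>'" "runs w inp (Assign i e) \<sigma> t \<sigma>'" "runs w inp (ReadInput i e) \<sigma> t \<sigma>'"
  "runs w inp (Load i e) \<sigma> t \<sigma>'" "runs w inp (Store e1 e2) \<sigma> t \<sigma>'" "runs w inp (Output e) \<sigma> t \<sigma>'"
  "runs w inp (Seq c1 c2) \<sigma> t \<sigma>'" "runs w inp (If e c1 c2) \<sigma> t \<sigma>'"

lemma wp_Skip: "wp w inp Skip Q \<sigma> t \<longleftrightarrow> Q \<sigma> (t + 1)"
  by (auto simp: wp_def runs_simps)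

lemma wp_Assign: "wp w inp (Assign i e) Q \<sigma> t \<longleftrightarrow>
   Q (\<sigma>\<lparr>regs := (regs \<sigma>)(i := exp_val w (regs \<sigma>) e)\<rparr>) (t + (1 + exp_cost e))"
  by (auto simp: wp_def runs_simps)

lemma wp_ReadInput: "wp w inp (ReadInput i e) Q \<sigma> t \<longleftrightarrow> exp_val w (regs \<sigma>) e < length inp \<and>
   Q (\<sigma>\<lparr>regs := (regs \<sigma>)(i := inp ! exp_val w (regs \<sigma>) e mod 2 ^ w)\<rparr>) (t + (1 + exp_cost e))"
  by (auto simp: wp_def runs_simps)

lemma wp_Load: "wp w inp (Load i e) Q \<sigma> t \<longleftrightarrow> exp_val w (regs \<sigma>) e < length (mem \<sigma>) \<and>
   Q (\<sigma>\<lparr>regs := (regs \<sigma>)(i := mem \<sigma> ! exp_val w (regs \<sigma>) e)\<rparr>) (t + (1 + exp_cost e))"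
  by (auto simp: wp_def runs_simps)

lemma wp_Store: "wp w inp (Store e1 e2) Q \<sigma> t \<longleftrightarrow> exp_val w (regs \<sigma>) e1 < length (mem \<sigma>) \<and>
   Q (\<sigma>\<lparr>mem := (mem \<sigma>)[exp_val w (regs \<sigma>) e1 := exp_val w (regs \<sigma>) e2]\<rparr>)
     (t + (1 + exp_cost e1 + exp_cost e2))"
  by (auto simp: wp_def runs_simps)

lemma wp_Output: "wp w inp (Output e) Q \<sigma> t \<longleftrightarrow>
   Q (\<sigma>\<lparr>outp := outp \<sigma> @ [exp_val w (regs \<sigma>) e]\<rparr>) (t + (1 + exp_cost e))"
  by (auto simp: wp_def runs_simps)

lemma wp_Seq: "wp w inp (Seq c1 c2) Q \<sigma> t \<longleftrightarrow> wp w inp c1 (wp w inp c2 Q) \<sigma> t"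
  by (auto simp: wp_def runs_simps add.assoc) (metis add.assoc)

lemma wp_If: "wp w inp (If e c1 c2) Q \<sigma> t \<longleftrightarrow>
   (if exp_val w (regs \<sigma>) e \<noteq> 0 then wp w inp c1 Q \<sigma> (t + (1 + exp_cost e))
    else wp w inp c2 Q \<sigma> (t + (1 + exp_cost e)))"
  unfolding wp_def runs_simps by (auto simp: add.assoc) (metis add_Suc_right add_Suc)+

text \<open>Elapsed time is part of the invariant; a bound on it makes the loop terminate.\<close>

lemma wp_While:
  assumes "I \<sigma> t"
    and bound: "\<And>\<sigma> t. I \<sigma> t \<Longrightarrow> t \<le> T"
    and exit: "\<And>\<sigma> t. I \<sigma> t \<Longrightarrow> exp_val w (regs \<sigma>) e = 0 \<Longrightarrow> Q \<sigma> (t + (1 + exp_cost e))"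
    and body: "\<And>\<sigma> t. I \<sigma> t \<Longrightarrow> exp_val w (regs \<sigma>) e \<noteq> 0 \<Longrightarrow> wp w inp c I \<sigma> (t + (1 + exp_cost e))"
  shows "wp w inp (While e c) Q \<sigma> t"
  using assms(1)
\<comment> \<open>Evaluating the condition already takes positive time, and the time after each pass
  is still at most \<open>T\<close>, so \<open>T - t\<close> decreases.\<close>
proof (induction "T - t" arbitrary: \<sigma> t rule: less_induct)
  case less
  show ?case
  proof (cases "exp_val w (regs \<sigma>) e = 0")
    case True
    then show ?thesis using exit less.prems WhileFalse unfolding wp_def by metis
  next
    case False
    then obtain t1 \<sigma>1 where 1: "runs w inp c \<sigma> t1 \<sigma>1" "I \<sigma>1 (t + (1 + exp_cost e) + t1)"
      using body[OF less.prems False] unfolding wp_def by auto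
    have "wp w inp (While e c) Q \<sigma>1 (t + (1 + exp_cost e) + t1)"
      by (rule less.hyps) (use 1 bound[OF 1(2)] in auto)
    then obtain t2 \<sigma>2 where "runs w inp (While e c) \<sigma>1 t2 \<sigma>2" "Q \<sigma>2 (t + (1 + exp_cost e) + t1 + t2)"
      unfolding wp_def by auto
    then show ?thesis using WhileTrue[OF False 1(1)] unfolding wp_def
      by (metis add.assoc)
  qed
qed

lemmas wp_simps = wp_Skip wp_Assign wp_ReadInput wp_Load wp_Store wp_Output wp_Seq wp_If

text \<open>\<open>rS\<close> is the input length and \<open>rN\<close> is \<open>n\<close>;
  \<open>rV\<close>, \<open>rC\<close>, \<open>rU\<close>, \<open>rP\<close> hold the current
  vertex, its current cell, a neighbour and a parent cell or cross pointer. \<open>rT\<close>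
  receives tested bits, \<open>rJ\<close> is scratch, \<open>rRun\<close> keeps the search going,
  \<open>rX\<close> is the vertex of a walk or of a report. \<open>rB\<close> counts bridges,
  \<open>rF\<close> records that a cut vertex was found, \<open>rR\<close> that a child of the root
  was seen. Space is charged for the registers that occur, not for the largest index.\<close>

abbreviation (input) "rS \<equiv> 10 :: nat"
abbreviation (input) "rN \<equiv> 11 :: nat"
abbreviation (input) "rV \<equiv> 12 :: nat"
abbreviation (input) "rC \<equiv> 13 :: nat"
abbreviation (input) "rU \<equiv> 14 :: nat"
abbreviation (input) "rT \<equiv> 15 :: nat"
abbreviation (input) "rP \<equiv> 16 :: nat"
abbreviation (input) "rRun \<equiv> 17 :: nat"
abbreviation (input) "rX \<equiv> 18 :: nat"
abbreviation (input) "rJ \<equiv> 19 :: nat"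
abbreviation (input) "rB \<equiv> 20 :: nat"
abbreviation (input) "rF \<equiv> 21 :: nat"
abbreviation (input) "rR \<equiv> 22 :: nat"

text \<open>
  The working memory is an array of bits, consisting of six fields with one bit for every input
  address: the visited vertices of the first (0) and second (1) search, the vertices
  whose tree edge is covered (2), the vertices from whose subtree an edge leads above
  the parent (3), the cut vertices (4) and the parent cells (5).
\<close>

definition bit_addr :: "nat \<Rightarrow> nat \<Rightarrow> exp" where
  "bit_addr f i = Bin Add (Bin Mul (Const f) (Reg rS)) (Reg i)"

definition get_bit_com :: "nat \<Rightarrow> nat \<Rightarrow> com" where
  "get_bit_com f i = Seq (Load rT (Bin Div (bit_addr f i) WordSize))
     (Assign rT (Bin BitAnd (Bin ShiftR (Reg rT) (Bin Mod (bit_addr f i) WordSize)) (Const 1)))"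

definition set_bit_com :: "nat \<Rightarrow> nat \<Rightarrow> com" where
  "set_bit_com f i = Seq (Load rJ (Bin Div (bit_addr f i) WordSize))
     (Store (Bin Div (bit_addr f i) WordSize)
       (Bin BitOr (Reg rJ) (Bin ShiftL (Const 1) (Bin Mod (bit_addr f i) WordSize))))"

definition read_next :: "nat \<Rightarrow> nat \<Rightarrow> com" where
  "read_next i j = ReadInput i (Bin Add (Reg j) (Const 1))"

definition read_plus2 :: "nat \<Rightarrow> nat \<Rightarrow> com" where
  "read_plus2 i j = ReadInput i (Bin Add (Reg j) (Const 2))"

text \<open>Bit positions stay below \<open>6 * N\<close>; the factor 16 leaves room for sums of
  addresses and small constants, so that address arithmetic never wraps around.\<close>

locale ram = adjacency +
  fixes w :: nat
  assumes word: "16 * length inp < 2 ^ w"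
begin

abbreviation "N \<equiv> length inp"
abbreviation "WP \<equiv> wp w inp"

lemma N_ge: "N \<ge> 3" using length_inp n_pos by simp

lemma N_pos: "inp \<noteq> []" using N_ge by auto

lemma w_ge: "4 < w"
proof (rule ccontr)
  assume "\<not> 4 < w"
  then have "(2::nat) ^ w \<le> 2 ^ 4" by (intro power_increasing) auto
  then show False using word N_ge by simp
qed

section \<open>Bit fields packed into words\<close>

definition mem_size :: nat where "mem_size = 6 * N div w + 1"

definition bits :: "nat list \<Rightarrow> nat \<Rightarrow> nat set" where
  "bits M f = {a. a < N \<and> bit (M ! ((f * N + a) div w)) ((f * N + a) mod w)}"

definition set_bit_mem :: "nat list \<Rightarrow> nat \<Rightarrow> nat \<Rightarrow> nat list" where
  "set_bit_mem M f a = (let q = (f * N + a) div w in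
     M[q := Bit_Operations.or (M ! q) (push_bit ((f * N + a) mod w) 1 mod 2 ^ w)])"

lemma small_mod: "a < 16 * N \<Longrightarrow> a mod 2 ^ w = a"
  using word by simp

lemma one_mod: "(1::nat) mod 2 ^ w = 1" by (rule small_mod) (use N_ge in simp)

lemma of_bool_mod: "(of_bool b :: nat) mod 2 ^ w = of_bool b" using w_ge by (cases b) simp_all

lemma bit_addr_lt: "f < 6 \<Longrightarrow> a < N \<Longrightarrow> f * N + a < 6 * N"
proof -
  assume "f < 6" "a < N"
  then have "f * N \<le> 5 * N" by (intro mult_right_mono) auto
  then show ?thesis using \<open>a < N\<close> by linarith
qed

lemma bit_addr_word: "f < 6 \<Longrightarrow> a < N \<Longrightarrow> (f * N + a) div w < mem_size"
  using div_le_mono[of "f * N + a" "6 * N" w] bit_addr_lt[of f a] by (simp add: mem_size_def)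

lemma length_set_bit_mem [simp]: "length (set_bit_mem M f a) = length M"
  by (simp add: set_bit_mem_def Let_def)

text \<open>Two divisions with remainder: by \<open>N\<close>, a position determines field and
  index; by \<open>w\<close>, it is determined by its word and offset. So distinct field entries
  occupy distinct bits.\<close>

lemma bits_set_bit_mem:
  assumes "length M = mem_size" "f < 6" "a < N" "g < 6"
  shows "bits (set_bit_mem M f a) g = (if g = f then insert a (bits M g) else bits M g)"
proof -
  let ?i = "f * N + a"
  have key: "bit (set_bit_mem M f a ! ((g * N + b) div w)) ((g * N + b) mod w) \<longleftrightarrow>
     (g = f \<and> b = a) \<or> bit (M ! ((g * N + b) div w)) ((g * N + b) mod w)" if "b < N" for b
  proof -
    let ?j = "g * N + b"
    have eq: "?j = ?i \<longleftrightarrow> g = f \<and> b = a"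
    proof
      assume "?j = ?i"
      then have "?j div N = ?i div N" "?j mod N = ?i mod N" by simp_all
      then show "g = f \<and> b = a" using that assms N_pos by (auto simp: div_mult_self3)
    qed simp
    have mw: "x mod w < w" for x using w_ge by simp
    show ?thesis
    proof (cases "?j div w = ?i div w")
      case True
      then have "?j mod w = ?i mod w \<longleftrightarrow> ?j = ?i" by (metis div_mult_mod_eq)
      then show ?thesis using True bit_addr_word[OF assms(2,3)] assms(1) mw[of ?j] eq
        by (auto simp: set_bit_mem_def Let_def bit_or_iff bit_push_bit_iff bit_take_bit_iff simp flip: take_bit_eq_mod)
           (auto simp: bit_simps)
    next
      case False
      then show ?thesis using eq by (auto simp: set_bit_mem_def Let_def)
    qed
  qed
  then show ?thesis by (auto simp: bits_def assms)
qed

lemma bits_initial: "f < 6 \<Longrightarrow> bits (replicate mem_size 0) f = {}"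
  by (auto simp: bits_def bit_addr_word)

lemma bit_addr_cost: "exp_cost (bit_addr f i) = 5"
  by (simp add: bit_addr_def)

lemma bit_addr_val:
  assumes "regs \<sigma> rS = N" "regs \<sigma> i < N" "f < 6"
  shows "exp_val w (regs \<sigma>) (bit_addr f i) = f * N + regs \<sigma> i"
proof -
  have "f * N + regs \<sigma> i < 6 * N" using assms bit_addr_lt by simp
  moreover have "f mod 2 ^ w = f" using assms N_ge by (intro small_mod) linarith
  moreover have "f * N mod 2 ^ w = f * N" using calculation(1) by (intro small_mod) linarith
  moreover have "(f * N + regs \<sigma> i) mod 2 ^ w = f * N + regs \<sigma> i" using calculation(1) by (intro small_mod) linarith
  ultimately show ?thesis using assms by (simp add: bit_addr_def)
qed

lemma wp_get_bit:
  assumes "regs \<sigma> rS = N" "regs \<sigma> i < N" "f < 6" "i \<noteq> rT" "length (mem \<sigma>) = mem_size"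
  shows "WP (get_bit_com f i) Q \<sigma> t \<longleftrightarrow>
    Q (\<sigma>\<lparr>regs := (regs \<sigma>)(rT := of_bool (regs \<sigma> i \<in> bits (mem \<sigma>) f))\<rparr>) (t + 20)"
proof -
  let ?x = "f * N + regs \<sigma> i"
  have a: "exp_val w (regs (\<sigma>\<lparr>regs := (regs \<sigma>)(rT := v)\<rparr>)) (bit_addr f i) = ?x" for v
    using assms by (subst bit_addr_val) auto
  have "drop_bit k (x::nat) mod 2 = of_bool (bit x k)" for x k
    by (simp add: bit_iff_odd_drop_bit mod_2_eq_odd)
  then have "Bit_Operations.and (drop_bit (?x mod w) (mem \<sigma> ! (?x div w))) 1 = of_bool (regs \<sigma> i \<in> bits (mem \<sigma>) f)"
    using assms by (simp add: bits_def and_one_eq)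
  then show ?thesis
    using a bit_addr_val[OF assms(1-3)] bit_addr_word[OF assms(3,2)] assms one_mod
    by (simp add: get_bit_com_def wp_simps bit_addr_cost add.commute del: One_nat_def)
qed

lemma wp_set_bit:
  assumes "regs \<sigma> rS = N" "regs \<sigma> i < N" "f < 6" "i \<noteq> rJ" "length (mem \<sigma>) = mem_size"
  shows "WP (set_bit_com f i) Q \<sigma> t \<longleftrightarrow>
    Q (\<sigma>\<lparr>regs := (regs \<sigma>)(rJ := mem \<sigma> ! ((f * N + regs \<sigma> i) div w)),
         mem := set_bit_mem (mem \<sigma>) f (regs \<sigma> i)\<rparr>) (t + 27)"
proof -
  let ?x = "f * N + regs \<sigma> i"
  have a: "exp_val w (regs (\<sigma>\<lparr>regs := (regs \<sigma>)(rJ := v)\<rparr>)) (bit_addr f i) = ?x" for v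
    using assms by (subst bit_addr_val) auto
  show ?thesis
    using a bit_addr_val[OF assms(1-3)] bit_addr_word[OF assms(3,2)] assms one_mod
    by (simp add: set_bit_com_def wp_simps bit_addr_cost set_bit_mem_def Let_def add.commute del: One_nat_def)
qed

section \<open>Reading the input\<close>

definition is_cell :: "nat \<Rightarrow> bool" where
  "is_cell c \<longleftrightarrow> (\<exists>v<n. c \<in> set (L v))"

lemma is_cellD: "is_cell c \<Longrightarrow> nb c < n \<and> is_cell (cr c) \<and> c + 2 < N \<and> 2 + n \<le> c"
  unfolding is_cell_def using nb_lt cross_in cell_bounds by blast

lemma n_lt_N: "n < N" using length_inp by simp

lemma is_cell_lt: "is_cell c \<Longrightarrow> c < N"
  using is_cellD by fastforce

lemma wp_read_nb:
  "is_cell (regs \<sigma> j) \<Longrightarrow> WP (ReadInput i (Reg j)) Q \<sigma> t \<longleftrightarrow>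
    Q (\<sigma>\<lparr>regs := (regs \<sigma>)(i := nb (regs \<sigma> j))\<rparr>) (t + 2)"
  using is_cellD[of "regs \<sigma> j"] n_lt_N by (simp add: wp_simps neighbour_def small_mod)

lemma wp_read_cross:
  assumes "is_cell (regs \<sigma> j)"
  shows "WP (read_plus2 i j) Q \<sigma> t \<longleftrightarrow> Q (\<sigma>\<lparr>regs := (regs \<sigma>)(i := cr (regs \<sigma> j))\<rparr>) (t + 4)"
proof -
  have "cr (regs \<sigma> j) < N" using is_cellD is_cell_lt assms by blast
  then show ?thesis
    using is_cellD[OF assms] N_ge
    by (simp add: read_plus2_def wp_simps cross_def small_mod del: One_nat_def)
qed

text \<open>Cells lie beyond the header and thus never at address \<open>0\<close>, so the program
  recognises an exhausted list by a zero test.\<close>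

lemma chain_value: "cell_chain inp a r \<Longrightarrow> (\<And>c. c \<in> set r \<Longrightarrow> is_cell c) \<Longrightarrow> a < N \<and> (a = 0 \<longleftrightarrow> r = [])"
  using N_ge is_cellD by (cases r) (auto dest!: is_cell_lt, fastforce)

lemma is_cell_L: "v < n \<Longrightarrow> c \<in> set (L v) \<Longrightarrow> is_cell c"
  by (auto simp: is_cell_def)

lemma chain_prefix: "v < n \<Longrightarrow> L v = pre @ c # r \<Longrightarrow> cell_chain inp (nx c) r"
  using chain[of v] cell_chain_drop[of inp _ pre "c # r"] by auto

lemma nx_lt:
  assumes "is_cell c"
  shows "nx c < N"
proof -
  obtain v pre r where v: "v < n" "L v = pre @ c # r"
    using assms by (auto simp: is_cell_def dest: split_list)
  then have "\<And>d. d \<in> set r \<Longrightarrow> is_cell d" using is_cell_L[of v] by auto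
  then show ?thesis using chain_value chain_prefix[OF v] by blast
qed

lemma wp_read_next:
  assumes "is_cell (regs \<sigma> j)"
  shows "WP (read_next i j) Q \<sigma> t \<longleftrightarrow> Q (\<sigma>\<lparr>regs := (regs \<sigma>)(i := nx (regs \<sigma> j))\<rparr>) (t + 4)"
  using is_cellD[OF assms(1)] nx_lt[OF assms] N_ge w_ge
  by (simp add: read_next_def wp_simps next_cell_def small_mod one_mod del: One_nat_def)

lemma wp_read_first:
  assumes "regs \<sigma> j < n"
  shows "WP (read_plus2 i j) Q \<sigma> t \<longleftrightarrow> Q (\<sigma>\<lparr>regs := (regs \<sigma>)(i := inp ! (2 + regs \<sigma> j))\<rparr>) (t + 4)"
  using chain_value[OF chain[OF assms] is_cell_L[OF assms]] assms length_inp
  by (simp add: read_plus2_def wp_simps small_mod add.commute del: One_nat_def)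

end

section \<open>The search program\<close>

text \<open>Elapsed times are to keep the form \<open>t + numeral\<close>.\<close>

declare One_nat_def [simp del] add_2_eq_Suc [simp del] add_2_eq_Suc' [simp del]

lemmas wp_ctrl = wp_Skip wp_Assign wp_Output wp_Seq wp_If

text \<open>There is no test for the end of the list: the search is made only for vertices other
  than the root whose parent cell is already marked.\<close>

definition find_parent_com :: "nat \<Rightarrow> com" where
  "find_parent_com i = Seq (read_plus2 rP i) (Seq (get_bit_com 5 rP)
     (While (Bin Equal (Reg rT) (Const 0)) (Seq (read_next rP rP) (get_bit_com 5 rP))))"

text \<open>With vertex \<open>0\<close> as root, a zero test on \<open>rV\<close> recognises the
  root, just as one on \<open>rC\<close> recognises the end of a list. \<open>hook\<close> runs
  after the new vertex is marked visited and before \<open>rC\<close> is loaded, so it may overwrite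
  \<open>rC\<close>.\<close>

definition dfs_body :: "nat \<Rightarrow> com \<Rightarrow> com" where
  "dfs_body f hook = If (Reg rC)
     (Seq (ReadInput rU (Reg rC)) (Seq (get_bit_com f rU)
        (If (Reg rT) (read_next rC rC)
           (Seq (read_plus2 rP rC) (Seq (set_bit_com 5 rP) (Seq (Assign rV (Reg rU))
              (Seq (set_bit_com f rV) (Seq hook (read_plus2 rC rV)))))))))
     (If (Reg rV)
        (Seq (find_parent_com rV) (Seq (ReadInput rV (Reg rP)) (Seq (read_plus2 rC rP) (read_next rC rC))))
        (Assign rRun (Const 0)))"

definition dfs_com :: "nat \<Rightarrow> com \<Rightarrow> com" where
  "dfs_com f hook = Seq (Assign rV (Const 0)) (Seq (set_bit_com f rV) (Seq hook
     (Seq (read_plus2 rC rV) (Seq (Assign rRun (Const 1)) (While (Reg rRun) (dfs_body f hook))))))"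

context ram
begin

text \<open>28 steps per cell: 4 for the loop test, 4 for the next pointer, 20 for the bit. The
  first cell costs 24, and the last test 4.\<close>

lemma wp_find_parent:
  assumes reg: "regs \<sigma> rS = N" "regs \<sigma> i = x" "x < n" "i \<noteq> rP" "i \<noteq> rT" "length (mem \<sigma>) = mem_size"
    and p: "bits (mem \<sigma>) 5 \<inter> set (L x) = {p}"
    and Q: "\<And>t'. t' \<le> t + 28 + 28 * length (L x) \<Longrightarrow> Q (\<sigma>\<lparr>regs := (regs \<sigma>)(rP := p, rT := 1)\<rparr>) t'"
  shows "WP (find_parent_com i) Q \<sigma> t"
proof -
  define I where "I \<sigma>' t' \<longleftrightarrow> (\<exists>pre q r. L x = pre @ q # r \<and> p \<in> set (q # r) \<and> 
      \<sigma>' = \<sigma>\<lparr>regs := (regs \<sigma>)(rP := q, rT := of_bool (q = p))\<rparr> \<and>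
      t' + 28 * length r \<le> t + 24 + 28 * length (L x))" for \<sigma>' t'
  have mem5: "q \<in> bits (mem \<sigma>) 5 \<longleftrightarrow> q = p" if "q \<in> set (L x)" for q using that p by blast
  have cell: "q \<in> set (L x) \<Longrightarrow> is_cell q" for q using is_cell_L reg by blast
  have loop: "WP (While (Bin Equal (Reg rT) (Const 0)) (Seq (read_next rP rP) (get_bit_com 5 rP))) Q \<sigma>' t'"
    if "I \<sigma>' t'" for \<sigma>' t'
    using that
  proof (rule wp_While[where T = "t + 24 + 28 * length (L x)"])
    fix \<sigma>' t' assume "I \<sigma>' t'"
    then obtain pre q r where I: "L x = pre @ q # r" "p \<in> set (q # r)"
      "\<sigma>' = \<sigma>\<lparr>regs := (regs \<sigma>)(rP := q, rT := of_bool (q = p))\<rparr>"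
      "t' + 28 * length r \<le> t + 24 + 28 * length (L x)" by (auto simp: I_def)
    then show "t' \<le> t + 24 + 28 * length (L x)" by simp
    show "Q \<sigma>' (t' + (1 + exp_cost (Bin Equal (Reg rT) (Const 0))))" 
      if "exp_val w (regs \<sigma>') (Bin Equal (Reg rT) (Const 0)) = 0"
    proof -
      have "q = p" using that I(3) by (auto simp: of_bool_mod)
      then show ?thesis using I Q by simp
    qed
    show "WP (Seq (read_next rP rP) (get_bit_com 5 rP)) I \<sigma>' (t' + (1 + exp_cost (Bin Equal (Reg rT) (Const 0))))"
      if "exp_val w (regs \<sigma>') (Bin Equal (Reg rT) (Const 0)) \<noteq> 0"
    proof -
      have qp: "q \<noteq> p" using that I(3) by (auto simp: of_bool_mod)
      then obtain q' r' where r: "r = q' # r'" using I(2) by (cases r) auto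
      have ch: "cell_chain inp (nx q) r" using chain_prefix I(1) reg(3) by blast
      then have nq: "nx q = q'" using r by simp
      have cells: "\<And>c. c \<in> set r \<Longrightarrow> is_cell c" "is_cell q" "is_cell q'" using cell I(1) r by auto
      have "I (\<sigma>\<lparr>regs := (regs \<sigma>)(rP := q', rT := of_bool (q' = p))\<rparr>) (t' + 28)"
        unfolding I_def by (rule exI[of _ "pre @ [q]"], rule exI[of _ q'], rule exI[of _ r']) 
          (use I qp r in auto)
      moreover have "q' \<in> set (L x)" using I(1) r by simp
      ultimately show ?thesis
        using I(3) nq reg is_cell_lt[OF cells(3)] mem5[of q']
        by (simp add: wp_Seq wp_read_next cells wp_get_bit add.commute)
    qed
  qed
  obtain q r where Lx: "L x = q # r" using p by (cases "L x") auto
  have f: "inp ! (2 + x) = q" using chain[OF reg(3)] Lx by simp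
  have "I (\<sigma>\<lparr>regs := (regs \<sigma>)(rP := q, rT := of_bool (q = p))\<rparr>) (t + 24)"
    unfolding I_def by (rule exI[of _ "[]"], rule exI[of _ q], rule exI[of _ r]) (use Lx p in auto)
  from loop[OF this] show ?thesis
    using reg is_cell_lt[OF cell[of q]] mem5[of q] Lx f
    by (simp add: find_parent_com_def wp_Seq wp_read_first wp_get_bit add.commute)
qed

section \<open>Verification of the search with a hook\<close>

definition frame :: "nat \<Rightarrow> state \<Rightarrow> state \<Rightarrow> bool" where
  "frame f \<sigma> \<sigma>' \<longleftrightarrow> regs \<sigma>' rS = regs \<sigma> rS \<and> regs \<sigma>' rN = regs \<sigma> rN \<and>
     length (mem \<sigma>') = length (mem \<sigma>) \<and> outp \<sigma>' = outp \<sigma> \<and>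
     (\<forall>g<6. g \<notin> {2, 3, 5, f} \<longrightarrow> bits (mem \<sigma>') g = bits (mem \<sigma>) g)"

text \<open>The situation in which the hook is called: \<open>S\<close> is the visited set without
  the new vertex \<open>v\<close>, while \<open>pc\<close> already knows the parent cell of
  \<open>v\<close>.\<close>

definition entering :: "nat set \<Rightarrow> nat \<Rightarrow> (nat \<Rightarrow> nat) \<Rightarrow> bool" where
  "entering S v pc \<longleftrightarrow> v < n \<and> v \<notin> S \<and> S \<subseteq> {..<n} \<and> (\<forall>x\<in>S - {0}. parent pc x \<in> S) \<and>
     (v \<noteq> 0 \<longrightarrow> 0 \<in> S \<and> parent pc v \<in> S) \<and> (\<exists>st. reached (insert v S, pc, (v, L v) # st))"

definition hook_post :: "state \<Rightarrow> state \<Rightarrow> bool" where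
  "hook_post \<sigma> \<sigma>' \<longleftrightarrow> (\<forall>r\<in>{rS, rN, rV, rRun}. regs \<sigma>' r = regs \<sigma> r) \<and>
     length (mem \<sigma>') = length (mem \<sigma>) \<and> outp \<sigma>' = outp \<sigma> \<and>
     (\<forall>g<6. g \<notin> {2, 3} \<longrightarrow> bits (mem \<sigma>') g = bits (mem \<sigma>) g)"

text \<open>\<open>Z\<close> is the content of field 5 before the search: empty the first time, all
  parent cells the second time. \<open>X\<close> relates the vertices entered so far to fields 2 and
  3. The cost bound is amortised: \<Psi> pays for work that the degree of \<open>v\<close> does not
  bound.\<close>

definition hook_spec :: "nat \<Rightarrow> nat set \<Rightarrow> (nat set \<Rightarrow> nat set \<Rightarrow> nat set \<Rightarrow> bool) \<Rightarrow> (nat set \<Rightarrow> nat) \<Rightarrow> com \<Rightarrow> bool" where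
  "hook_spec f Z X \<Psi> hook \<longleftrightarrow> (\<forall>S v pc \<sigma> t Q. entering S v pc \<longrightarrow> regs \<sigma> rS = N \<longrightarrow> regs \<sigma> rV = v \<longrightarrow>
     length (mem \<sigma>) = mem_size \<longrightarrow> bits (mem \<sigma>) f = insert v S \<longrightarrow>
     bits (mem \<sigma>) 5 = Z \<union> pc ` (insert v S - {0}) \<longrightarrow> X S (bits (mem \<sigma>) 2) (bits (mem \<sigma>) 3) \<longrightarrow>
     (\<forall>\<sigma>' t'. hook_post \<sigma> \<sigma>' \<longrightarrow> X (insert v S) (bits (mem \<sigma>') 2) (bits (mem \<sigma>') 3) \<longrightarrow>
        t' + \<Psi> (bits (mem \<sigma>') 2) \<le> t + \<Psi> (bits (mem \<sigma>) 2) + 100 + 100 * length (L v) \<longrightarrow> Q \<sigma>' t') \<longrightarrow>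
     WP hook Q \<sigma> t)"

text \<open>An unvisited vertex holds the cost of entering it, of its hook and of its future stack
  entry. A stack entry holds 100 for every cell still to be scanned and
  \<open>50 + 50 * length (L x)\<close> for backtracking, which scans the list once more for the
  mark.\<close>

definition dfs_potential :: "nat set \<Rightarrow> (nat \<times> nat list) list \<Rightarrow> nat" where
  "dfs_potential S st = (\<Sum>x\<in>{..<n} - S. 300 + 300 * length (L x)) +
     (\<Sum>(x, r)\<leftarrow>st. 50 + 50 * length (L x) + 100 * length r)"

lemma dfs_potential_insert:
  assumes "u < n" "u \<notin> S"
  shows "dfs_potential S st = 300 + 300 * length (L u) + dfs_potential (insert u S) st"
proof -
  have "{..<n} - S - {u} = {..<n} - insert u S" by auto
  then show ?thesis
    using sum.remove[of "{..<n} - S" u "\<lambda>x. 300 + 300 * length (L x)"] assms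
    by (simp add: dfs_potential_def)
qed

text \<open>The program simulates \<open>dfs_step\<close>, with all stack entries below the top as
  ghosts. The assumption on \<open>Z\<close> ensures that marks left by an earlier search cannot
  divert the backtracking.\<close>

lemma wp_dfs:
  assumes f: "f = 0 \<or> f = 1"
    and Z: "\<And>S pc st x z. reached (S, pc, st) \<Longrightarrow> x \<in> S \<Longrightarrow> x \<noteq> 0 \<Longrightarrow> z \<in> Z \<Longrightarrow> z \<in> set (L x) \<Longrightarrow> z = pc x"
    and hook: "hook_spec f Z X \<Psi> hook"
    and init: "regs \<sigma> rS = N" "length (mem \<sigma>) = mem_size" "bits (mem \<sigma>) f = {}" "bits (mem \<sigma>) 5 = Z"
      "X {} (bits (mem \<sigma>) 2) (bits (mem \<sigma>) 3)"
    and Q: "\<And>\<sigma>' t' pc. frame f \<sigma> \<sigma>' \<Longrightarrow> reached ({..<n}, pc, [(0, [])]) \<Longrightarrow> bits (mem \<sigma>') f = {..<n} \<Longrightarrow>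
      bits (mem \<sigma>') 5 = Z \<union> pc ` ({..<n} - {0}) \<Longrightarrow> X {..<n} (bits (mem \<sigma>') 2) (bits (mem \<sigma>') 3) \<Longrightarrow>
      t' + \<Psi> (bits (mem \<sigma>') 2) \<le> t + \<Psi> (bits (mem \<sigma>) 2) + 400 * n + 600 * card E \<Longrightarrow> Q \<sigma>' t'"
  shows "WP (dfs_com f hook) Q \<sigma> t"
proof -
  let ?B = "\<lambda>\<sigma> g. bits (mem \<sigma>) g"
  have f6: "f < 6" "f \<noteq> 5" "f \<noteq> 2" "f \<noteq> 3" using f by auto
  \<comment> \<open>The subtracted 2 steps are the last evaluation of the loop condition.\<close>
  define T where "T = t + \<Psi> (?B \<sigma> 2) + 400 * n + 600 * card E - 2"
  \<comment> \<open>The summand \<open>10 * regs \<sigma>' rRun\<close> pays for the one pass that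
    finds the root exhausted and clears the flag.\<close>
  define I where "I \<sigma>' t' \<longleftrightarrow> (\<exists>S pc v r st. reached (S, pc, (v, r) # st) \<and> frame f \<sigma> \<sigma>' \<and>
     regs \<sigma>' rV = v \<and> cell_chain inp (regs \<sigma>' rC) r \<and> 
     (regs \<sigma>' rRun = 1 \<or> regs \<sigma>' rRun = 0 \<and> v = 0 \<and> r = [] \<and> st = []) \<and>
     ?B \<sigma>' f = S \<and> ?B \<sigma>' 5 = Z \<union> pc ` (S - {0}) \<and> X S (?B \<sigma>' 2) (?B \<sigma>' 3) \<and>
     t' + \<Psi> (?B \<sigma>' 2) + 10 * regs \<sigma>' rRun + dfs_potential S ((v, r) # st) \<le> T)" for \<sigma>' t'
  have loop: "WP (While (Reg rRun) (dfs_body f hook)) Q \<sigma>' t'" if "I \<sigma>' t'" for \<sigma>' t'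
    using that
  proof (rule wp_While[where T = T])
    fix \<sigma>' t' assume "I \<sigma>' t'"
    then obtain S pc v r st where I: "reached (S, pc, (v, r) # st)" "frame f \<sigma> \<sigma>'"
     "regs \<sigma>' rV = v" "cell_chain inp (regs \<sigma>' rC) r"
     "regs \<sigma>' rRun = 1 \<or> regs \<sigma>' rRun = 0 \<and> v = 0 \<and> r = [] \<and> st = []"
     "?B \<sigma>' f = S" "?B \<sigma>' 5 = Z \<union> pc ` (S - {0})" "X S (?B \<sigma>' 2) (?B \<sigma>' 3)"
     "t' + \<Psi> (?B \<sigma>' 2) + 10 * regs \<sigma>' rRun + dfs_potential S ((v, r) # st) \<le> T"
      unfolding I_def by blast
    then show "t' \<le> T" by simp
    show "Q \<sigma>' (t' + (1 + exp_cost (Reg rRun)))" if "exp_val w (regs \<sigma>') (Reg rRun) = 0"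
    proof -
      have z: "v = 0" "r = []" "st = []" using I(5) that by auto
      then have S: "S = {..<n}" using final_all I(1) by simp
      show ?thesis
        by (rule Q[of \<sigma>' pc]) (use I z S n_pos in \<open>simp_all add: T_def\<close>)
    qed
    assume "exp_val w (regs \<sigma>') (Reg rRun) \<noteq> 0"
    then have run: "regs \<sigma>' rRun = 1" using I(5) by auto
    have inv: "dfs_inv (S, pc, (v, r) # st)" using I(1) reached_inv by blast
    then have so: "stack_ok pc ((v, r) # st)" and v: "v < n" and SV: "S \<subseteq> {..<n}" and vS: "v \<in> S" by auto
    obtain pre where Lv: "L v = pre @ r" using so by (auto simp: stack_ok_Cons)
    have cells: "\<And>c. c \<in> set r \<Longrightarrow> is_cell c" using Lv is_cell_L[OF v] by simp
    have RS: "regs \<sigma>' rS = N" "length (mem \<sigma>') = mem_size" using I(2) init by (auto simp: frame_def)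
    have vN: "v < N" using v n_lt_N by simp
    show "WP (dfs_body f hook) I \<sigma>' (t' + (1 + exp_cost (Reg rRun)))"
    proof (cases r)
      case Nil
      then have C0: "regs \<sigma>' rC = 0" using I(4) by simp
      show ?thesis
      proof (cases "v = 0")
        case True
        then have st: "st = []" using so by (auto simp: stack_ok_Cons split: list.splits)
        have "I (\<sigma>'\<lparr>regs := (regs \<sigma>')(rRun := 0)\<rparr>) (t' + 8)"
          unfolding I_def using I Nil True st run
          by (intro exI[of _ S] exI[of _ pc] exI[of _ v] exI[of _ r] exI[of _ st]) (simp add: frame_def)
        then show ?thesis using C0 True I(3)
          by (simp add: dfs_body_def wp_ctrl add.commute)
      next
        case False
        then obtain y r' st' where st: "st = (y, r') # st'" 
          using so by (cases st) (auto simp: stack_ok_Cons)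
        obtain pre' where y: "nb (pc v) = y" "L y = pre' @ cr (pc v) # r'" 
          using so st by (auto simp: stack_ok_Cons)
        have pv: "pc v \<in> set (L v)" "y < n" using inv False vS st by auto
        \<comment> \<open>A mark in the list of \<open>v\<close> comes either from \<open>Z\<close>,
          and then it is \<open>pc v\<close> by assumption, or from some visited \<open>x\<close>,
          and then \<open>x = v\<close> because lists are disjoint.\<close>
        have p: "?B \<sigma>' 5 \<inter> set (L v) = {pc v}"
        proof -
          have "z = pc v" if z: "z \<in> set (L v)" "z \<in> Z \<union> pc ` (S - {0})" for z
          proof (cases "z \<in> Z")
            case True
            then show ?thesis using Z I(1) vS \<open>v \<noteq> 0\<close> z by blast
          next
            case False
            then obtain x where x: "x \<in> S - {0}" "z = pc x" using z False by blast
            then have "z \<in> set (L x)" "x < n" using inv by auto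
            then show ?thesis using L_disjoint v z x by blast
          qed
          then have "?B \<sigma>' 5 \<inter> set (L v) \<subseteq> {pc v}" unfolding I(7) by blast
          moreover have "pc v \<in> ?B \<sigma>' 5" unfolding I(7) using vS False by blast
          ultimately show ?thesis using pv by blast
        qed
        have ch: "cell_chain inp (nx (cr (pc v))) r'" using chain_prefix[OF pv(2) y(2)] .
        have cells': "is_cell (pc v)" "is_cell (cr (pc v))" "\<And>c. c \<in> set r' \<Longrightarrow> is_cell c"
          using is_cell_L v pv y by auto
        have reach: "reached (S, pc, (y, r') # st')"
          using reached_step[OF I(1)] dfs_step.up[of S pc v "(y, r')" st'] Nil st by simp
        have "I (\<sigma>'\<lparr>regs := (regs \<sigma>')(rP := pc v, rT := 1, rV := y, rC := nx (cr (pc v)))\<rparr>) (t'' + 10)"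
          if "t'' \<le> t' + 6 + 28 + 28 * length (L v)" for t''
          unfolding I_def using I Nil st run ch that reach
          by (intro exI[of _ S] exI[of _ pc] exI[of _ y] exI[of _ r'] exI[of _ st']) 
             (simp add: frame_def dfs_potential_def)
        then show ?thesis using C0 False I(3) RS v p cells' y
          by (simp add: dfs_body_def wp_ctrl add.commute)
             (rule wp_find_parent[where x = v and p = "pc v"], 
               simp_all add: wp_Seq wp_read_nb wp_read_cross wp_read_next add.commute)
      qed
    next
      case (Cons c r')
      then have C: "regs \<sigma>' rC = c" using I(4) by simp
      have cv: "c \<in> set (L v)" "is_cell c" using Lv Cons cells by auto
      have ch: "cell_chain inp (nx c) r'" using chain_prefix[OF v] Lv Cons by blast
      have cells': "\<And>c. c \<in> set r' \<Longrightarrow> is_cell c" using cells Cons by simp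
      have c0: "c \<noteq> 0" using is_cellD[OF cv(2)] by simp
      let ?u = "nb c"
      have u: "?u < n" "?u < N" using is_cellD[OF cv(2)] n_lt_N by auto
      show ?thesis
      proof (cases "?u \<in> S")
        case True
        have reach: "reached (S, pc, (v, r') # st)"
          using reached_step[OF I(1)] dfs_step.skip[OF True, of pc v r' st] Cons by simp
        have "I (\<sigma>'\<lparr>regs := (regs \<sigma>')(rU := ?u, rT := 1, rC := nx c)\<rparr>) (t' + 32)"
          unfolding I_def using I Cons run ch reach
          by (intro exI[of _ S] exI[of _ pc] exI[of _ v] exI[of _ r'] exI[of _ st]) 
             (simp add: frame_def dfs_potential_def)
        then show ?thesis using C cv u I(6) True RS f6 c0
          by (simp add: dfs_body_def wp_ctrl wp_read_nb wp_get_bit wp_read_next add.commute)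
      next
        case False
        have reach: "reached (insert ?u S, pc(?u := cr c), (?u, L ?u) # (v, r') # st)"
          using reached_step[OF I(1)] dfs_step.down[OF False, of pc v r' st] Cons by simp
        have u0: "?u \<noteq> 0" using False inv by auto
        have crc: "is_cell (cr c)" "cr c < N" using is_cellD is_cell_lt cv by auto
        have ent: "entering S ?u (pc(?u := cr c))"
          unfolding entering_def using u False SV inv reach nb_cross[OF v cv(1)] vS
          by (auto simp: parent_def)
        define M where "M = set_bit_mem (set_bit_mem (mem \<sigma>') 5 (cr c)) f ?u"
        have M: "length M = mem_size" "bits M f = insert ?u S" "bits M 5 = Z \<union> (pc(?u := cr c)) ` (insert ?u S - {0})"
          "\<And>g. g < 6 \<Longrightarrow> g \<notin> {5, f} \<Longrightarrow> bits M g = ?B \<sigma>' g"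
          using RS crc u f6 I(6,7) u0 False by (auto simp: M_def bits_set_bit_mem image_iff)
        define \<sigma>1 where "\<sigma>1 = \<sigma>'\<lparr>regs := (regs \<sigma>')(rU := ?u, rT := 0, rP := cr c, rJ := mem \<sigma>' ! ((5 * N + cr c) div w),
             rV := ?u, rJ := set_bit_mem (mem \<sigma>') 5 (cr c) ! ((f * N + ?u) div w)), mem := M\<rparr>"
        have "WP hook (WP (read_plus2 rC rV) I) \<sigma>1 (t' + 88)"
        proof (rule hook[unfolded hook_spec_def, rule_format, OF ent])
          show "regs \<sigma>1 rS = N" "regs \<sigma>1 rV = ?u" "length (mem \<sigma>1) = mem_size" "bits (mem \<sigma>1) f = insert ?u S" 
            "bits (mem \<sigma>1) 5 = Z \<union> (pc(?u := cr c)) ` (insert ?u S - {0})"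
            using RS M by (simp_all add: \<sigma>1_def)
          show "X S (bits (mem \<sigma>1) 2) (bits (mem \<sigma>1) 3)" using I(8) M(4) f6 by (simp add: \<sigma>1_def)
          fix \<sigma>2 t2 assume post: "hook_post \<sigma>1 \<sigma>2" "X (insert ?u S) (bits (mem \<sigma>2) 2) (bits (mem \<sigma>2) 3)"
           "t2 + \<Psi> (bits (mem \<sigma>2) 2) \<le> t' + 88 + \<Psi> (bits (mem \<sigma>1) 2) + 100 + 100 * length (L ?u)"
          have V2: "regs \<sigma>2 rV = ?u" "regs \<sigma>2 rRun = 1" using post(1) run by (auto simp: hook_post_def \<sigma>1_def)
          have fr: "frame f \<sigma> (\<sigma>2\<lparr>regs := (regs \<sigma>2)(rC := inp ! (2 + ?u))\<rparr>)"
            using I(2) post(1) M f6 by (auto simp: frame_def hook_post_def \<sigma>1_def RS)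
          have B2: "bits (mem \<sigma>2) f = insert ?u S" "bits (mem \<sigma>2) 5 = Z \<union> (pc(?u := cr c)) ` (insert ?u S - {0})"
            using post(1) M f6 by (auto simp: hook_post_def \<sigma>1_def)
          have "\<Psi> (bits (mem \<sigma>1) 2) = \<Psi> (?B \<sigma>' 2)" using M(4)[of 2] f6 by (simp add: \<sigma>1_def)
          then have time: "t2 + 4 + \<Psi> (bits (mem \<sigma>2) 2) + 10 + dfs_potential (insert ?u S) ((?u, L ?u) # (v, r') # st) \<le> T"
            using I(9) post(3) run dfs_potential_insert[OF u(1) False, of "(v, r) # st"] Cons
            by (simp add: dfs_potential_def)
          have "I (\<sigma>2\<lparr>regs := (regs \<sigma>2)(rC := inp ! (2 + ?u))\<rparr>) (t2 + 4)"
            unfolding I_def using reach fr V2 chain[OF u(1)] B2 post(2) time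
            by (intro exI[of _ "insert ?u S"] exI[of _ "pc(?u := cr c)"] exI[of _ ?u] exI[of _ "L ?u"] exI[of _ "(v, r') # st"]) simp
          then show "WP (read_plus2 rC rV) I \<sigma>2 t2" using V2 u by (simp add: wp_read_first)
        qed
        then show ?thesis using C cv u I(6) False RS f6 c0 crc
          by (simp add: dfs_body_def wp_ctrl wp_read_nb wp_get_bit wp_set_bit wp_read_cross \<sigma>1_def M_def add.commute)
      qed
    qed
  qed
  define M where "M = set_bit_mem (mem \<sigma>) f 0"
  have zN: "0 < N" using n_pos n_lt_N by linarith
  have M: "length M = mem_size" "bits M f = {0}" "\<And>g. g < 6 \<Longrightarrow> g \<noteq> f \<Longrightarrow> bits M g = ?B \<sigma> g"
    using init f6 zN by (auto simp: M_def bits_set_bit_mem)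
  define \<sigma>1 where "\<sigma>1 = \<sigma>\<lparr>regs := (regs \<sigma>)(rV := 0, rJ := mem \<sigma> ! ((f * N) div w)), mem := M\<rparr>"
  have start: "reached ({0}, \<lambda>_. 0, [(0, L 0)])" using reached_start by (simp add: dfs_start_def)
  then have ent: "entering {} 0 (\<lambda>_. 0)" using n_pos by (auto simp: entering_def)
  have "WP hook (WP (Seq (read_plus2 rC rV) (Seq (Assign rRun (Const 1)) (While (Reg rRun) (dfs_body f hook)))) Q) \<sigma>1 (t + 29)"
  proof (rule hook[unfolded hook_spec_def, rule_format, OF ent])
    show "regs \<sigma>1 rS = N" "regs \<sigma>1 rV = 0" "length (mem \<sigma>1) = mem_size" "bits (mem \<sigma>1) f = insert 0 {}" 
       "bits (mem \<sigma>1) 5 = Z \<union> (\<lambda>_. 0) ` (insert 0 {} - {0})" "X {} (bits (mem \<sigma>1) 2) (bits (mem \<sigma>1) 3)"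
      using M init f6 by (simp_all add: \<sigma>1_def)
    fix \<sigma>2 t2 assume post: "hook_post \<sigma>1 \<sigma>2" "X (insert 0 {}) (bits (mem \<sigma>2) 2) (bits (mem \<sigma>2) 3)"
           "t2 + \<Psi> (bits (mem \<sigma>2) 2) \<le> t + 29 + \<Psi> (bits (mem \<sigma>1) 2) + 100 + 100 * length (L 0)"
    have "\<Psi> (bits (mem \<sigma>1) 2) = \<Psi> (?B \<sigma> 2)" using M(3)[of 2] f6 by (simp add: \<sigma>1_def)
    moreover have "dfs_potential {} [] \<le> 300 * n + 600 * card E"
      using sum_degrees by (simp add: dfs_potential_def sum.distrib sum_distrib_left[symmetric])
    ultimately have time: "t2 + 6 + \<Psi> (bits (mem \<sigma>2) 2) + 10 + dfs_potential {0} [(0, L 0)] \<le> T"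
      using post(3) dfs_potential_insert[OF n_pos, of "{}" "[]"] n_pos
      by (simp add: dfs_potential_def T_def)
    have V2: "regs \<sigma>2 rV = 0" using post(1) by (auto simp: hook_post_def \<sigma>1_def)
    have "I (\<sigma>2\<lparr>regs := (regs \<sigma>2)(rC := inp ! 2, rRun := 1)\<rparr>) (t2 + 6)"
      unfolding I_def using start time V2 chain[OF n_pos] post M f6 init
      by (intro exI[of _ "{0}"] exI[of _ "\<lambda>_. 0"] exI[of _ 0] exI[of _ "L 0"] exI[of _ "[]"])
         (simp add: frame_def hook_post_def \<sigma>1_def)
    from loop[OF this] show "WP (Seq (read_plus2 rC rV) (Seq (Assign rRun (Const 1)) (While (Reg rRun) (dfs_body f hook)))) Q \<sigma>2 t2"
      using V2 n_pos w_ge by (simp add: wp_ctrl wp_read_first one_mod add.commute)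
  qed
  then show ?thesis using init zN f6
    by (simp add: dfs_com_def wp_ctrl wp_set_bit \<sigma>1_def M_def add.commute)
qed

end

section \<open>Covering tree edges\<close>

abbreviation (input) "rY \<equiv> 23 :: nat"

text \<open>\<open>rT\<close> is the stop flag: 1 if the parent is \<open>v\<close>, otherwise the
  covered bit of the parent. The vertex right below \<open>v\<close> gets no bit in field 3, as for
  it the edge does not lead above the parent.\<close>

definition walk_body :: com where
  "walk_body = Seq (set_bit_com 2 rX) (Seq (find_parent_com rX) (Seq (ReadInput rY (Reg rP))
     (If (Bin Equal (Reg rY) (Reg rV)) (Assign rT (Const 1))
        (Seq (set_bit_com 3 rX) (Seq (Assign rX (Reg rY)) (get_bit_com 2 rX))))))"

definition walk_com :: com where
  "walk_com = Seq (Assign rX (Reg rU)) (Seq (get_bit_com 2 rX) (While (Bin Equal (Reg rT) (Const 0)) walk_body))"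

text \<open>Field 1 tells the direction of the edge: a neighbour already visited by the second
  search is an ancestor of \<open>rV\<close>, an unvisited one a descendant. Field 5 at the cross
  pointer then tells whether the edge is a tree edge.\<close>

definition mark_body :: com where
  "mark_body = Seq (ReadInput rU (Reg rC)) (Seq (get_bit_com 1 rU)
     (Seq (If (Reg rT) Skip (Seq (read_plus2 rP rC) (Seq (get_bit_com 5 rP) (If (Reg rT) Skip walk_com))))
        (read_next rC rC)))"

definition mark_com :: com where
  "mark_com = Seq (read_plus2 rC rV) (While (Reg rC) mark_body)"

lemma update_mem_regs: "\<sigma>\<lparr>mem := m, regs := r\<rparr> = \<sigma>\<lparr>regs := r, mem := m\<rparr>"
  by (cases \<sigma>) simp

locale ram_tree = ram n E inp L w + tree: dfs_tree "{..<n}" E 0 "adjacency.parent inp pc" dep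
  for n E inp L w and pc :: "nat \<Rightarrow> nat" and dep :: "nat \<Rightarrow> nat" +
  assumes final: "reached ({..<n}, pc, [(0, [])])"
begin

abbreviation "par \<equiv> parent pc"
abbreviation "anc \<equiv> tree.anc"
abbreviation "spans \<equiv> tree.spans"

definition parent_cells :: "nat set" where
  "parent_cells = pc ` ({..<n} - {0})"

lemma pc_cell: "x < n \<Longrightarrow> x \<noteq> 0 \<Longrightarrow> pc x \<in> set (L x)"
  using reached_inv[OF final] by simp

lemma parent_cells_list: "x < n \<Longrightarrow> x \<noteq> 0 \<Longrightarrow> parent_cells \<inter> set (L x) = {pc x}"
proof -
  assume x: "x < n" "x \<noteq> 0"
  have "z = pc x" if "z \<in> parent_cells" "z \<in> set (L x)" for z
  proof -
    obtain y where y: "y < n" "y \<noteq> 0" "z = pc y" using \<open>z \<in> parent_cells\<close> by (auto simp: parent_cells_def)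
    then show ?thesis using pc_cell L_disjoint x that by metis
  qed
  moreover have "pc x \<in> parent_cells" using x by (auto simp: parent_cells_def)
  ultimately show ?thesis using pc_cell x by blast
qed

section \<open>Walking up from the lower end of a back edge\<close>

definition strand :: "nat \<Rightarrow> nat \<Rightarrow> nat set" where
  "strand v u = {x. anc x u \<and> anc v x \<and> x \<noteq> v}"

text \<open>A walk scans the list of each vertex it marks to find the parent; every uncovered vertex
  holds the cost of this single scan.\<close>

definition cover_potential :: "nat set \<Rightarrow> nat" where
  "cover_potential B = (\<Sum>x\<in>{..<n} - B. 150 + 150 * length (L x))"

lemma cover_potential_insert:
  "x < n \<Longrightarrow> x \<notin> B \<Longrightarrow> cover_potential B = 150 + 150 * length (L x) + cover_potential (insert x B)"
proof -
  assume x: "x < n" "x \<notin> B"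
  have "{..<n} - B - {x} = {..<n} - insert x B" by auto
  then show ?thesis
    using sum.remove[of "{..<n} - B" x "\<lambda>x. 150 + 150 * length (L x)"] x
    by (simp add: cover_potential_def)
qed

definition walk_frame :: "state \<Rightarrow> state \<Rightarrow> bool" where
  "walk_frame \<sigma> \<sigma>' \<longleftrightarrow> (\<forall>r\<in>{rS, rN, rV, rRun, rC}. regs \<sigma>' r = regs \<sigma> r) \<and>
     length (mem \<sigma>') = length (mem \<sigma>) \<and> outp \<sigma>' = outp \<sigma> \<and>
     (\<forall>g<6. g \<notin> {2, 3} \<longrightarrow> bits (mem \<sigma>') g = bits (mem \<sigma>) g)"

text \<open>Once the walk meets a covered vertex it may stop, since this condition holds for the marks
  made for \<open>v\<close> and for the ancestors of \<open>v\<close>.\<close>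

definition upward :: "nat \<Rightarrow> nat set \<Rightarrow> nat set \<Rightarrow> bool" where
  "upward v B H \<longleftrightarrow> (\<forall>x\<in>B. anc v x \<longrightarrow> x \<noteq> v \<longrightarrow> par x \<noteq> v \<longrightarrow> x \<in> H \<and> par x \<in> B)"

lemma strand_upward:
  assumes "upward v B H" "x \<in> B" "y \<in> strand v x"
  shows "y \<in> B \<and> (par y \<noteq> v \<longrightarrow> y \<in> H)"
proof -
  have y: "anc y x" "anc v y" "y \<noteq> v" using assms(3) by (auto simp: strand_def)
  have "anc v x \<and> y \<in> B"
    using y(1) assms(2) unfolding tree.anc_def
  proof (induction rule: converse_rtrancl_induct)
    case base
    then show ?case using y(2) by (simp add: tree.anc_def)
  next
    case (step x z)
    then have z: "x < n" "x \<noteq> 0" "z = par x" "anc y z" by (auto simp: tree_up_def tree.anc_def)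
    then have "anc v z" using y tree.anc_trans by blast
    then have "anc v x" using z tree.anc_trans tree.anc_par by blast
    moreover have "x \<noteq> v" using z \<open>anc v z\<close> tree.anc_antisym tree.anc_par tree.par_neq lessThan_iff by metis
    \<comment> \<open>\<open>y\<close> lies strictly below \<open>v\<close> and is
      \<open>par x\<close> or an ancestor of it.\<close>
    moreover have "par x \<noteq> v" using z y tree.anc_antisym by blast
    ultimately show ?case using step assms(1) z by (auto simp: upward_def tree.anc_def)
  qed
  then show ?thesis using assms(1) y by (auto simp: upward_def)
qed

lemma strand_step:
  assumes "x < n" "x \<noteq> v" "anc v x"
  shows "strand v x = insert x (strand v (par x))" "x \<noteq> 0" "anc v (par x)" "par x < n"
proof -
  show x0: "x \<noteq> 0"
    using assms tree.anc_antisym tree.root_anc tree.anc_in by (metis lessThan_iff)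
  show "anc v (par x)" using assms tree.anc_cases by blast
  show "par x < n" using tree.par_in assms x0 by simp
  show "strand v x = insert x (strand v (par x))"
    using assms x0 tree.anc_cases[of _ x] tree.anc_trans[OF _ tree.anc_par[of x]]
    by (auto simp: strand_def)
qed

lemma strand_self [simp]: "strand v v = {}"
  using tree.anc_antisym by (auto simp: strand_def)

text \<open>Each pass covers a new vertex and is paid by its share of
  \<open>cover_potential\<close>. The remaining 26 steps are the initial assignment (2), the first
  bit test (20) and the last loop test (4).\<close>

lemma wp_walk:
  assumes reg: "regs \<sigma> rS = N" "length (mem \<sigma>) = mem_size" "regs \<sigma> rV = v" "regs \<sigma> rU = u"
    and u: "u < n" "anc v u" "u \<noteq> v" and v: "v < n"
    and B5: "bits (mem \<sigma>) 5 = parent_cells"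
    and up: "upward v (bits (mem \<sigma>) 2) (bits (mem \<sigma>) 3)"
    and Q: "\<And>\<sigma>' t'. walk_frame \<sigma> \<sigma>' \<Longrightarrow> bits (mem \<sigma>') 2 = bits (mem \<sigma>) 2 \<union> strand v u \<Longrightarrow>
       bits (mem \<sigma>') 3 = bits (mem \<sigma>) 3 \<union> {x\<in>strand v u. par x \<noteq> v} \<Longrightarrow>
       t' + cover_potential (bits (mem \<sigma>') 2) \<le> t + cover_potential (bits (mem \<sigma>) 2) + 26 \<Longrightarrow> Q \<sigma>' t'"
  shows "WP walk_com Q \<sigma> t"
proof -
  let ?B = "\<lambda>\<sigma> g. bits (mem \<sigma>) g"
  let ?T = "t + cover_potential (?B \<sigma> 2) + 22"
  \<comment> \<open>\<open>D\<close> is the part of the strand below the current vertex \<open>x\<close>; \<open>x = v\<close> encodes that the walk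
    has reached its end.\<close>
  define I where "I \<sigma>' t' \<longleftrightarrow> (\<exists>x D. walk_frame \<sigma> \<sigma>' \<and> x < n \<and> anc v x \<and> strand v u = D \<union> strand v x \<and>
     D \<inter> strand v x = {} \<and> ?B \<sigma>' 2 = ?B \<sigma> 2 \<union> D \<and> ?B \<sigma>' 3 = ?B \<sigma> 3 \<union> {y\<in>D. par y \<noteq> v} \<and>
     (x = v \<and> regs \<sigma>' rT = 1 \<or> x \<noteq> v \<and> regs \<sigma>' rX = x \<and> regs \<sigma>' rT = of_bool (x \<in> ?B \<sigma>' 2)) \<and>
     t' + cover_potential (?B \<sigma>' 2) \<le> ?T)" for \<sigma>' t'
  have loop: "WP (While (Bin Equal (Reg rT) (Const 0)) walk_body) Q \<sigma>' t'" if "I \<sigma>' t'" for \<sigma>' t'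
    using that
  proof (rule wp_While[where T = ?T])
    fix \<sigma>' t' assume "I \<sigma>' t'"
    then obtain x D where I: "walk_frame \<sigma> \<sigma>'" "x < n" "anc v x" "strand v u = D \<union> strand v x"
      "D \<inter> strand v x = {}" "?B \<sigma>' 2 = ?B \<sigma> 2 \<union> D" "?B \<sigma>' 3 = ?B \<sigma> 3 \<union> {y\<in>D. par y \<noteq> v}"
      "x = v \<and> regs \<sigma>' rT = 1 \<or> x \<noteq> v \<and> regs \<sigma>' rX = x \<and> regs \<sigma>' rT = of_bool (x \<in> ?B \<sigma>' 2)"
      "t' + cover_potential (?B \<sigma>' 2) \<le> ?T"
      unfolding I_def by blast
    then show "t' \<le> ?T" by simp
    show "Q \<sigma>' (t' + (1 + exp_cost (Bin Equal (Reg rT) (Const 0))))"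
      if e: "exp_val w (regs \<sigma>') (Bin Equal (Reg rT) (Const 0)) = 0"
    proof (rule Q)
      \<comment> \<open>\<open>upward\<close> is assumed for the marks before the walk and may fail
        in between, when the parent of the vertex just marked is still unmarked. But
        \<open>x\<close>, on which the walk stops, is not in \<open>D\<close>, so it was marked from
        the start.\<close>
      have S: "strand v x \<subseteq> ?B \<sigma> 2 \<and> {y\<in>strand v x. par y \<noteq> v} \<subseteq> ?B \<sigma> 3"
      proof (cases "x = v")
        case False
        then have "x \<in> ?B \<sigma>' 2" using e I(8) by (auto simp: of_bool_mod)
        moreover have "x \<in> strand v x" using False I(3) by (auto simp: strand_def)
        ultimately have "x \<in> ?B \<sigma> 2" using I(5,6) by auto
        then show ?thesis using strand_upward[OF up] by auto
      qed auto
      show "?B \<sigma>' 2 = ?B \<sigma> 2 \<union> strand v u" "?B \<sigma>' 3 = ?B \<sigma> 3 \<union> {x\<in>strand v u. par x \<noteq> v}"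
        using S I(4,6,7) by auto
      show "t' + (1 + exp_cost (Bin Equal (Reg rT) (Const 0))) + cover_potential (?B \<sigma>' 2)
         \<le> t + cover_potential (?B \<sigma> 2) + 26" using I(9) by simp
    qed (rule I)
    assume e: "exp_val w (regs \<sigma>') (Bin Equal (Reg rT) (Const 0)) \<noteq> 0"
    have xv: "x \<noteq> v" "regs \<sigma>' rX = x" "x \<notin> ?B \<sigma>' 2" 
      using e I(8) by (auto simp: of_bool_mod split: if_splits)
    note st = strand_step[OF I(2) xv(1) I(3)]
    have reg': "regs \<sigma>' rS = N" "length (mem \<sigma>') = mem_size" "regs \<sigma>' rV = v" "?B \<sigma>' 5 = parent_cells"
      using I(1) reg B5 by (auto simp: walk_frame_def)
    have xN: "x < N" "par x < N" using I(2) st(4) n_lt_N by auto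
    define M where "M = set_bit_mem (mem \<sigma>') 2 x"
    have M: "length M = mem_size" "bits M 2 = insert x (?B \<sigma>' 2)" "\<And>g. g < 6 \<Longrightarrow> g \<noteq> 2 \<Longrightarrow> bits M g = ?B \<sigma>' g"
      using reg' xN by (auto simp: M_def bits_set_bit_mem)
    define \<sigma>1 where "\<sigma>1 = \<sigma>'\<lparr>regs := (regs \<sigma>')(rJ := mem \<sigma>' ! ((2 * N + x) div w)), mem := M\<rparr>"
    have cell: "is_cell (pc x)" "nb (pc x) = par x" using is_cell_L pc_cell st(2) I(2) by (auto simp: parent_def)
    have px: "par x \<noteq> x" using tree.par_neq I(2) st(2) by simp
    have nx: "x \<notin> strand v (par x)"
      using tree.anc_antisym tree.anc_par tree.par_neq I(2) st(2) by (auto simp: strand_def)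
    have time: "cover_potential (?B \<sigma>' 2) = 150 + 150 * length (L x) + cover_potential (bits M 2)"
      using cover_potential_insert[OF I(2) xv(3)] M(2) by simp
    have "WP (find_parent_com rX) (WP (Seq (ReadInput rY (Reg rP))
     (If (Bin Equal (Reg rY) (Reg rV)) (Assign rT (Const 1))
        (Seq (set_bit_com 3 rX) (Seq (Assign rX (Reg rY)) (get_bit_com 2 rX))))) I) \<sigma>1 (t' + 31)"
    proof (rule wp_find_parent[where x = x and p = "pc x"])
      show "regs \<sigma>1 rS = N" "regs \<sigma>1 rX = x" "x < n" "rX \<noteq> rP" "rX \<noteq> rT" "length (mem \<sigma>1) = mem_size"
        "bits (mem \<sigma>1) 5 \<inter> set (L x) = {pc x}"
        using reg' xv M I(2) st(2) parent_cells_list by (simp_all add: \<sigma>1_def)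
      fix t2 assume t2: "t2 \<le> t' + 31 + 28 + 28 * length (L x)"
      define \<sigma>2 where "\<sigma>2 = \<sigma>1\<lparr>regs := (regs \<sigma>1)(rP := pc x, rY := par x, rT := 1)\<rparr>"
      show "WP (Seq (ReadInput rY (Reg rP))
         (If (Bin Equal (Reg rY) (Reg rV)) (Assign rT (Const 1))
          (Seq (set_bit_com 3 rX) (Seq (Assign rX (Reg rY)) (get_bit_com 2 rX))))) I 
         (\<sigma>1\<lparr>regs := (regs \<sigma>1)(rP := pc x, rT := 1)\<rparr>) t2"
      proof (cases "par x = v")
        case True
        have "I \<sigma>2 (t2 + 8)"
          unfolding I_def
        proof (rule exI[of _ v], rule exI[of _ "insert x D"], intro conjI)
          show "walk_frame \<sigma> \<sigma>2" using I(1) M reg' by (auto simp: walk_frame_def \<sigma>2_def \<sigma>1_def reg)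
          show "strand v u = insert x D \<union> strand v v" using I(4) st(1) True by auto
          show "bits (mem \<sigma>2) 2 = ?B \<sigma> 2 \<union> insert x D" using M I(6) by (simp add: \<sigma>2_def \<sigma>1_def)
          show "bits (mem \<sigma>2) 3 = ?B \<sigma> 3 \<union> {y\<in>insert x D. par y \<noteq> v}" 
            using M(3)[of 3] I(7) True by (auto simp: \<sigma>2_def \<sigma>1_def)
          show "t2 + 8 + cover_potential (bits (mem \<sigma>2) 2) \<le> ?T"
            using I(9) t2 time by (simp add: \<sigma>2_def \<sigma>1_def)
        qed (auto simp: v \<sigma>2_def)
        then show ?thesis using cell True reg' w_ge
          by (simp add: wp_ctrl wp_read_nb \<sigma>2_def \<sigma>1_def of_bool_mod add.commute)
      next
        case False
        define \<sigma>3 where "\<sigma>3 = \<sigma>2\<lparr>regs := (regs \<sigma>2)(rJ := M ! ((3 * N + x) div w), rX := par x, rT := of_bool (par x \<in> ?B \<sigma>' 2)),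
           mem := set_bit_mem M 3 x\<rparr>"
        have M3: "length (mem \<sigma>3) = mem_size" "bits (mem \<sigma>3) 3 = insert x (?B \<sigma>' 3)" 
          "bits (mem \<sigma>3) 2 = bits M 2"
          "\<And>g. g < 6 \<Longrightarrow> g \<notin> {2, 3} \<Longrightarrow> bits (mem \<sigma>3) g = ?B \<sigma>' g"
          using M xN by (auto simp: \<sigma>3_def bits_set_bit_mem)
        have "I \<sigma>3 (t2 + 55)"
          unfolding I_def
        proof (rule exI[of _ "par x"], rule exI[of _ "insert x D"], intro conjI)
          show "walk_frame \<sigma> \<sigma>3" using I(1) M3 reg' by (auto simp: walk_frame_def \<sigma>3_def \<sigma>2_def \<sigma>1_def reg)
          show "strand v u = insert x D \<union> strand v (par x)" using I(4) st(1) by auto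
          show "insert x D \<inter> strand v (par x) = {}" using nx I(5) st(1) by auto
          show "bits (mem \<sigma>3) 2 = ?B \<sigma> 2 \<union> insert x D" using M M3 I(6) by simp
          show "bits (mem \<sigma>3) 3 = ?B \<sigma> 3 \<union> {y\<in>insert x D. par y \<noteq> v}" 
            using M3 I(7) False by auto
          show "t2 + 55 + cover_potential (bits (mem \<sigma>3) 2) \<le> ?T"
            using I(9) t2 time M3 by simp
        qed (use st False M3 M px in \<open>auto simp: \<sigma>3_def\<close>)
        then show ?thesis using cell False reg' w_ge M xN xv px
          by (simp add: wp_ctrl wp_read_nb wp_set_bit wp_get_bit bits_set_bit_mem \<sigma>3_def \<sigma>2_def \<sigma>1_def of_bool_mod update_mem_regs add.commute split del: split_of_bool)
      qed
    qed
    then show "WP walk_body I \<sigma>' (t' + (1 + exp_cost (Bin Equal (Reg rT) (Const 0))))"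
      using reg' xN xv by (simp add: walk_body_def wp_ctrl wp_set_bit \<sigma>1_def M_def add.commute)
  qed
  have "I (\<sigma>\<lparr>regs := (regs \<sigma>)(rX := u, rT := of_bool (u \<in> ?B \<sigma> 2))\<rparr>) (t + 22)"
    unfolding I_def by (rule exI[of _ u], rule exI[of _ "{}"]) (use u in \<open>auto simp: walk_frame_def\<close>)
  from loop[OF this] show ?thesis
    using reg u n_lt_N by (simp add: walk_com_def wp_ctrl wp_get_bit add.commute)
qed

section \<open>Treating all back edges at an entered vertex\<close>

definition marked :: "nat set \<Rightarrow> nat set \<Rightarrow> nat set \<Rightarrow> bool" where
  "marked S B H \<longleftrightarrow> B = {x. \<exists>t\<in>S. \<exists>u. spans t u x} \<and> H = {x. \<exists>t\<in>S. \<exists>u. spans t u x \<and> par x \<noteq> t}"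

text \<open>For every back edge from below, the strand walked is exactly the set of vertices spanned
  by it, and every edge that spans a vertex from its upper end \<open>v\<close> occurs in the list
  of \<open>v\<close>.\<close>

lemma mark_spec: "hook_spec 1 parent_cells marked cover_potential mark_com"
  unfolding hook_spec_def
proof (intro allI impI)
  fix S v pc' \<sigma> t Q
  let ?B = "\<lambda>\<sigma> g. bits (mem \<sigma>) g"
  assume ent: "entering S v pc'" and reg: "regs \<sigma> rS = N" "regs \<sigma> rV = v" "length (mem \<sigma>) = mem_size"
    and B1: "?B \<sigma> 1 = insert v S" and B5': "?B \<sigma> 5 = parent_cells \<union> pc' ` (insert v S - {0})"
    and mk: "marked S (?B \<sigma> 2) (?B \<sigma> 3)"
    and Q: "\<forall>\<sigma>' t'. hook_post \<sigma> \<sigma>' \<longrightarrow> marked (insert v S) (?B \<sigma>' 2) (?B \<sigma>' 3) \<longrightarrow>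
        t' + cover_potential (?B \<sigma>' 2) \<le> t + cover_potential (?B \<sigma> 2) + 100 + 100 * length (L v) \<longrightarrow> Q \<sigma>' t'"
  have v: "v < n" "v \<notin> S" "S \<subseteq> {..<n}" using ent by (auto simp: entering_def)
  obtain st where st: "reached (insert v S, pc', (v, L v) # st)" using ent by (auto simp: entering_def)
  \<comment> \<open>The parent cells of the running search agree with those of the first, so its
    visited set can be discussed in the finished tree.\<close>
  have pc': "pc' x = pc x" if "x \<in> insert v S" for x using final_reached[OF final st] that by auto
  have B5: "?B \<sigma> 5 = parent_cells"
  proof -
    have "pc' ` (insert v S - {0}) = pc ` (insert v S - {0})" using pc' by auto
    also have "\<dots> \<subseteq> parent_cells" using v by (auto simp: parent_cells_def)
    finally show ?thesis using B5' by auto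
  qed
  have parS: "par x \<in> S" if "x \<in> S" "x \<noteq> 0" for x
    using ent pc' that by (auto simp: entering_def parent_def)
  have ancS: "a \<in> S" if "anc a x" "x \<in> S" for a x
    using that unfolding tree.anc_def
    by (induction rule: rtrancl_induct) (auto simp: tree_up_def parS)
  have par_v: "v \<noteq> 0 \<Longrightarrow> par v \<in> S \<and> 0 \<in> S" using ent pc' by (auto simp: entering_def parent_def)
  have anc_v: "a \<in> S" if "anc a v" "a \<noteq> v" for a
  proof -
    have "v \<noteq> 0 \<and> anc a (par v)" using tree.anc_cases[OF that(1)] that(2) by auto
    then show ?thesis using ancS par_v by blast
  qed
  define I where "I \<sigma>' t' \<longleftrightarrow> (\<exists>done r. L v = done @ r \<and> cell_chain inp (regs \<sigma>' rC) r \<and> hook_post \<sigma> \<sigma>' \<and>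
     ?B \<sigma>' 2 = ?B \<sigma> 2 \<union> {x. \<exists>c\<in>set done. spans v (nb c) x} \<and>
     ?B \<sigma>' 3 = ?B \<sigma> 3 \<union> {x. \<exists>c\<in>set done. spans v (nb c) x \<and> par x \<noteq> v} \<and>
     t' + cover_potential (?B \<sigma>' 2) + 100 * length r \<le> t + cover_potential (?B \<sigma> 2) + 4 + 100 * length (L v))" for \<sigma>' t'
  have loop: "WP (While (Reg rC) mark_body) Q \<sigma>' t'" if "I \<sigma>' t'" for \<sigma>' t'
    using that
  proof (rule wp_While[where T = "t + cover_potential (?B \<sigma> 2) + 4 + 100 * length (L v)"])
    fix \<sigma>' t' assume "I \<sigma>' t'"
    then obtain dn r where I: "L v = dn @ r" "cell_chain inp (regs \<sigma>' rC) r" "hook_post \<sigma> \<sigma>'"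
     "?B \<sigma>' 2 = ?B \<sigma> 2 \<union> {x. \<exists>c\<in>set dn. spans v (nb c) x}"
     "?B \<sigma>' 3 = ?B \<sigma> 3 \<union> {x. \<exists>c\<in>set dn. spans v (nb c) x \<and> par x \<noteq> v}"
     "t' + cover_potential (?B \<sigma>' 2) + 100 * length r \<le> t + cover_potential (?B \<sigma> 2) + 4 + 100 * length (L v)"
      unfolding I_def by blast
    then show "t' \<le> t + cover_potential (?B \<sigma> 2) + 4 + 100 * length (L v)" by simp
    have cells: "\<And>c. c \<in> set r \<Longrightarrow> is_cell c" using I(1) is_cell_L[OF v(1)] by simp
    have reg': "regs \<sigma>' rS = N" "regs \<sigma>' rV = v" "length (mem \<sigma>') = mem_size" "?B \<sigma>' 1 = insert v S" "?B \<sigma>' 5 = parent_cells"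
      using I(3) reg B1 B5 by (auto simp: hook_post_def)
    show "Q \<sigma>' (t' + (1 + exp_cost (Reg rC)))" if "exp_val w (regs \<sigma>') (Reg rC) = 0"
    proof (rule Q[rule_format])
      have "r = []" using that chain_value[OF I(2) cells] by simp
      then have dn: "dn = L v" using I(1) by simp
      have cell: "\<exists>c\<in>set (L v). nb c = u" if "spans v u x" for u x
        using that edge_cell by (auto simp: tree.spans_def)
      show "marked (insert v S) (?B \<sigma>' 2) (?B \<sigma>' 3)"
        unfolding marked_def I(4,5) dn using mk cell unfolding marked_def by auto (metis)+
      show "t' + (1 + exp_cost (Reg rC)) + cover_potential (?B \<sigma>' 2) \<le> t + cover_potential (?B \<sigma> 2) + 100 + 100 * length (L v)"
        using I(6) by simp
    qed (rule I)
    assume "exp_val w (regs \<sigma>') (Reg rC) \<noteq> 0"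
    then obtain c r' where r: "r = c # r'" "regs \<sigma>' rC = c" using I(2) by (cases r) auto
    have cv: "c \<in> set (L v)" "is_cell c" using I(1) r cells by auto
    have ch: "cell_chain inp (nx c) r'" using I(2) r by simp
    define u where "u = nb c"
    have u: "u < n" "u < N" "u \<noteq> v" "{v, u} \<in> E" 
      using is_cellD[OF cv(2)] n_lt_N nb_neq[OF v(1) cv(1)] nb_edge[OF v(1) cv(1)] by (auto simp: u_def)
    have crc: "cr c < N" "is_cell (cr c)" "cr c \<in> set (L u)" "nb (cr c) = v"
      using is_cellD is_cell_lt cv cross_in[OF v(1) cv(1)] nb_cross[OF v(1) cv(1)] by (auto simp: u_def)
    have split: "{x. \<exists>d\<in>set (dn @ [c]). spans v (nb d) x} = {x. \<exists>d\<in>set dn. spans v (nb d) x} \<union> {x. spans v u x}"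
      "{x. \<exists>d\<in>set (dn @ [c]). spans v (nb d) x \<and> par x \<noteq> v} = 
        {x. \<exists>d\<in>set dn. spans v (nb d) x \<and> par x \<noteq> v} \<union> {x. spans v u x \<and> par x \<noteq> v}"
      by (auto simp: u_def)
    have skip: "WP (read_next rC rC) I (\<sigma>'\<lparr>regs := f\<rparr>) t2"
      if none: "\<And>x. \<not> spans v u x" and f: "\<And>r. r \<in> {rS, rN, rV, rRun, rC} \<Longrightarrow> f r = regs \<sigma>' r" and t2: "t2 \<le> t' + 60" for f t2
    proof -
      have none': "{x. spans v u x} = {}" "{x. spans v u x \<and> par x \<noteq> v} = {}" using none by auto
      have "I (\<sigma>'\<lparr>regs := f(rC := nx c)\<rparr>) (t2 + 4)"
        unfolding I_def 
        by (rule exI[of _ "dn @ [c]"], rule exI[of _ r'], unfold split none')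
          (use I r ch t2 f in \<open>simp add: hook_post_def\<close>)
      then show ?thesis using f r cv by (simp add: wp_read_next)
    qed
    show "WP mark_body I \<sigma>' (t' + (1 + exp_cost (Reg rC)))"
    proof (cases "u \<in> insert v S")
      case True
      \<comment> \<open>The visited set without \<open>v\<close> is closed under ancestors; a
        visited \<open>u \<noteq> v\<close> is therefore not below \<open>v\<close>.\<close>
      have "\<not> spans v u x" for x
        using True u v ancS[of v u] tree.spansD(6)[of v u x] by auto
      note skip = skip[OF this]
      show ?thesis using r cv u True reg'
        by (simp add: mark_body_def wp_ctrl wp_read_nb wp_get_bit u_def[symmetric] add.commute)
           (rule skip, auto)
    next
      case False
      \<comment> \<open>All proper ancestors of \<open>v\<close> are visited, so an unvisited
        neighbour can only be a descendant.\<close>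
      have avu: "anc v u"
        using tree.edge_comparable[OF u(4)] anc_v[of u] False unfolding tree.anc_def[symmetric] by auto
      have u0: "u \<noteq> 0" using avu False u tree.anc_cases[of v u] by auto
      show ?thesis
      proof (cases "cr c \<in> parent_cells")
        case True
        then have "pc u = cr c" using parent_cells_list[OF u(1) u0] crc(3) by (metis IntI singletonD)
        then have "par u = v" using crc u0 by (simp add: parent_def)
        then have "\<not> spans v u x" for x by (simp add: tree.spans_def)
        note skip = skip[OF this]
        show ?thesis using r cv u True False reg' crc
          by (simp add: mark_body_def wp_ctrl wp_read_nb wp_get_bit wp_read_cross u_def[symmetric] add.commute)
             (rule skip, auto)
      next
        case nt: False
        have pu: "par u \<noteq> v"
        proof
          assume "par u = v"
          then have "pc u = cr c" using nb_inj[OF u(1) pc_cell[OF u(1) u0] crc(3)] crc u0 by (simp add: parent_def)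
          then show False using nt parent_cells_list[OF u(1) u0] by (metis Int_iff singletonI)
        qed
        have strand: "strand v u = {x. spans v u x}"
          using u pu by (auto simp: strand_def tree.spans_def)
        have up: "upward v (?B \<sigma>' 2) (?B \<sigma>' 3)"
          unfolding upward_def
        proof (intro ballI impI)
          fix x assume x: "x \<in> ?B \<sigma>' 2" "anc v x" "x \<noteq> v" "par x \<noteq> v"
          have vp: "anc v (par x)" using x tree.anc_cases by blast
          \<comment> \<open>A mark of an earlier \<open>s\<close> has its upper end not below
            \<open>v\<close>, so \<open>s \<noteq> par x\<close> and the same edge spans
            \<open>par x\<close> too. A mark of the current \<open>v\<close> passes to
            \<open>par x\<close> because \<open>par x \<noteq> v\<close>.\<close>
          consider (old) s y where "s \<in> S" "spans s y x" | (new) d where "d \<in> set dn" "spans v (nb d) x"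
            using x(1) mk unfolding I(4) marked_def by blast
          then show "x \<in> ?B \<sigma>' 3 \<and> par x \<in> ?B \<sigma>' 2"
          proof cases
            case old
            note D = tree.spansD[OF old(2)]
            have nvs: "\<not> anc v s" using ancS old(1) v by blast
            have sp: "par x \<noteq> s" using vp nvs by auto
            have "anc (par x) x" using D tree.anc_par by blast
            then have "spans s y (par x)" using old(2) D sp tree.anc_trans unfolding tree.spans_def by blast
            then show ?thesis using old sp mk unfolding I(4,5) marked_def by blast
          next
            case new
            note D = tree.spansD[OF new(2)]
            have "anc (par x) x" using D tree.anc_par by blast
            then have "spans v (nb d) (par x)" using new(2) x vp tree.anc_trans unfolding tree.spans_def by blast
            then show ?thesis using new x unfolding I(4,5) by blast
          qed
        qed
        define \<sigma>1 where "\<sigma>1 = \<sigma>'\<lparr>regs := (regs \<sigma>')(rU := u, rP := cr c, rT := 0)\<rparr>"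
        have "WP walk_com (WP (read_next rC rC) I) \<sigma>1 (t' + 52)"
        proof (rule wp_walk)
          show "regs \<sigma>1 rS = N" "length (mem \<sigma>1) = mem_size" "regs \<sigma>1 rV = v" "regs \<sigma>1 rU = u"
            "bits (mem \<sigma>1) 5 = parent_cells" "upward v (bits (mem \<sigma>1) 2) (bits (mem \<sigma>1) 3)"
            using reg' up by (simp_all add: \<sigma>1_def)
          fix \<sigma>2 t2 assume 2: "walk_frame \<sigma>1 \<sigma>2" "bits (mem \<sigma>2) 2 = bits (mem \<sigma>1) 2 \<union> strand v u"
            "bits (mem \<sigma>2) 3 = bits (mem \<sigma>1) 3 \<union> {x \<in> strand v u. par x \<noteq> v}"
            "t2 + cover_potential (bits (mem \<sigma>2) 2) \<le> t' + 52 + cover_potential (bits (mem \<sigma>1) 2) + 26"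
          have "I (\<sigma>2\<lparr>regs := (regs \<sigma>2)(rC := nx c)\<rparr>) (t2 + 4)"
            unfolding I_def
          proof (rule exI[of _ "dn @ [c]"], rule exI[of _ r'], unfold split, intro conjI)
            show "hook_post \<sigma> (\<sigma>2\<lparr>regs := (regs \<sigma>2)(rC := nx c)\<rparr>)"
              using I(3) 2(1) by (auto simp: hook_post_def walk_frame_def \<sigma>1_def)
            show "t2 + 4 + cover_potential (bits (mem (\<sigma>2\<lparr>regs := (regs \<sigma>2)(rC := nx c)\<rparr>)) 2) + 100 * length r' 
              \<le> t + cover_potential (?B \<sigma> 2) + 4 + 100 * length (L v)"
              using 2(4) I(6) r by (simp add: \<sigma>1_def)
          qed (use I 2 r ch in \<open>auto simp: \<sigma>1_def strand\<close>)
          then show "WP (read_next rC rC) I \<sigma>2 t2" 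
            using 2(1) r cv by (simp add: wp_read_next walk_frame_def \<sigma>1_def)
        qed (use u avu v in auto)
        then show ?thesis using r cv u False nt reg' crc
          by (simp add: mark_body_def wp_ctrl wp_read_nb wp_get_bit wp_read_cross u_def[symmetric] \<sigma>1_def add.commute)
      qed
    qed
  qed
  have "I (\<sigma>\<lparr>regs := (regs \<sigma>)(rC := inp ! (2 + v))\<rparr>) (t + 4)"
    unfolding I_def by (rule exI[of _ "[]"], rule exI[of _ "L v"])
      (use chain[OF v(1)] in \<open>simp add: hook_post_def\<close>)
  from loop[OF this] show "WP mark_com Q \<sigma> t"
    using reg v by (simp add: mark_com_def wp_ctrl wp_read_first)
qed

end

section \<open>The report\<close>

definition next_cell_com :: com where
  "next_cell_com = Assign rC (Bin Add (Reg rC) (Const 3))"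

text \<open>One test serves both criteria: the sum is nonzero if the parent is not the root or if a
  child of the root was seen before. Otherwise this is the first child of the root, which is only
  noted in \<open>rR\<close>.\<close>

definition mark_cut_com :: com where
  "mark_cut_com = If (Reg rT) Skip (Seq (ReadInput rU (Reg rC))
     (If (Bin Add (Reg rU) (Reg rR)) (Seq (set_bit_com 4 rU) (Assign rF (Const 1)))
        (Assign rR (Const 1))))"

definition classify_com :: com where
  "classify_com = Seq (read_plus2 rP rC) (Seq (ReadInput rX (Reg rP)) (Seq (get_bit_com 2 rX)
     (Seq (If (Reg rT) Skip (Assign rB (Bin Add (Reg rB) (Const 1)))) (Seq (get_bit_com 3 rX) mark_cut_com))))"

definition classify_body :: com where
  "classify_body = Seq (get_bit_com 5 rC) (Seq (If (Reg rT) classify_com Skip) next_cell_com)"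

definition bridge_com :: com where
  "bridge_com = Seq (read_plus2 rP rC) (Seq (ReadInput rX (Reg rP)) (Seq (get_bit_com 2 rX)
     (If (Reg rT) Skip (Seq (Output (Reg rX)) (Seq (ReadInput rU (Reg rC)) (Output (Reg rU)))))))"

definition bridge_body :: com where
  "bridge_body = Seq (get_bit_com 5 rC) (Seq (If (Reg rT) bridge_com Skip) next_cell_com)"

definition cut_body :: com where
  "cut_body = Seq (get_bit_com 4 rX) (Seq (If (Reg rT) (Output (Reg rX)) Skip)
     (Assign rX (Bin Add (Reg rX) (Const 1))))"

definition cells_loop :: "com \<Rightarrow> com" where
  "cells_loop body = Seq (Assign rC (Bin Add (Reg rN) (Const 2))) (While (Bin Less (Reg rC) (Reg rS)) body)"

definition answers_com :: com where
  "answers_com = Seq (Output (Bin Mul (Bin Less (Const 2) (Reg rN)) (Bin Equal (Reg rF) (Const 0))))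
     (Seq (Output (Bin Mul (Bin Less (Const 1) (Reg rN)) (Bin Equal (Reg rB) (Const 0)))) (Output (Reg rB)))"

text \<open>The answers and the number of bridges precede the list of bridges in a write-only
  output, so the cells are traversed twice: once to classify and count, once to list.\<close>

definition report_com :: com where
  "report_com = Seq (Assign rB (Const 0)) (Seq (Assign rF (Const 0)) (Seq (Assign rR (Const 0))
     (Seq (cells_loop classify_body) (Seq answers_com (Seq (cells_loop bridge_body)
     (Seq (Assign rX (Const 0)) (While (Bin Less (Reg rX) (Reg rN)) cut_body)))))))"

text \<open>\<open>rS\<close> holds the number of edges at first and is then replaced by the length
  of the input block, computed from the two header words.\<close>

definition main_com :: com where
  "main_com = Seq (ReadInput rN (Const 0)) (Seq (ReadInput rS (Const 1))
     (Seq (Assign rS (Bin Add (Bin Mul (Const 6) (Reg rS)) (Bin Add (Reg rN) (Const 2))))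
     (Seq (dfs_com 0 Skip) (Seq (dfs_com 1 mark_com) report_com))))"

lemma update_outp_regs: "\<sigma>\<lparr>outp := a, regs := r\<rparr> = \<sigma>\<lparr>regs := r, outp := a\<rparr>"
  by (cases \<sigma>) simp

section \<open>Tree edges in the order of their cells\<close>

context ram_tree
begin

text \<open>The owner of the cell. It lets the report traverse the cells by address instead of
  following lists, and every tree edge turns up once, at its parent cell.\<close>

definition child :: "nat \<Rightarrow> nat" where
  "child c = nb (cr c)"

definition cells :: "nat \<Rightarrow> nat list" where
  "cells k = map (\<lambda>j. 2 + n + 3 * j) [0..<k]"

lemma cells_Suc: "cells (Suc k) = cells k @ [2 + n + 3 * k]"
  by (simp add: cells_def)

lemma cells_fresh: "2 + n + 3 * k \<notin> set (cells k)"
  by (auto simp: cells_def)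

lemma distinct_cells: "distinct (cells k)"
  by (auto simp: cells_def distinct_map inj_on_def)

lemma child_pc: "x < n \<Longrightarrow> x \<noteq> 0 \<Longrightarrow> child (pc x) = x"
  using pc_cell nb_cross by (simp add: child_def)

lemma nb_pc: "x \<noteq> 0 \<Longrightarrow> nb (pc x) = par x"
  by (simp add: parent_def)

lemma parent_cell_cases:
  assumes "c \<in> parent_cells"
  obtains x where "x < n" "x \<noteq> 0" "c = pc x" "child c = x" "nb c = par x"
  using assms child_pc nb_pc by (auto simp: parent_cells_def)

lemma parent_cells_subset: "parent_cells \<subseteq> set (cells (2 * card E))"
proof
  fix c assume "c \<in> parent_cells"
  then obtain x where "x < n" "x \<noteq> 0" "c = pc x" by (rule parent_cell_cases)
  then have "c \<in> cell_addrs n (card E)" using pc_cell L_addrs by blast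
  then show "c \<in> set (cells (2 * card E))" by (auto simp: cell_addrs_def cells_def)
qed

lemma parent_cells_is_cell: "c \<in> parent_cells \<Longrightarrow> is_cell c \<and> is_cell (cr c) \<and> child c < n \<and> nb c < n"
proof (erule parent_cell_cases)
  fix x assume x: "x < n" "x \<noteq> 0" "c = pc x" "child c = x" "nb c = par x"
  then have "is_cell c" using pc_cell is_cell_L by blast
  then show ?thesis using is_cellD[of c] x by simp
qed

definition low_cells :: "nat \<Rightarrow> nat list" where
  "low_cells k = filter (\<lambda>c. c \<in> parent_cells \<and> child c \<notin> tree.high) (cells k)"

definition bridge_cells :: "nat \<Rightarrow> nat list" where
  "bridge_cells k = filter (\<lambda>c. c \<in> parent_cells \<and> child c \<notin> tree.covered) (cells k)"

text \<open>The cut vertices known from the low cells met so far; the second set is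
  \<open>{0}\<close> or empty and expresses that two children of the root were met.\<close>

definition cuts :: "nat list \<Rightarrow> nat set" where
  "cuts cs = {nb c | c. c \<in> set cs \<and> nb c \<noteq> 0} \<union>
     {0 | c d. c \<in> set cs \<and> d \<in> set cs \<and> c \<noteq> d \<and> nb c = 0 \<and> nb d = 0}"

lemma cuts_append:
  assumes "c \<notin> set cs"
  shows "cuts (cs @ [c]) = (if nb c \<noteq> 0 \<or> (\<exists>d\<in>set cs. nb d = 0) then insert (nb c) (cuts cs) else cuts cs)"
  using assms unfolding cuts_def by (auto 0 4)

text \<open>An edge spanning a child of the root can only end at the root. Hence the restriction to
  low cells loses no child of the root.\<close>

lemma root_child_not_high: "par x = 0 \<Longrightarrow> x \<notin> tree.high"
proof
  assume "par x = 0" "x \<in> tree.high"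
  then obtain t u where sp: "spans t u x" and t: "t \<noteq> 0" by (auto simp: tree.high_def)
  then have "anc t 0" using tree.spansD(8)[OF sp] \<open>par x = 0\<close> by simp
  then show False using t tree.root_anc tree.spansD(3)[OF sp] tree.anc_antisym by blast
qed

lemma cuts_final: "cuts (low_cells (2 * card E)) = cut_vertices {..<n} E"
proof -
  have low: "set (low_cells (2 * card E)) = pc ` {x. x < n \<and> x \<noteq> 0 \<and> x \<notin> tree.high}"
    using parent_cells_subset child_pc by (auto simp: low_cells_def parent_cells_def)
  have "{nb c | c. c \<in> set (low_cells (2 * card E)) \<and> nb c \<noteq> 0} =
    {par x | x. x \<in> {..<n} \<and> x \<noteq> 0 \<and> x \<notin> tree.high \<and> par x \<noteq> 0}"
    (is "?l = ?r")
  proof (intro equalityI subsetI)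
    fix v assume "v \<in> ?l"
    then obtain x where "x < n" "x \<noteq> 0" "x \<notin> tree.high" "nb (pc x) \<noteq> 0" "v = nb (pc x)"
      unfolding low by blast
    then have "par x \<noteq> 0" "v = par x" using nb_pc by auto
    then show "v \<in> ?r" using \<open>x < n\<close> \<open>x \<noteq> 0\<close> \<open>x \<notin> tree.high\<close> by blast
  next
    fix v assume "v \<in> ?r"
    then obtain x where x: "x < n" "x \<noteq> 0" "x \<notin> tree.high" "par x \<noteq> 0" "v = par x" by blast
    then have "v = nb (pc x)" "nb (pc x) \<noteq> 0" "pc x \<in> set (low_cells (2 * card E))"
      using nb_pc unfolding low by auto
    then show "v \<in> ?l" by blast
  qed
  moreover have "{0 :: nat | c d. c \<in> set (low_cells (2 * card E)) \<and> d \<in> set (low_cells (2 * card E)) \<and> c \<noteq> d \<and> nb c = 0 \<and> nb d = 0}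
    = {0 | x y. x \<in> {..<n} \<and> x \<noteq> 0 \<and> y \<in> {..<n} \<and> y \<noteq> 0 \<and> x \<noteq> y \<and> par x = 0 \<and> par y = (0::nat)}"
  proof -
    have "(\<exists>c d. c \<in> set (low_cells (2 * card E)) \<and> d \<in> set (low_cells (2 * card E)) \<and> c \<noteq> d \<and> nb c = 0 \<and> nb d = 0)
      \<longleftrightarrow> (\<exists>x y. x \<in> {..<n} \<and> x \<noteq> 0 \<and> y \<in> {..<n} \<and> y \<noteq> 0 \<and> x \<noteq> y \<and> par x = 0 \<and> par y = (0::nat))"
      unfolding low
    proof (intro iffI; elim exE conjE imageE)
      fix x y assume xy: "x \<in> {..<n}" "x \<noteq> 0" "y \<in> {..<n}" "y \<noteq> 0" "x \<noteq> y" "par x = 0" "par y = (0::nat)"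
      then have "pc x \<noteq> pc y" using child_pc by (metis lessThan_iff)
      then show "\<exists>c d. c \<in> pc ` {x. x < n \<and> x \<noteq> 0 \<and> x \<notin> tree.high} \<and>
        d \<in> pc ` {x. x < n \<and> x \<noteq> 0 \<and> x \<notin> tree.high} \<and> c \<noteq> d \<and> nb c = 0 \<and> nb d = 0"
        using xy root_child_not_high nb_pc by (intro exI[of _ "pc x"] exI[of _ "pc y"]) auto
    next
      fix c d x y assume "c \<noteq> d" "nb c = 0" "nb d = 0" "c = pc x" "d = pc y"
        "x \<in> {x. x < n \<and> x \<noteq> 0 \<and> x \<notin> tree.high}" "y \<in> {x. x < n \<and> x \<noteq> 0 \<and> x \<notin> tree.high}"
      then show "\<exists>x y. x \<in> {..<n} \<and> x \<noteq> 0 \<and> y \<in> {..<n} \<and> y \<noteq> 0 \<and> x \<noteq> y \<and> par x = 0 \<and> par y = (0::nat)"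
        using nb_pc by (intro exI[of _ x] exI[of _ y]) auto
    qed
    then show ?thesis by blast
  qed
  ultimately show ?thesis unfolding cuts_def tree.cut_vertices_eq by (simp only:)
qed

abbreviation bridge_pairs :: "nat \<Rightarrow> (nat \<times> nat) list" where
  "bridge_pairs k \<equiv> map (\<lambda>c. (child c, nb c)) (bridge_cells k)"

lemma bridges_final:
  "set (map (\<lambda>(u, v). {u, v}) (bridge_pairs (2 * card E))) = bridges {..<n} E"
  "distinct (map (\<lambda>(u, v). {u, v}) (bridge_pairs (2 * card E)))"
proof -
  have st: "set (bridge_cells (2 * card E)) = pc ` {x. x < n \<and> x \<noteq> 0 \<and> x \<notin> tree.covered}"
    using parent_cells_subset child_pc by (auto simp: bridge_cells_def parent_cells_def)
  show "set (map (\<lambda>(u, v). {u, v}) (bridge_pairs (2 * card E))) = bridges {..<n} E"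
  proof -
    have "set (map (\<lambda>(u, v). {u, v}) (bridge_pairs (2 * card E))) =
      (\<lambda>x. {child (pc x), nb (pc x)}) ` {x. x < n \<and> x \<noteq> 0 \<and> x \<notin> tree.covered}"
      by (simp add: st image_image)
    also have "\<dots> = (\<lambda>x. {x, par x}) ` ({..<n} - {0} - tree.covered)"
      by (rule image_cong) (use child_pc nb_pc in auto)
    finally show ?thesis by (simp only: tree.bridges_eq)
  qed
  have "inj_on (\<lambda>c. {child c, nb c}) (set (bridge_cells (2 * card E)))"
    unfolding st
  proof (rule inj_onI, elim imageE, clarify)
    fix x y assume xy: "x < n" "0 < x" "y < n" "0 < y" "{child (pc x), nb (pc x)} = {child (pc y), nb (pc y)}"
    then have "{x, par x} = {y, par y}" using child_pc nb_pc by simp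
    then show "pc x = pc y" using tree.tree_edge_eq_iff[of x y] xy by simp
  qed
  moreover have "distinct (bridge_cells (2 * card E))"
    using distinct_cells by (simp add: bridge_cells_def)
  ultimately show "distinct (map (\<lambda>(u, v). {u, v}) (bridge_pairs (2 * card E)))"
    by (simp add: distinct_map comp_def split_def)
qed

section \<open>Loops over the cells and over the vertices\<close>

lemma less_val: "exp_val w r (Bin Less (Reg i) (Reg j)) \<noteq> 0 \<longleftrightarrow> r i < r j"
  by (simp add: of_bool_mod)

lemma wp_next_cell_com:
  "regs \<sigma> rC < N \<Longrightarrow> WP next_cell_com Q \<sigma> t \<longleftrightarrow> Q (\<sigma>\<lparr>regs := (regs \<sigma>)(rC := regs \<sigma> rC + 3)\<rparr>) (t + 4)"
  using N_ge by (simp add: next_cell_com_def wp_ctrl small_mod)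

text \<open>Each of the \<open>2 * card E\<close> cells costs at most 150 steps for the body and 4
  for the loop test, which gives 308 per edge; the 8 is the initial assignment plus the last
  test.\<close>

lemma wp_cells_loop:
  assumes init: "regs \<sigma> rS = N" "regs \<sigma> rN = n" "J 0 (\<sigma>\<lparr>regs := (regs \<sigma>)(rC := 2 + n)\<rparr>)"
    and body: "\<And>k \<sigma> t Q. k < 2 * card E \<Longrightarrow> regs \<sigma> rS = N \<Longrightarrow> regs \<sigma> rN = n \<Longrightarrow> regs \<sigma> rC = 2 + n + 3 * k \<Longrightarrow> J k \<sigma> \<Longrightarrow>
      (\<And>\<sigma>' t'. regs \<sigma>' rS = N \<Longrightarrow> regs \<sigma>' rN = n \<Longrightarrow> regs \<sigma>' rC = 2 + n + 3 * Suc k \<Longrightarrow> J (Suc k) \<sigma>' \<Longrightarrow> 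
        t' \<le> t + 150 \<Longrightarrow> Q \<sigma>' t') \<Longrightarrow> WP body Q \<sigma> t"
    and Q: "\<And>\<sigma>' t'. regs \<sigma>' rS = N \<Longrightarrow> regs \<sigma>' rN = n \<Longrightarrow> J (2 * card E) \<sigma>' \<Longrightarrow> t' \<le> t + 8 + 308 * card E \<Longrightarrow> Q \<sigma>' t'"
  shows "WP (cells_loop body) Q \<sigma> t"
proof -
  define I where "I \<sigma>' t' \<longleftrightarrow> (\<exists>k\<le>2 * card E. regs \<sigma>' rS = N \<and> regs \<sigma>' rN = n \<and> regs \<sigma>' rC = 2 + n + 3 * k \<and>
     J k \<sigma>' \<and> t' + 154 * (2 * card E - k) \<le> t + 4 + 308 * card E)" for \<sigma>' t'
  have loop: "WP (While (Bin Less (Reg rC) (Reg rS)) body) Q \<sigma>' t'" if "I \<sigma>' t'" for \<sigma>' t'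
    using that
  proof (rule wp_While[where T = "t + 4 + 308 * card E"])
    fix \<sigma>' t' assume "I \<sigma>' t'"
    then obtain k where I: "k \<le> 2 * card E" "regs \<sigma>' rS = N" "regs \<sigma>' rN = n" "regs \<sigma>' rC = 2 + n + 3 * k"
      "J k \<sigma>'" "t' + 154 * (2 * card E - k) \<le> t + 4 + 308 * card E" unfolding I_def by blast
    then show "t' \<le> t + 4 + 308 * card E" by simp
    show "Q \<sigma>' (t' + (1 + exp_cost (Bin Less (Reg rC) (Reg rS))))"
      if "exp_val w (regs \<sigma>') (Bin Less (Reg rC) (Reg rS)) = 0"
    proof -
      have "\<not> regs \<sigma>' rC < regs \<sigma>' rS" using that less_val by metis
      then have "k = 2 * card E" using I length_inp by simp
      then show ?thesis using I Q by simp
    qed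
    assume "exp_val w (regs \<sigma>') (Bin Less (Reg rC) (Reg rS)) \<noteq> 0"
    then have "regs \<sigma>' rC < regs \<sigma>' rS" using less_val by metis
    then have k: "k < 2 * card E" using I length_inp by simp
    show "WP body I \<sigma>' (t' + (1 + exp_cost (Bin Less (Reg rC) (Reg rS))))"
      by (rule body[OF k I(2-5)], unfold I_def, rule exI[of _ "Suc k"]) (use I(6) k in auto)
  qed
  have "I (\<sigma>\<lparr>regs := (regs \<sigma>)(rC := 2 + n)\<rparr>) (t + 4)"
    unfolding I_def by (rule exI[of _ 0]) (use init in auto)
  from loop[OF this] show ?thesis
    using init N_ge n_lt_N by (simp add: cells_loop_def wp_ctrl small_mod add.commute)
qed

definition classified :: "nat \<Rightarrow> state \<Rightarrow> bool" where
  "classified k \<sigma> \<longleftrightarrow> length (mem \<sigma>) = mem_size \<and> outp \<sigma> = [] \<and>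
     bits (mem \<sigma>) 2 = tree.covered \<and> bits (mem \<sigma>) 3 = tree.high \<and> bits (mem \<sigma>) 5 = parent_cells \<and>
     regs \<sigma> rB = length (bridge_cells k) \<and> bits (mem \<sigma>) 4 = cuts (low_cells k) \<and>
     regs \<sigma> rF = of_bool (cuts (low_cells k) \<noteq> {}) \<and>
     regs \<sigma> rR = of_bool (\<exists>c\<in>set (low_cells k). nb c = 0)"

lemma wp_classify_body:
  assumes k: "k < 2 * card E" and reg: "regs \<sigma> rS = N" "regs \<sigma> rN = n" "regs \<sigma> rC = 2 + n + 3 * k"
    and J: "classified k \<sigma>"
    and Q: "\<And>\<sigma>' t'. regs \<sigma>' rS = N \<Longrightarrow> regs \<sigma>' rN = n \<Longrightarrow> regs \<sigma>' rC = 2 + n + 3 * Suc k \<Longrightarrow> 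
        classified (Suc k) \<sigma>' \<Longrightarrow> t' \<le> t + 150 \<Longrightarrow> Q \<sigma>' t'"
  shows "WP classify_body Q \<sigma> t"
proof -
  define c where "c = 2 + n + 3 * k"
  have cN: "c < N" "2 + n + 3 * Suc k = c + 3" using k length_inp by (auto simp: c_def)
  have fresh: "c \<notin> set (low_cells k)" using cells_fresh by (auto simp: low_cells_def c_def)
  have Suc: "low_cells (Suc k) = low_cells k @ (if c \<in> parent_cells \<and> child c \<notin> tree.high then [c] else [])"
    "bridge_cells (Suc k) = bridge_cells k @ (if c \<in> parent_cells \<and> child c \<notin> tree.covered then [c] else [])"
    by (simp_all add: low_cells_def bridge_cells_def cells_Suc c_def)
  have C: "regs \<sigma> rC = c" using reg by (simp add: c_def)
  note Jd = J[unfolded classified_def]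
  show ?thesis
  proof (cases "c \<in> parent_cells")
    case False
    have "Q (\<sigma>\<lparr>regs := (regs \<sigma>)(rT := 0, rC := c + 3)\<rparr>) (t + 27)"
      by (rule Q) (use J reg False cN in \<open>auto simp: classified_def Suc\<close>)
    then show ?thesis using reg C Jd False cN
      by (simp add: classify_body_def wp_ctrl wp_get_bit wp_next_cell_com add.commute)
  next
    case True
    note cell = parent_cells_is_cell[OF True]
    have lt: "child c < N" "nb c < N" using cell n_lt_N by auto
    \<comment> \<open>At most one bridge per cell, so the counter stays below \<open>N\<close> and
      does not wrap around.\<close>
    have "length (bridge_cells k) \<le> length (cells k)" by (simp add: bridge_cells_def)
    then have B: "regs \<sigma> rB + 1 < N" using Jd k length_inp n_pos by (simp add: cells_def)
    define b where "b = length (bridge_cells (Suc k))"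
    define \<sigma>1 where "\<sigma>1 = \<sigma>\<lparr>regs := (regs \<sigma>)(rP := cr c, rX := child c, rB := b, rT := of_bool (child c \<in> tree.high))\<rparr>"
    have J1: "regs \<sigma>1 rS = N" "regs \<sigma>1 rN = n" "regs \<sigma>1 rC = c" "regs \<sigma>1 rB = b" "length (mem \<sigma>1) = mem_size" "outp \<sigma>1 = []"
      "bits (mem \<sigma>1) 2 = tree.covered" "bits (mem \<sigma>1) 3 = tree.high" "bits (mem \<sigma>1) 5 = parent_cells"
      "bits (mem \<sigma>1) 4 = cuts (low_cells k)" "regs \<sigma>1 rF = of_bool (cuts (low_cells k) \<noteq> {})"
      "regs \<sigma>1 rR = of_bool (\<exists>c\<in>set (low_cells k). nb c = 0)" "regs \<sigma>1 rT = of_bool (child c \<in> tree.high)"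
      using reg C Jd by (simp_all add: \<sigma>1_def)
    have step: "WP mark_cut_com (WP next_cell_com Q) \<sigma>1 t2" if t2: "t2 \<le> t + 100" for t2
    proof (cases "child c \<in> tree.high")
      case high: True
      have "Q (\<sigma>1\<lparr>regs := (regs \<sigma>1)(rC := c + 3)\<rparr>) (t2 + 7)"
        by (rule Q) (use J1 high cN t2 in \<open>auto simp: classified_def Suc b_def\<close>)
      then show ?thesis using J1 high cN
        by (simp add: mark_cut_com_def wp_ctrl wp_next_cell_com add.commute)
    next
      case False
      have low: "low_cells (Suc k) = low_cells k @ [c]" using Suc True False by simp
      have ca: "cuts (low_cells (Suc k)) = (if nb c \<noteq> 0 \<or> (\<exists>d\<in>set (low_cells k). nb d = 0) 
          then insert (nb c) (cuts (low_cells k)) else cuts (low_cells k))"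
        unfolding low by (rule cuts_append[OF fresh])
      have sm: "(nb c + regs \<sigma>1 rR) mod 2 ^ w = nb c + regs \<sigma>1 rR"
        using lt J1 N_ge by (intro small_mod) (auto split: split_of_bool)
      show ?thesis
      proof (cases "nb c \<noteq> 0 \<or> (\<exists>d\<in>set (low_cells k). nb d = 0)")
        case cut: True
        define \<sigma>2 where "\<sigma>2 = \<sigma>1\<lparr>regs := (regs \<sigma>1)(rU := nb c, rJ := mem \<sigma>1 ! ((4 * N + nb c) div w), rF := 1, rC := c + 3),
          mem := set_bit_mem (mem \<sigma>1) 4 (nb c)\<rparr>"
        have "Q \<sigma>2 (t2 + 41)"
        proof (rule Q)
          have "(\<exists>d\<in>set (low_cells (Suc k)). nb d = 0) \<longleftrightarrow> (\<exists>d\<in>set (low_cells k). nb d = 0)"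
            unfolding low using cut by auto
          then show "classified (Suc k) \<sigma>2"
            using J1 lt ca cut by (simp add: classified_def \<sigma>2_def bits_set_bit_mem b_def)
        qed (use J1 cN t2 in \<open>auto simp: \<sigma>2_def\<close>)
        moreover have "nb c + regs \<sigma>1 rR \<noteq> 0" using cut J1 by auto
        ultimately show ?thesis using J1 False cell lt cN sm w_ge
          by (simp add: mark_cut_com_def wp_ctrl wp_read_nb wp_set_bit wp_next_cell_com \<sigma>2_def update_mem_regs add.commute del: add_is_0)
      next
        case cut: False
        have ca': "cuts (low_cells (Suc k)) = cuts (low_cells k)" unfolding ca using cut by auto
        have "\<exists>d\<in>set (low_cells (Suc k)). nb d = 0" unfolding low using cut by auto
        note ca' = ca' this
        define \<sigma>2 where "\<sigma>2 = \<sigma>1\<lparr>regs := (regs \<sigma>1)(rU := 0, rR := 1, rC := c + 3)\<rparr>"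
        have "Q \<sigma>2 (t2 + 14)"
        proof (rule Q)
          show "classified (Suc k) \<sigma>2"
            using J1 ca' by (simp add: classified_def \<sigma>2_def b_def)
        qed (use J1 cN t2 in \<open>auto simp: \<sigma>2_def\<close>)
        then show ?thesis using J1 False cell lt cN cut w_ge
          by (simp add: mark_cut_com_def wp_ctrl wp_read_nb wp_next_cell_com \<sigma>2_def add.commute)
      qed
    qed
    show ?thesis
    proof (cases "child c \<in> tree.covered")
      case cov: True
      then have b: "regs \<sigma> rB = b" using Jd Suc by (simp add: b_def)
      show ?thesis using step[of "t + 71"] reg C Jd True cN lt cell cov b
        by (simp add: classify_body_def classify_com_def wp_ctrl wp_get_bit wp_read_nb wp_read_cross 
            child_def[symmetric] \<sigma>1_def add.commute fun_upd_idem)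
    next
      case cov: False
      then have b: "regs \<sigma> rB + 1 = b" using Jd Suc True by (simp add: b_def)
      show ?thesis using step[of "t + 74"] reg C Jd True cN lt cell cov b B w_ge
        by (simp add: classify_body_def classify_com_def wp_ctrl wp_get_bit wp_read_nb wp_read_cross 
            child_def[symmetric] \<sigma>1_def add.commute small_mod)
    qed
  qed
qed

definition listed :: "nat list \<Rightarrow> nat \<Rightarrow> state \<Rightarrow> bool" where
  "listed out k \<sigma> \<longleftrightarrow> length (mem \<sigma>) = mem_size \<and> 
     bits (mem \<sigma>) 2 = tree.covered \<and> bits (mem \<sigma>) 5 = parent_cells \<and> 
     bits (mem \<sigma>) 4 = cut_vertices {..<n} E \<and>
     outp \<sigma> = out @ concat (map (\<lambda>(u, v). [u, v]) (bridge_pairs k))"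

lemma wp_bridge_body:
  assumes k: "k < 2 * card E" and reg: "regs \<sigma> rS = N" "regs \<sigma> rN = n" "regs \<sigma> rC = 2 + n + 3 * k"
    and J: "listed out k \<sigma>"
    and Q: "\<And>\<sigma>' t'. regs \<sigma>' rS = N \<Longrightarrow> regs \<sigma>' rN = n \<Longrightarrow> regs \<sigma>' rC = 2 + n + 3 * Suc k \<Longrightarrow> 
        listed out (Suc k) \<sigma>' \<Longrightarrow> t' \<le> t + 150 \<Longrightarrow> Q \<sigma>' t'"
  shows "WP bridge_body Q \<sigma> t"
proof -
  define c where "c = 2 + n + 3 * k"
  have cN: "c < N" "2 + n + 3 * Suc k = c + 3" using k length_inp by (auto simp: c_def)
  have Suc: "bridge_cells (Suc k) = bridge_cells k @ (if c \<in> parent_cells \<and> child c \<notin> tree.covered then [c] else [])"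
    by (simp add: bridge_cells_def cells_Suc c_def)
  have C: "regs \<sigma> rC = c" using reg by (simp add: c_def)
  note Jd = J[unfolded listed_def]
  show ?thesis
  proof (cases "c \<in> parent_cells")
    case False
    have "Q (\<sigma>\<lparr>regs := (regs \<sigma>)(rT := 0, rC := c + 3)\<rparr>) (t + 27)"
      by (rule Q) (use Jd reg False cN in \<open>auto simp: listed_def Suc\<close>)
    then show ?thesis using reg C Jd False cN
      by (simp add: bridge_body_def wp_ctrl wp_get_bit wp_next_cell_com add.commute)
  next
    case True
    note cell = parent_cells_is_cell[OF True]
    have lt: "child c < N" "nb c < N" using cell n_lt_N by auto
    show ?thesis
    proof (cases "child c \<in> tree.covered")
      case cov: True
      have "Q (\<sigma>\<lparr>regs := (regs \<sigma>)(rP := cr c, rX := child c, rT := 1, rC := c + 3)\<rparr>) (t + 55)"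
        by (rule Q) (use Jd reg cov cN in \<open>auto simp: listed_def Suc\<close>)
      then show ?thesis using reg C Jd True cN lt cell cov
        by (simp add: bridge_body_def bridge_com_def wp_ctrl wp_get_bit wp_read_nb wp_read_cross 
            wp_next_cell_com child_def[symmetric] add.commute)
    next
      case cov: False
      have "Q (\<sigma>\<lparr>regs := (regs \<sigma>)(rP := cr c, rX := child c, rT := 0, rU := nb c, rC := c + 3), 
         outp := outp \<sigma> @ [child c, nb c]\<rparr>) (t + 60)"
        by (rule Q) (use Jd reg cov True cN in \<open>auto simp: listed_def Suc\<close>)
      then show ?thesis using reg C Jd True cN lt cell cov
        by (simp add: bridge_body_def bridge_com_def wp_ctrl wp_get_bit wp_read_nb wp_read_cross 
            wp_next_cell_com child_def[symmetric] update_outp_regs add.commute)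
    qed
  qed
qed

lemma wp_cut_loop:
  fixes \<sigma> :: state
  assumes reg: "regs \<sigma> rS = N" "regs \<sigma> rN = n" "regs \<sigma> rX = 0" "length (mem \<sigma>) = mem_size"
    and Q: "\<And>\<sigma>' t'. outp \<sigma>' = outp \<sigma> @ filter (\<lambda>v. v \<in> bits (mem \<sigma>) 4) [0..<n] \<Longrightarrow> t' \<le> t + 4 + 40 * n \<Longrightarrow> Q \<sigma>' t'"
  shows "WP (While (Bin Less (Reg rX) (Reg rN)) cut_body) Q \<sigma> t"
proof -
  define I where "I \<sigma>' t' \<longleftrightarrow> (\<exists>k\<le>n. regs \<sigma>' rS = N \<and> regs \<sigma>' rN = n \<and> regs \<sigma>' rX = k \<and> mem \<sigma>' = mem \<sigma> \<and>
     outp \<sigma>' = outp \<sigma> @ filter (\<lambda>v. v \<in> bits (mem \<sigma>) 4) [0..<k] \<and> t' + 40 * (n - k) \<le> t + 40 * n)" for \<sigma>' :: state and t'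
  have "I \<sigma> t" unfolding I_def by (rule exI[of _ 0]) (use reg in auto)
  then show ?thesis
  proof (rule wp_While[where T = "t + 40 * n"])
    fix \<sigma>' t' assume "I \<sigma>' t'"
    then obtain k where I: "k \<le> n" "regs \<sigma>' rS = N" "regs \<sigma>' rN = n" "regs \<sigma>' rX = k" "mem \<sigma>' = mem \<sigma>"
     "outp \<sigma>' = outp \<sigma> @ filter (\<lambda>v. v \<in> bits (mem \<sigma>) 4) [0..<k]" "t' + 40 * (n - k) \<le> t + 40 * n"
      unfolding I_def by blast
    then show "t' \<le> t + 40 * n" by simp
    show "Q \<sigma>' (t' + (1 + exp_cost (Bin Less (Reg rX) (Reg rN))))"
      if "exp_val w (regs \<sigma>') (Bin Less (Reg rX) (Reg rN)) = 0"
    proof -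
      have "\<not> regs \<sigma>' rX < regs \<sigma>' rN" using that less_val by metis
      then have "k = n" using I by simp
      then show ?thesis using I Q by simp
    qed
    assume "exp_val w (regs \<sigma>') (Bin Less (Reg rX) (Reg rN)) \<noteq> 0"
    then have "regs \<sigma>' rX < regs \<sigma>' rN" using less_val by metis
    then have k: "k < n" "k < N" using I n_lt_N by auto
    have "I (\<sigma>'\<lparr>regs := (regs \<sigma>')(rT := 1, rX := k + 1), outp := outp \<sigma>' @ [k]\<rparr>) (t' + 32)"
      if "k \<in> bits (mem \<sigma>) 4"
      unfolding I_def by (rule exI[of _ "Suc k"]) (use I k that in auto)
    moreover have "I (\<sigma>'\<lparr>regs := (regs \<sigma>')(rT := 0, rX := k + 1)\<rparr>) (t' + 31)"
      if "k \<notin> bits (mem \<sigma>) 4"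
      unfolding I_def by (rule exI[of _ "Suc k"]) (use I k that in auto)
    moreover have "(k + 1) mod 2 ^ w = k + 1" using k by (intro small_mod) simp
    ultimately show "WP cut_body I \<sigma>' (t' + (1 + exp_cost (Bin Less (Reg rX) (Reg rN))))"
      using I k reg w_ge by (cases "k \<in> bits (mem \<sigma>) 4") (simp_all add: cut_body_def wp_ctrl wp_get_bit update_outp_regs add.commute)
  qed
qed

lemma wp_report:
  fixes \<sigma> :: state and Q :: "state \<Rightarrow> nat \<Rightarrow> bool"
  assumes reg: "regs \<sigma> rS = N" "regs \<sigma> rN = n" "length (mem \<sigma>) = mem_size" "outp \<sigma> = []"
    and B: "bits (mem \<sigma>) 2 = tree.covered" "bits (mem \<sigma>) 3 = tree.high" "bits (mem \<sigma>) 4 = {}" "bits (mem \<sigma>) 5 = parent_cells"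
    and Q: "\<And>\<sigma>' t'. connectivity_report {..<n} E (outp \<sigma>') \<Longrightarrow> t' \<le> t + 60 + 40 * n + 616 * card E \<Longrightarrow> Q \<sigma>' t'"
  shows "WP report_com Q \<sigma> t"
proof -
  let ?m = "2 * card E"
  let ?out = "[of_bool (two_vertex_connected {..<n} E), of_bool (two_edge_connected {..<n} E), length (bridge_cells ?m)]"
  let ?rest = "Seq (cells_loop bridge_body) (Seq (Assign rX (Const 0)) (While (Bin Less (Reg rX) (Reg rN)) cut_body))"
  have rest: "WP ?rest Q \<sigma>1 t1" if "regs \<sigma>1 rS = N" "regs \<sigma>1 rN = n" "listed ?out 0 \<sigma>1" "t1 \<le> t + 44 + 308 * card E" for \<sigma>1 t1
    unfolding wp_Seq
  proof (rule wp_cells_loop[where J = "listed ?out"])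
    fix \<sigma>2 t2 assume 2: "regs \<sigma>2 rS = N" "regs \<sigma>2 rN = n" "listed ?out ?m \<sigma>2" "t2 \<le> t1 + 8 + 308 * card E"
    have "WP (While (Bin Less (Reg rX) (Reg rN)) cut_body) Q (\<sigma>2\<lparr>regs := (regs \<sigma>2)(rX := 0)\<rparr>) (t2 + 2)"
    proof (rule wp_cut_loop)
      fix \<sigma>' :: state and t' assume out: "outp \<sigma>' = outp (\<sigma>2\<lparr>regs := (regs \<sigma>2)(rX := 0)\<rparr>) @ 
          filter (\<lambda>v. v \<in> bits (mem (\<sigma>2\<lparr>regs := (regs \<sigma>2)(rX := 0)\<rparr>)) 4) [0..<n]" and t': "t' \<le> t2 + 2 + 4 + 40 * n"
      show "Q \<sigma>' t'"
      proof (rule Q)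
        have "outp \<sigma>' = ?out @ concat (map (\<lambda>(u, v). [u, v]) (bridge_pairs ?m)) @ filter (\<lambda>v. v \<in> cut_vertices {..<n} E) [0..<n]"
          using out 2(3) by (simp add: listed_def)
        moreover have "cut_vertices {..<n} E \<subseteq> {..<n}" by (auto simp: cut_vertices_def)
        ultimately show "connectivity_report {..<n} E (outp \<sigma>')"
          unfolding connectivity_report_def using bridges_final
          by (intro exI[of _ "bridge_pairs ?m"] exI[of _ "filter (\<lambda>v. v \<in> cut_vertices {..<n} E) [0..<n]"]) auto
        show "t' \<le> t + 60 + 40 * n + 616 * card E" using t' 2(4) that(4) by simp
      qed
    qed (use 2 in \<open>auto simp: listed_def\<close>)
    then show "WP (Assign rX (Const 0)) (WP (While (Bin Less (Reg rX) (Reg rN)) cut_body) Q) \<sigma>2 t2"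
      by (simp add: wp_ctrl)
  next
    show "listed ?out 0 (\<sigma>1\<lparr>regs := (regs \<sigma>1)(rC := 2 + n)\<rparr>)" using that by (simp add: listed_def)
  qed (use that in \<open>auto intro: wp_bridge_body\<close>)
  have mid: "WP (Seq answers_com ?rest) Q \<sigma>1 t1" if 1: "regs \<sigma>1 rS = N" "regs \<sigma>1 rN = n" "classified ?m \<sigma>1" "t1 \<le> t + 14 + 308 * card E" for \<sigma>1 t1
  proof -
    note J = 1(3)[unfolded classified_def cuts_final]
    have bc: "bridge_cells ?m = [] \<longleftrightarrow> bridges {..<n} E = {}"
      using bridges_final(1) by auto
    \<comment> \<open>The input graph is connected, so only the number of vertices and the emptiness
      of the two sets remain to be tested.\<close>
    have two: "two_vertex_connected {..<n} E \<longleftrightarrow> 2 < n \<and> cut_vertices {..<n} E = {}"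
      "two_edge_connected {..<n} E \<longleftrightarrow> 1 < n \<and> bridges {..<n} E = {}"
      using connected by (auto simp: two_vertex_connected_def two_edge_connected_def)
    have v: "exp_val w (regs \<sigma>1) (Bin Mul (Bin Less (Const 2) (Reg rN)) (Bin Equal (Reg rF) (Const 0))) = of_bool (two_vertex_connected {..<n} E)"
      "exp_val w (regs \<sigma>1) (Bin Mul (Bin Less (Const 1) (Reg rN)) (Bin Equal (Reg rB) (Const 0))) = of_bool (two_edge_connected {..<n} E)"
      "exp_val w (regs \<sigma>1) (Reg rB) = length (bridge_cells ?m)"
      unfolding two using J 1 bc w_ge N_ge by (simp_all add: small_mod one_mod)
    have "WP ?rest Q (\<sigma>1\<lparr>outp := ?out\<rparr>) (t1 + 18)"
      by (rule rest) (use J 1 in \<open>auto simp: listed_def bridge_cells_def cells_def\<close>)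
    then show ?thesis using J v by (simp add: answers_com_def wp_ctrl add.commute del: exp_val.simps split del: split_of_bool)
  qed
  have "WP (cells_loop classify_body) (WP (Seq answers_com ?rest) Q) (\<sigma>\<lparr>regs := (regs \<sigma>)(rB := 0, rF := 0, rR := 0)\<rparr>) (t + 6)"
  proof (rule wp_cells_loop[where J = classified])
    show "classified 0 (\<sigma>\<lparr>regs := (regs \<sigma>)(rB := 0, rF := 0, rR := 0)\<rparr>\<lparr>regs := 
       (regs (\<sigma>\<lparr>regs := (regs \<sigma>)(rB := 0, rF := 0, rR := 0)\<rparr>))(rC := 2 + n)\<rparr>)"
      using reg B by (simp add: classified_def low_cells_def bridge_cells_def cells_def cuts_def)
  qed (use reg in \<open>auto intro: wp_classify_body mid\<close>)
  then show ?thesis by (simp add: report_com_def wp_ctrl add.commute)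
qed

end

section \<open>The two searches and the report together\<close>

context ram
begin

lemma skip_spec: "hook_spec 0 {} (\<lambda>_ B H. B = {} \<and> H = {}) (\<lambda>_. 0) Skip"
  unfolding hook_spec_def
  by (intro allI impI) (auto simp: wp_ctrl hook_post_def)

text \<open>The costs are 12 for the header, twice \<open>400 * n + 600 * card E\<close> for the
  searches, \<open>150 * n + 300 * card E\<close> for the walks and
  \<open>60 + 40 * n + 616 * card E\<close> for the report; as \<open>0 < n\<close>, the constants
  are absorbed.\<close>

lemma wp_main:
  assumes Q: "\<And>\<sigma> t. connectivity_report {..<n} E (outp \<sigma>) \<Longrightarrow> t \<le> 3000 * (n + card E) \<Longrightarrow> Q \<sigma> t"
  shows "WP main_com Q (initial_state mem_size) 0"
proof -
  define \<sigma>0 where "\<sigma>0 = (initial_state mem_size)\<lparr>regs := (\<lambda>_. 0)(rN := n, rS := N)\<rparr>"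
  have m0: "bits (mem \<sigma>0) f = {}" if "f < 6" for f
    using that bits_initial by (simp add: \<sigma>0_def initial_state_def)
  have "WP (dfs_com 0 Skip) (WP (Seq (dfs_com 1 mark_com) report_com) Q) \<sigma>0 12"
  proof (rule wp_dfs[OF _ _ skip_spec])
    show "regs \<sigma>0 rS = N" "length (mem \<sigma>0) = mem_size" by (simp_all add: \<sigma>0_def initial_state_def)
    fix \<sigma>1 t1 pc assume fr1: "frame 0 \<sigma>0 \<sigma>1" and final: "reached ({..<n}, pc, [(0, [])])"
      and B5: "bits (mem \<sigma>1) 5 = {} \<union> pc ` ({..<n} - {0})"
      and B23: "bits (mem \<sigma>1) 2 = {} \<and> bits (mem \<sigma>1) 3 = {}"
      and t1: "t1 + 0 \<le> 12 + 0 + 400 * n + 600 * card E"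
    obtain dep where "dfs_tree {..<n} E 0 (parent pc) dep" using final_tree[OF final] by blast
    then interpret ram_tree n E inp L w pc dep
      by (intro ram_tree.intro ram_axioms ram_tree_axioms.intro final)
    have 1: "regs \<sigma>1 rS = N" "regs \<sigma>1 rN = n" "length (mem \<sigma>1) = mem_size" "outp \<sigma>1 = []" 
      "bits (mem \<sigma>1) 1 = {}" "bits (mem \<sigma>1) 4 = {}" "bits (mem \<sigma>1) 5 = parent_cells"
      using fr1 m0 B5 by (simp_all add: frame_def \<sigma>0_def initial_state_def parent_cells_def)
    show "WP (Seq (dfs_com 1 mark_com) report_com) Q \<sigma>1 t1"
      unfolding wp_Seq
    proof (rule wp_dfs[OF _ _ mark_spec])
      \<comment> \<open>The only mark in the list of \<open>x\<close> is the parent cell from the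
        first search, and by determinism the second search chooses the same cell.\<close>
      fix S pc' st x z assume a: "reached (S, pc', st)" "x \<in> S" "x \<noteq> 0" "z \<in> parent_cells" "z \<in> set (L x)"
      then have "x < n" using reached_inv[OF a(1)] by auto
      then have "z = pc x" using parent_cells_list a by blast
      then show "z = pc' x" using final_reached[OF final a(1)] a(2) by simp
    next
      show "marked {} (bits (mem \<sigma>1) 2) (bits (mem \<sigma>1) 3)" using B23 by (simp add: marked_def)
    next
      fix \<sigma>2 t2 pc' assume fr2: "frame 1 \<sigma>1 \<sigma>2" and final': "reached ({..<n}, pc', [(0, [])])"
        and B5': "bits (mem \<sigma>2) 5 = parent_cells \<union> pc' ` ({..<n} - {0})"
        and mk: "marked {..<n} (bits (mem \<sigma>2) 2) (bits (mem \<sigma>2) 3)"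
        and t2: "t2 + cover_potential (bits (mem \<sigma>2) 2) \<le> t1 + cover_potential (bits (mem \<sigma>1) 2) + 400 * n + 600 * card E"
      have "pc' ` ({..<n} - {0}) = parent_cells"
        using final_reached[OF final final'] by (auto simp: parent_cells_def)
      then have 2: "regs \<sigma>2 rS = N" "regs \<sigma>2 rN = n" "length (mem \<sigma>2) = mem_size" "outp \<sigma>2 = []" 
        "bits (mem \<sigma>2) 4 = {}" "bits (mem \<sigma>2) 5 = parent_cells"
        using fr2 1 B5' by (auto simp: frame_def)
      have cov: "bits (mem \<sigma>2) 2 = tree.covered" "bits (mem \<sigma>2) 3 = tree.high"
        using mk tree.spansD(3) unfolding marked_def tree.covered_def tree.high_def by blast+
      have "cover_potential {} \<le> 150 * n + 300 * card E"
        using sum_degrees by (simp add: cover_potential_def sum.distrib sum_distrib_left[symmetric])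
      then have t2': "t2 \<le> 12 + 950 * n + 1500 * card E" using t1 t2 B23 by simp
      show "WP report_com Q \<sigma>2 t2"
      proof (rule wp_report)
        fix \<sigma>' :: state and t' assume "connectivity_report {..<n} E (outp \<sigma>')" "t' \<le> t2 + 60 + 40 * n + 616 * card E"
        then show "Q \<sigma>' t'" using t2' n_pos by (intro Q) auto
      qed (use 2 cov in auto)
    qed (use 1 in auto)
  qed (use m0 in auto)
  moreover have "n mod 2 ^ w = n" "card E mod 2 ^ w = card E" "6 * card E mod 2 ^ w = 6 * card E" 
    "(n + 2) mod 2 ^ w = n + 2" "6 mod 2 ^ w = (6::nat)" "2 mod 2 ^ w = (2::nat)"
    using length_inp by (auto intro!: small_mod)
  moreover have "6 * card E + (n + 2) = N" "N mod 2 ^ w = N"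
    using length_inp small_mod[of N] N_ge by simp_all
  moreover have "0 < N" "1 < N" using N_ge by auto
  ultimately show ?thesis
    using inp_0 inp_1 w_ge
    by (simp add: main_com_def wp_simps initial_state_def \<sigma>0_def one_mod add.commute)
qed

end

theorem theorem18:
  shows "\<exists>(prog :: com) (\<kappa> :: nat) (C :: nat).
    \<forall>(n :: nat) (E :: nat set set) (inp :: nat list) (w :: nat).
      simple_graph {..<n} E \<longrightarrow> connected_graph {..<n} E \<longrightarrow> adjacency_list n E inp \<longrightarrow>
      real \<kappa> * log 2 (real n + 1) \<le> real w \<longrightarrow>
      (\<exists>s t \<sigma>. runs w inp prog (initial_state s) t \<sigma> \<and>
         connectivity_report {..<n} E (outp \<sigma>) \<and>
         t \<le> C * (n + card E) \<and>
         space_bits w prog s \<le> C * (n + card E + w))"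
\<comment> \<open>The factor 12 yields \<open>(n + 1) ^ 12 \<le> 2 ^ w\<close>: two factors bound
  the input length, which is quadratic in \<open>n\<close> at worst, and the other ten absorb its
  constants.\<close>
proof (rule exI[of _ main_com], rule exI[of _ 12], rule exI[of _ "3000 + card (com_regs main_com)"], intro allI impI)
  let ?R = "card (com_regs main_com)"
  fix n E inp w
  assume g: "simple_graph {..<n} E" and c: "connected_graph {..<n} E" and a: "adjacency_list n E inp"
    and w: "real 12 * log 2 (real n + 1) \<le> real w"
  obtain L where "adjacency n E inp L"
    using g c a unfolding adjacency_list_def adjacency_def by blast
  then interpret adjacency n E inp L .
  have "(real n + 1) ^ 12 \<le> 2 ^ w"
  proof -
    have "log 2 ((real n + 1) ^ 12) \<le> real w" using w by (simp add: log_nat_power)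
    then show ?thesis by (subst (asm) log_le_iff) (auto simp: powr_realpow)
  qed
  then have "(n + 1) ^ 12 \<le> 2 ^ w"
    by (metis (mono_tags, lifting) of_nat_1 of_nat_add of_nat_le_iff of_nat_numeral of_nat_power)
  moreover have "16 * length inp < (n + 1) ^ 12"
  proof -
    have "length inp \<le> 2 + n + 6 * (n * n)" using length_inp card_E_le by simp
    also have "\<dots> < 8 * (n + 1) ^ 2" by (simp add: power2_eq_square algebra_simps)
    \<comment> \<open>Here \<open>16 * 8\<close> is below \<open>2 ^ 10\<close>, and
      \<open>2 \<le> n + 1\<close> turns this constant into a power of \<open>n + 1\<close>.\<close>
    finally have "16 * length inp < 2 ^ 10 * (n + 1) ^ 2" by simp
    also have "\<dots> \<le> (n + 1) ^ 10 * (n + 1) ^ 2"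
      using n_pos by (intro mult_right_mono power_mono) auto
    finally show ?thesis by (simp flip: power_add)
  qed
  ultimately interpret ram n E inp L w by unfold_locales simp
  have "wp w inp main_com (\<lambda>\<sigma> t. connectivity_report {..<n} E (outp \<sigma>) \<and> t \<le> 3000 * (n + card E)) (initial_state mem_size) 0"
    by (rule wp_main) simp
  then obtain t \<sigma> where r: "runs w inp main_com (initial_state mem_size) t \<sigma>"
    "connectivity_report {..<n} E (outp \<sigma>)" "t \<le> 3000 * (n + card E)" by (auto simp: wp_def)
  \<comment> \<open>Rounding \<open>6 * N\<close> bits up to whole words wastes at most one
    word.\<close>
  have "w * mem_size \<le> 6 * length inp + w"
    by (simp add: mem_size_def distrib_left)
  then have "space_bits w main_com mem_size \<le> w * ?R + 6 * length inp + w"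
    by (simp add: space_bits_def distrib_left)
  also have "\<dots> \<le> (3000 + ?R) * (n + card E + w)"
    using length_inp n_pos by (simp add: algebra_simps)
  finally have "space_bits w main_com mem_size \<le> (3000 + ?R) * (n + card E + w)" .
  moreover have "t \<le> (3000 + ?R) * (n + card E)" using r(3) by (simp add: add_mult_distrib)
  ultimately show "\<exists>s t \<sigma>. runs w inp main_com (initial_state s) t \<sigma> \<and>
         connectivity_report {..<n} E (outp \<sigma>) \<and> t \<le> (3000 + ?R) * (n + card E) \<and>
         space_bits w main_com s \<le> (3000 + ?R) * (n + card E + w)"
    using r by blast
qed

end
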